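(* There is an algorithm which, given the rank $n$ of a free group $F$ with free basis $\mathcal{B}$ and a finite list of words $w_1,\dots,w_r$ in $F$ generating a malnormal family of cyclic subgroups, with associated decomposition space $\mathcal{D}$, determines whether or not the first Čech cohomology group $\check{\mathrm{H}}^1(\mathcal{D},\mathbb{Z})$ is trivial.
   Context: $F$ is a free group of finite rank $n$ with free basis $\mathcal{B}$, and $\mathcal{T}$ is the Cayley graph of $F$ with respect to $\mathcal{B}$ (a tree, on which $F$ acts on the left by isometries); $\partial_\infty F=\partial_\infty\mathcal{T}$ is its Gromov boundary. The family $\langle w_1\rangle,\dots,\langle w_r\rangle$ is malnormal: each $w_i\neq 1$, and if $g\langle w_i\rangle g^{-1}\cap\langle w_j\rangle\neq 1$ for some $g\in F$ then $i=j$ and $g\in\langle w_i\rangle$. The line pattern $\mathcal{L}$ is the set of lines $\{g w_i^k\}_{k\in\mathbb{Z}}$, $g\in F$, $1\le i\le r$, each identified with the bi-infinite geodesic of $\mathcal{T}$ with end points $\lim_{k\to\pm\infty} g w_i^{k}$. The decomposition space $\mathcal{D}$ is the quotient of $\partial_\infty F$ by the equivalence relation identifying the two end points of each line in $\mathcal{L}$, with the quotient topology. $\check{\mathrm{H}}^*(\mathcal{D},\mathbb{Z})$ is Čech cohomology: the direct limit, over open covers ordered by refinement, of the cohomology of the nerve. *)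

theory Defs
  imports "HOL-Analysis.Analysis" "HOL-Homology.Homology" "HOL-Library.Nat_Bijection"
begin

section \<open>Free groups\<close>

text \<open>The letter \<open>(i, True)\<close> is the basis element with index \<open>i\<close>, and \<open>(i, False)\<close> is its inverse.\<close>

type_synonym letter = "nat \<times> bool"

definition inv_letter :: "letter \<Rightarrow> letter" where
  "inv_letter a = (fst a, \<not> snd a)"

definition letters :: "nat \<Rightarrow> letter set" where
  "letters n = {..<n} \<times> UNIV"

definition reduced :: "letter list \<Rightarrow> bool" where
  "reduced w \<longleftrightarrow> successively (\<lambda>a b. b \<noteq> inv_letter a) w"

definition cancel_Cons :: "letter \<Rightarrow> letter list \<Rightarrow> letter list" where
  "cancel_Cons a w = (if w \<noteq> [] \<and> hd w = inv_letter a then tl w else a # w)"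

definition reduce :: "letter list \<Rightarrow> letter list" where
  "reduce w = foldr cancel_Cons w []"

definition free_group :: "nat \<Rightarrow> letter list monoid" where
  "free_group n =
     \<lparr>carrier = {w. set w \<subseteq> letters n \<and> reduced w},
      mult = (\<lambda>u v. reduce (u @ v)),
      one = []\<rparr>"

lemma inv_letter_inv_letter [simp]: "inv_letter (inv_letter a) = a"
  by (simp add: inv_letter_def)

lemma inv_letter_in_letters [simp]: "inv_letter a \<in> letters n \<longleftrightarrow> a \<in> letters n"
  by (cases a) (simp add: inv_letter_def letters_def)

lemma reduced_Nil [simp]: "reduced []"
  by (simp add: reduced_def)

lemma reduced_Cons: "reduced (a # w) \<longleftrightarrow> reduced w \<and> (w \<noteq> [] \<longrightarrow> hd w \<noteq> inv_letter a)"
  by (cases w) (auto simp: reduced_def)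

lemma reduced_cancel_Cons: "reduced w \<Longrightarrow> reduced (cancel_Cons a w)"
  by (cases w) (auto simp: cancel_Cons_def reduced_Cons)

lemma cancel_Cons_inverse: "reduced w \<Longrightarrow> cancel_Cons a (cancel_Cons (inv_letter a) w) = w"
  by (cases w) (auto simp: cancel_Cons_def reduced_Cons neq_Nil_conv)

lemma reduced_foldr_cancel: "reduced v \<Longrightarrow> reduced (foldr cancel_Cons u v)"
  by (induction u) (auto intro: reduced_cancel_Cons)

lemma reduced_reduce: "reduced (reduce w)"
  by (simp add: reduce_def reduced_foldr_cancel)

lemma reduce_reduced: "reduced w \<Longrightarrow> reduce w = w"
  by (induction w) (auto simp: reduce_def reduced_Cons cancel_Cons_def)

lemma set_reduce: "set (reduce w) \<subseteq> set w"
  by (induction w) (auto simp: reduce_def cancel_Cons_def dest: list.set_sel(2))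

lemma foldr_cancel_Cons_cancel:
  assumes "reduced v"
  shows "foldr cancel_Cons (cancel_Cons a u) v = cancel_Cons a (foldr cancel_Cons u v)"
proof (cases "u \<noteq> [] \<and> hd u = inv_letter a")
  case True
  then obtain u' where "u = inv_letter a # u'"
    by (cases u) auto
  then show ?thesis
    using assms by (simp add: cancel_Cons_inverse reduced_foldr_cancel cancel_Cons_def[of a "_ # _"])
qed (auto simp: cancel_Cons_def[of a u])

lemma foldr_cancel_reduce:
  assumes "reduced v"
  shows "foldr cancel_Cons (reduce u) v = foldr cancel_Cons u v"
proof (induction u)
  case (Cons a u)
  have "reduce (a # u) = cancel_Cons a (reduce u)"
    by (simp add: reduce_def)
  then show ?case
    using Cons assms by (simp add: foldr_cancel_Cons_cancel)
qed (simp add: reduce_def)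

lemma reduce_append_left: "reduce (reduce u @ v) = reduce (u @ v)"
proof -
  have "reduce (u' @ v) = foldr cancel_Cons u' (reduce v)" for u'
    by (simp add: reduce_def)
  then show ?thesis
    by (simp add: foldr_cancel_reduce reduced_reduce)
qed

lemma reduce_append_right: "reduce (u @ reduce v) = reduce (u @ v)"
proof -
  have "reduce (u @ v') = foldr cancel_Cons u (reduce v')" for v'
    by (simp add: reduce_def)
  then show ?thesis
    by (simp add: reduce_reduced reduced_reduce)
qed

lemma reduce_inverse: "reduce (rev (map inv_letter w) @ w) = []"
proof (induction w)
  case (Cons a w)
  have "reduce (rev (map inv_letter (a # w)) @ a # w)
      = reduce (rev (map inv_letter w) @ reduce ([inv_letter a, a] @ w))"
    by (simp add: reduce_append_right)
  also have "reduce ([inv_letter a, a] @ w) = reduce w"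
    using cancel_Cons_inverse[OF reduced_reduce, of "inv_letter a" w]
    by (simp add: reduce_def)
  also have "reduce (rev (map inv_letter w) @ reduce w) = []"
    using Cons by (simp add: reduce_append_right)
  finally show ?case .
qed (simp add: reduce_def)

lemma group_free_group: "group (free_group n)"
proof (rule groupI)
  fix u assume u: "u \<in> carrier (free_group n)"
  let ?v = "reduce (rev (map inv_letter u))"
  have "?v \<otimes>\<^bsub>free_group n\<^esub> u = \<one>\<^bsub>free_group n\<^esub>"
    by (simp add: free_group_def reduce_append_left reduce_inverse)
  moreover have "set (rev (map inv_letter u)) \<subseteq> letters n"
    using u by (auto simp: free_group_def simp del: split_paired_All)
  then have "?v \<in> carrier (free_group n)"
    using set_reduce[of "rev (map inv_letter u)"]
    by (simp add: free_group_def reduced_reduce)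
  ultimately show "\<exists>v\<in>carrier (free_group n). v \<otimes>\<^bsub>free_group n\<^esub> u = \<one>\<^bsub>free_group n\<^esub>"
    by blast
next
  fix u v assume "u \<in> carrier (free_group n)" "v \<in> carrier (free_group n)"
  then show "u \<otimes>\<^bsub>free_group n\<^esub> v \<in> carrier (free_group n)"
    using set_reduce[of "u @ v"] by (auto simp: free_group_def reduced_reduce)
qed (auto simp: free_group_def reduce_append_left reduce_append_right reduce_reduced)

text \<open>\<open>malnormal_family G us\<close>: the cyclic subgroups generated by the members of \<open>us\<close> form a
  malnormal family in \<open>G\<close>.\<close>

definition malnormal_family :: "('a, 'b) monoid_scheme \<Rightarrow> 'a list \<Rightarrow> bool" where
  "malnormal_family G us \<longleftrightarrow>
     (\<forall>i<length us. us ! i \<noteq> \<one>\<^bsub>G\<^esub>) \<and>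
     (\<forall>i<length us. \<forall>j<length us. \<forall>g\<in>carrier G.
        (g <#\<^bsub>G\<^esub> generate G {us ! i} #>\<^bsub>G\<^esub> inv\<^bsub>G\<^esub> g) \<inter> generate G {us ! j} \<noteq> {\<one>\<^bsub>G\<^esub>}
        \<longrightarrow> i = j \<and> g \<in> generate G {us ! i})"


section \<open>The Gromov boundary of the Cayley tree\<close>

definition cayley_edges :: "nat \<Rightarrow> (letter list \<times> letter list) set" where
  "cayley_edges n =
     {(g, g \<otimes>\<^bsub>free_group n\<^esub> [a]) | g a. g \<in> carrier (free_group n) \<and> a \<in> letters n}"

definition cayley_dist :: "nat \<Rightarrow> letter list \<Rightarrow> letter list \<Rightarrow> nat" where
  "cayley_dist n g h = (LEAST k. (g, h) \<in> cayley_edges n ^^ k)"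

text \<open>The Gromov boundary of a set \<open>V\<close> with metric \<open>d\<close> and base point \<open>e\<close>: classes of sequences
  that converge to infinity. It is applied below to the vertex set of the tree, which is
  coarsely dense in the geometric realization and so has the same boundary. The sets
  \<open>gromov_nhd V d e p r\<close>, for real \<open>r\<close>, form a neighbourhood basis of \<open>p\<close> when \<open>d\<close> is hyperbolic.\<close>

definition gromov_product :: "('v \<Rightarrow> 'v \<Rightarrow> real) \<Rightarrow> 'v \<Rightarrow> 'v \<Rightarrow> 'v \<Rightarrow> real" where
  "gromov_product d e x y = (d x e + d y e - d x y) / 2"

definition gromov_sequences :: "'v set \<Rightarrow> ('v \<Rightarrow> 'v \<Rightarrow> real) \<Rightarrow> 'v \<Rightarrow> (nat \<Rightarrow> 'v) set" where
  "gromov_sequences V d e =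
     {x. range x \<subseteq> V \<and>
         filterlim (\<lambda>(i, j). gromov_product d e (x i) (x j)) at_top (sequentially \<times>\<^sub>F sequentially)}"

definition gromov_equivalence ::
    "'v set \<Rightarrow> ('v \<Rightarrow> 'v \<Rightarrow> real) \<Rightarrow> 'v \<Rightarrow> ((nat \<Rightarrow> 'v) \<times> (nat \<Rightarrow> 'v)) set" where
  "gromov_equivalence V d e =
     {(x, y). x \<in> gromov_sequences V d e \<and> y \<in> gromov_sequences V d e \<and>
        filterlim (\<lambda>(i, j). gromov_product d e (x i) (y j)) at_top (sequentially \<times>\<^sub>F sequentially)}"

definition gromov_boundary_points ::
    "'v set \<Rightarrow> ('v \<Rightarrow> 'v \<Rightarrow> real) \<Rightarrow> 'v \<Rightarrow> (nat \<Rightarrow> 'v) set set" where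
  "gromov_boundary_points V d e = gromov_sequences V d e // gromov_equivalence V d e"

definition gromov_nhd ::
    "'v set \<Rightarrow> ('v \<Rightarrow> 'v \<Rightarrow> real) \<Rightarrow> 'v \<Rightarrow> (nat \<Rightarrow> 'v) set \<Rightarrow> real \<Rightarrow> (nat \<Rightarrow> 'v) set set" where
  "gromov_nhd V d e p r =
     {q \<in> gromov_boundary_points V d e. \<exists>x\<in>p. \<exists>y\<in>q.
        ereal r \<le> Liminf (sequentially \<times>\<^sub>F sequentially)
                    (\<lambda>(i, j). ereal (gromov_product d e (x i) (y j)))}"

definition gromov_boundary ::
    "'v set \<Rightarrow> ('v \<Rightarrow> 'v \<Rightarrow> real) \<Rightarrow> 'v \<Rightarrow> (nat \<Rightarrow> 'v) set topology" where
  "gromov_boundary V d e =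
     topology (\<lambda>U. U \<subseteq> gromov_boundary_points V d e \<and> (\<forall>p\<in>U. \<exists>r. gromov_nhd V d e p r \<subseteq> U))"

lemma openin_gromov_boundary:
  "openin (gromov_boundary V d e) U \<longleftrightarrow>
     U \<subseteq> gromov_boundary_points V d e \<and> (\<forall>p\<in>U. \<exists>r. gromov_nhd V d e p r \<subseteq> U)"
proof -
  have mono: "gromov_nhd V d e p s \<subseteq> gromov_nhd V d e p r" if "r \<le> s" for p r s
    using that unfolding gromov_nhd_def by (force intro: order_trans[of "ereal r" "ereal s"])
  have "istopology (\<lambda>U. U \<subseteq> gromov_boundary_points V d e \<and> (\<forall>p\<in>U. \<exists>r. gromov_nhd V d e p r \<subseteq> U))"
    unfolding istopology_def
  proof (intro conjI allI impI ballI; (elim conjE)?)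
    fix S T p
    assume "\<forall>p\<in>S. \<exists>r. gromov_nhd V d e p r \<subseteq> S" "\<forall>p\<in>T. \<exists>r. gromov_nhd V d e p r \<subseteq> T" "p \<in> S \<inter> T"
    then obtain r s where "gromov_nhd V d e p r \<subseteq> S" "gromov_nhd V d e p s \<subseteq> T"
      by blast
    then have "gromov_nhd V d e p (max r s) \<subseteq> S \<inter> T"
      using mono[of r "max r s" p] mono[of s "max r s" p] by auto
    then show "\<exists>r. gromov_nhd V d e p r \<subseteq> S \<inter> T" ..
  next
    fix \<K> p
    assume "\<forall>K\<in>\<K>. K \<subseteq> gromov_boundary_points V d e \<and> (\<forall>p\<in>K. \<exists>r. gromov_nhd V d e p r \<subseteq> K)"
      "p \<in> \<Union>\<K>"
    then show "\<exists>r. gromov_nhd V d e p r \<subseteq> \<Union>\<K>"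
      by (meson Sup_upper UnionE order_trans)
  qed auto
  then show ?thesis
    by (simp add: gromov_boundary_def topology_inverse')
qed

definition free_boundary :: "nat \<Rightarrow> (nat \<Rightarrow> letter list) set topology" where
  "free_boundary n =
     gromov_boundary (carrier (free_group n)) (\<lambda>g h. real (cayley_dist n g h)) \<one>\<^bsub>free_group n\<^esub>"

definition boundary_limit :: "nat \<Rightarrow> (nat \<Rightarrow> letter list) \<Rightarrow> (nat \<Rightarrow> letter list) set" where
  "boundary_limit n x =
     gromov_equivalence (carrier (free_group n)) (\<lambda>g h. real (cayley_dist n g h)) \<one>\<^bsub>free_group n\<^esub> `` {x}"


section \<open>The decomposition space of a line pattern\<close>

definition quotient_topology :: "'a topology \<Rightarrow> ('a \<times> 'a) set \<Rightarrow> 'a set topology" where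
  "quotient_topology X r = topology (\<lambda>U. U \<subseteq> topspace X // r \<and> openin X (\<Union>U))"

lemma openin_quotient_topology:
  assumes "equiv (topspace X) r"
  shows "openin (quotient_topology X r) U \<longleftrightarrow> U \<subseteq> topspace X // r \<and> openin X (\<Union>U)"
proof -
  have "istopology (\<lambda>U. U \<subseteq> topspace X // r \<and> openin X (\<Union>U))"
    unfolding istopology_def
  proof (intro conjI allI impI; (elim conjE)?)
    fix S T
    assume *: "S \<subseteq> topspace X // r" "openin X (\<Union>S)" "T \<subseteq> topspace X // r" "openin X (\<Union>T)"
    then have "\<Union>(S \<inter> T) = \<Union>S \<inter> \<Union>T"
      using quotient_disj[OF assms] by blast
    with * show "openin X (\<Union>(S \<inter> T))"
      by auto
  next
    fix \<K>
    assume "\<forall>K\<in>\<K>. K \<subseteq> topspace X // r \<and> openin X (\<Union>K)"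
    moreover have "\<Union>(\<Union>\<K>) = \<Union>(Union ` \<K>)"
      by blast
    ultimately show "openin X (\<Union>(\<Union>\<K>))"
      by auto
  qed auto
  then show ?thesis
    by (simp add: quotient_topology_def topology_inverse')
qed

lemma topspace_quotient_topology:
  assumes "equiv (topspace X) r"
  shows "topspace (quotient_topology X r) = topspace X // r"
proof -
  have "openin (quotient_topology X r) (topspace X // r)"
    using Union_quotient[OF assms] by (simp add: openin_quotient_topology[OF assms])
  then show ?thesis
    using openin_quotient_topology[OF assms] by (meson openin_subset openin_topspace subset_antisym)
qed

lemma quotient_map_quotient_topology:
  assumes "equiv (topspace X) r"
  shows "quotient_map X (quotient_topology X r) (\<lambda>x. r `` {x})"
proof -
  have "{x \<in> topspace X. r `` {x} \<in> U} = \<Union>U" if U: "U \<subseteq> topspace X // r" for U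
  proof (intro equalityI subsetI)
    fix x assume "x \<in> {x \<in> topspace X. r `` {x} \<in> U}"
    then show "x \<in> \<Union>U"
      using equiv_class_self[OF assms, of x] by blast
  next
    fix x assume "x \<in> \<Union>U"
    then obtain A where A: "x \<in> A" "A \<in> U" by blast
    then obtain y where y: "y \<in> topspace X" "A = r `` {y}"
      using U by (meson quotientE subsetD)
    then have "(y, x) \<in> r"
      using A by simp
    then have "r `` {x} = A" "x \<in> topspace X"
      using y(2) equiv_class_eq[OF assms, of y x] equiv_class_eq_iff[OF assms, of y x] by simp_all
    with A show "x \<in> {x \<in> topspace X. r `` {x} \<in> U}" by simp
  qed
  moreover have "(\<lambda>x. r `` {x}) ` topspace X = topspace X // r"
    by (simp add: quotient_def UNION_singleton_eq_range)
  ultimately show ?thesis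
    by (simp add: quotient_map_def topspace_quotient_topology[OF assms] openin_quotient_topology[OF assms])
qed

text \<open>Each line is parametrized by the integers.\<close>

definition line_pattern :: "nat \<Rightarrow> letter list list \<Rightarrow> (int \<Rightarrow> letter list) set" where
  "line_pattern n us =
     {(\<lambda>k. g \<otimes>\<^bsub>free_group n\<^esub> (u [^]\<^bsub>free_group n\<^esub> k)) | g u. g \<in> carrier (free_group n) \<and> u \<in> set us}"

definition line_endpoints ::
    "nat \<Rightarrow> (int \<Rightarrow> letter list) \<Rightarrow> (nat \<Rightarrow> letter list) set \<times> (nat \<Rightarrow> letter list) set" where
  "line_endpoints n l = (boundary_limit n (\<lambda>k. l (int k)), boundary_limit n (\<lambda>k. l (- int k)))"

text \<open>The equivalence relation on the boundary generated by the pairs of end points.\<close>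

definition endpoint_relation ::
    "nat \<Rightarrow> letter list list \<Rightarrow> ((nat \<Rightarrow> letter list) set \<times> (nat \<Rightarrow> letter list) set) set" where
  "endpoint_relation n us =
     (let E = line_endpoints n ` line_pattern n us
      in Restr ((E \<union> E\<inverse>)\<^sup>*) (topspace (free_boundary n)))"

lemma equiv_endpoint_relation: "equiv (topspace (free_boundary n)) (endpoint_relation n us)"
proof -
  let ?E = "line_endpoints n ` line_pattern n us"
  have "sym ((?E \<union> ?E\<inverse>)\<^sup>*)"
    by (intro sym_rtrancl sym_Un_converse)
  then show ?thesis
    unfolding endpoint_relation_def Let_def
    by (intro equivI refl_onI symI transI) (auto dest: symD intro: rtrancl_trans)
qed

definition decomposition_space :: "nat \<Rightarrow> letter list list \<Rightarrow> (nat \<Rightarrow> letter list) set set topology" where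
  "decomposition_space n us = quotient_topology (free_boundary n) (endpoint_relation n us)"


section \<open>Simplicial cohomology\<close>

text \<open>An abstract simplicial complex is a set \<open>K\<close> of finite nonempty sets closed under nonempty
  subsets. Cochains are integer functions on ordered simplices, in which vertices may be repeated;
  they are extended by \<open>0\<close> to all other lists.\<close>

definition ordered_simplices :: "nat \<Rightarrow> 'v set set \<Rightarrow> 'v list set" where
  "ordered_simplices p K = {vs. length vs = Suc p \<and> set vs \<in> K}"

definition cochain_group :: "nat \<Rightarrow> 'v set set \<Rightarrow> ('v list \<Rightarrow> int) monoid" where
  "cochain_group p K =
     \<lparr>carrier = {f. \<forall>vs. vs \<notin> ordered_simplices p K \<longrightarrow> f vs = 0},
      mult = (\<lambda>f g vs. f vs + g vs),
      one = (\<lambda>_. 0)\<rparr>"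

definition coboundary :: "nat \<Rightarrow> 'v set set \<Rightarrow> ('v list \<Rightarrow> int) \<Rightarrow> 'v list \<Rightarrow> int" where
  "coboundary p K f =
     (\<lambda>vs. if vs \<in> ordered_simplices (Suc p) K
           then \<Sum>i\<le>Suc p. (-1) ^ i * f (take i vs @ drop (Suc i) vs) else 0)"

definition cocycles :: "nat \<Rightarrow> 'v set set \<Rightarrow> ('v list \<Rightarrow> int) set" where
  "cocycles p K = kernel (cochain_group p K) (cochain_group (Suc p) K) (coboundary p K)"

definition coboundaries :: "nat \<Rightarrow> 'v set set \<Rightarrow> ('v list \<Rightarrow> int) set" where
  "coboundaries p K =
     (case p of 0 \<Rightarrow> {\<one>\<^bsub>cochain_group 0 K\<^esub>}
      | Suc q \<Rightarrow> coboundary q K ` carrier (cochain_group q K))"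

definition simplicial_cohomology :: "nat \<Rightarrow> 'v set set \<Rightarrow> ('v list \<Rightarrow> int) set monoid" where
  "simplicial_cohomology p K = (subgroup_generated (cochain_group p K) (cocycles p K)) Mod coboundaries p K"

text \<open>The maps induced by a simplicial map \<open>\<phi>\<close> from \<open>L\<close> to \<open>K\<close>.\<close>

definition cochain_pullback ::
    "nat \<Rightarrow> ('w \<Rightarrow> 'v) \<Rightarrow> 'w set set \<Rightarrow> ('v list \<Rightarrow> int) \<Rightarrow> 'w list \<Rightarrow> int" where
  "cochain_pullback p \<phi> L f = (\<lambda>vs. if vs \<in> ordered_simplices p L then f (map \<phi> vs) else 0)"

definition cohomology_pullback ::
    "nat \<Rightarrow> ('w \<Rightarrow> 'v) \<Rightarrow> 'w set set \<Rightarrow> ('v list \<Rightarrow> int) set \<Rightarrow> ('w list \<Rightarrow> int) set" where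
  "cohomology_pullback p \<phi> L c =
     (\<Union>f\<in>c. coboundaries p L #>\<^bsub>cochain_group p L\<^esub> cochain_pullback p \<phi> L f)"


section \<open>Cech cohomology\<close>

text \<open>Direct limit of groups \<open>G i\<close>, \<open>i \<in> I\<close>, with maps \<open>\<rho> i j\<close> from \<open>G i\<close> to \<open>G j\<close> whenever
  \<open>R i j\<close>. Any two elements of the limit have representatives with a common index.\<close>

definition direct_limit_rel ::
    "'i set \<Rightarrow> ('i \<Rightarrow> 'i \<Rightarrow> bool) \<Rightarrow> ('i \<Rightarrow> 'a monoid) \<Rightarrow> ('i \<Rightarrow> 'i \<Rightarrow> 'a \<Rightarrow> 'a) \<Rightarrow>
      (('i \<times> 'a) \<times> ('i \<times> 'a)) set" where
  "direct_limit_rel I R G \<rho> =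
     {((i, a), (j, b)) | i a j b. i \<in> I \<and> a \<in> carrier (G i) \<and> j \<in> I \<and> b \<in> carrier (G j) \<and>
        (\<exists>k\<in>I. R i k \<and> R j k \<and> \<rho> i k a = \<rho> j k b)}"

definition direct_limit ::
    "'i set \<Rightarrow> ('i \<Rightarrow> 'i \<Rightarrow> bool) \<Rightarrow> ('i \<Rightarrow> 'a monoid) \<Rightarrow> ('i \<Rightarrow> 'i \<Rightarrow> 'a \<Rightarrow> 'a) \<Rightarrow>
      ('i \<times> 'a) set monoid" where
  "direct_limit I R G \<rho> =
     \<lparr>carrier = (SIGMA i:I. carrier (G i)) // direct_limit_rel I R G \<rho>,
      mult = (\<lambda>X Y. direct_limit_rel I R G \<rho> ``
                {(k, a \<otimes>\<^bsub>G k\<^esub> b) | k a b. (k, a) \<in> X \<and> (k, b) \<in> Y}),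
      one = direct_limit_rel I R G \<rho> `` {(k, \<one>\<^bsub>G k\<^esub>) | k. k \<in> I}\<rparr>"

definition open_covers :: "'a topology \<Rightarrow> 'a set set set" where
  "open_covers X = {\<U>. (\<forall>U\<in>\<U>. openin X U) \<and> \<Union>\<U> = topspace X}"

definition refines :: "'a set set \<Rightarrow> 'a set set \<Rightarrow> bool" where
  "refines \<V> \<U> \<longleftrightarrow> (\<forall>V\<in>\<V>. \<exists>U\<in>\<U>. V \<subseteq> U)"

definition nerve :: "'a set set \<Rightarrow> 'a set set set" where
  "nerve \<U> = {\<sigma>. finite \<sigma> \<and> \<sigma> \<noteq> {} \<and> \<sigma> \<subseteq> \<U> \<and> \<Inter>\<sigma> \<noteq> {}}"

text \<open>All choices of a refinement projection are contiguous, so they induce the same map on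
  cohomology.\<close>

definition refinement_projection :: "'a set set \<Rightarrow> 'a set set \<Rightarrow> 'a set \<Rightarrow> 'a set" where
  "refinement_projection \<U> \<V> = (\<lambda>V. SOME U. U \<in> \<U> \<and> V \<subseteq> U)"

definition cech_cohomology ::
    "nat \<Rightarrow> 'a topology \<Rightarrow> ('a set set \<times> ('a set list \<Rightarrow> int) set) set monoid" where
  "cech_cohomology p X =
     direct_limit (open_covers X) (\<lambda>\<U> \<V>. refines \<V> \<U>)
       (\<lambda>\<U>. simplicial_cohomology p (nerve \<U>))
       (\<lambda>\<U> \<V>. cohomology_pullback p (refinement_projection \<U> \<V>) (nerve \<V>))"


section \<open>Algorithms\<close>

text \<open>Algorithms are partial recursive functions; \<open>rec_eval f xs y\<close> means that the evaluation of
  \<open>f\<close> on the arguments \<open>xs\<close> terminates with value \<open>y\<close>.\<close>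

datatype recf =
  Zero
| Succ
| Proj nat
| Comp recf "recf list"
| PrimRec recf recf
| Mu recf

inductive rec_eval :: "recf \<Rightarrow> nat list \<Rightarrow> nat \<Rightarrow> bool" where
  rec_eval_Zero: "rec_eval Zero xs 0"
| rec_eval_Succ: "rec_eval Succ [x] (Suc x)"
| rec_eval_Proj: "i < length xs \<Longrightarrow> rec_eval (Proj i) xs (xs ! i)"
| rec_eval_Comp: "list_all2 (\<lambda>g y. rec_eval g xs y) gs ys \<Longrightarrow> rec_eval f ys z
    \<Longrightarrow> rec_eval (Comp f gs) xs z"
| rec_eval_PrimRec_0: "rec_eval f xs y \<Longrightarrow> rec_eval (PrimRec f g) (0 # xs) y"
| rec_eval_PrimRec_Suc: "rec_eval (PrimRec f g) (n # xs) y \<Longrightarrow> rec_eval g (n # y # xs) z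
    \<Longrightarrow> rec_eval (PrimRec f g) (Suc n # xs) z"
| rec_eval_Mu: "rec_eval f (n # xs) 0 \<Longrightarrow> \<forall>m<n. \<exists>y>0. rec_eval f (m # xs) y
    \<Longrightarrow> rec_eval (Mu f) xs n"

lemma rec_eval_deterministic: "rec_eval f xs y \<Longrightarrow> rec_eval f xs z \<Longrightarrow> y = z"
proof (induction arbitrary: z rule: rec_eval.induct)
  case (rec_eval_Comp xs gs ys f y)
  from rec_eval_Comp.prems obtain ys' where
    ys': "list_all2 (\<lambda>g y. rec_eval g xs y) gs ys'" "rec_eval f ys' z"
    by (cases rule: rec_eval.cases) auto
  have "ys = ys'"
    using rec_eval_Comp.IH(1) ys'(1) by (auto simp: list_all2_conv_all_nth intro!: nth_equalityI)
  then show ?case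
    using rec_eval_Comp.IH(2) ys'(2) by blast
next
  case (rec_eval_PrimRec_Suc f g n xs y z')
  from rec_eval_PrimRec_Suc.prems show ?case
    by (cases rule: rec_eval.cases) (use rec_eval_PrimRec_Suc.IH in blast)
next
  case (rec_eval_Mu f n xs)
  from rec_eval_Mu.prems have z: "rec_eval f (z # xs) 0" "\<forall>m<z. \<exists>y>0. rec_eval f (m # xs) y"
    by (cases rule: rec_eval.cases; simp)+
  show ?case
  proof (cases n z rule: linorder_cases)
    case less
    with z(2) show ?thesis using rec_eval_Mu.IH(1) by fastforce
  next
    case greater
    with z(1) show ?thesis using rec_eval_Mu.IH(2) by fastforce
  qed
qed (erule rec_eval.cases; simp)+

text \<open>Goedel numbers of finite lists of words.\<close>

definition encode_letter :: "letter \<Rightarrow> nat" where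
  "encode_letter a = 2 * fst a + of_bool (snd a)"

definition encode_words :: "letter list list \<Rightarrow> nat" where
  "encode_words ws = list_encode (map (\<lambda>w. list_encode (map encode_letter w)) ws)"

end

theory Submission
  imports Defs "HOL-Library.Sublist" "HOL-Library.Z2" "HOL-Library.Function_Algebras"
begin

text \<open>Collapsing pairs of points of a Cantor set kills the first Cech cohomology exactly if each pair
  can be split by a clopen set that splits no other pair: a locally constant function with prescribed
  jumps at the pairs turns a cocycle into a coboundary, and conversely the cocycle that winds once
  around a single pair is a coboundary only if such a clopen set exists. By malnormality distinct
  lines have disjoint pairs of end points, so this applies to the decomposition space.

  Over the field with two elements the existence of all these clopen sets is dual to the absence of a
  nonempty set of lines that crosses every edge of the Cayley tree an even number of times. Such a
  set is described by the patterns it leaves at the vertices, which are subject only to constraints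
  at single vertices and along single edges. Since the graph is a tree, it exists if and only if some
  set of patterns is closed under extension along each edge, and there are only finitely many
  candidates to inspect.\<close>

section \<open>Cech cohomology in terms of cocycles on covers\<close>

text \<open>Integer coefficients reduce to parity as follows. An integer valued locally constant
  function with an odd jump at one pair and no jump at the others gives, read mod 2, a clopen set
  that splits only that pair; conversely, integer multiples of indicators of such sets produce every
  prescribed jump. Thus integral cohomology is governed by linear algebra over two elements.

  The vector space spanned by the lines is infinite dimensional, and a functional on it may take the
  value 1 on infinitely many lines. The dual object is therefore an arbitrary function on lines and
  not a finite cycle. This is what allows it to be described locally: only finitely many passages of
  lines cross a given edge, so each edge imposes a finite parity condition, and no global finiteness
  has to be tested.

  Local pieces can be assembled because each vertex is reached from the identity by exactly one
  reduced word: successors are chosen freely, with no closed circuits along which the choices would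
  have to agree.\<close>

lemma comm_group_cochain_group: "comm_group (cochain_group p K)"
proof (rule comm_groupI)
  fix f assume "f \<in> carrier (cochain_group p K)"
  then show "\<exists>g\<in>carrier (cochain_group p K). g \<otimes>\<^bsub>cochain_group p K\<^esub> f = \<one>\<^bsub>cochain_group p K\<^esub>"
    by (intro bexI[of _ "\<lambda>vs. - f vs"]) (auto simp: cochain_group_def)
qed (auto simp: cochain_group_def fun_eq_iff)

lemma group_cochain_group: "group (cochain_group p K)"
  using comm_group_cochain_group comm_group.axioms(2) by blast

lemma coboundary_closed: "coboundary p K f \<in> carrier (cochain_group (Suc p) K)"
  by (simp add: cochain_group_def coboundary_def)

lemma coboundary_add:
  "coboundary p K (\<lambda>vs. f vs + g vs) = (\<lambda>vs. coboundary p K f vs + coboundary p K g vs)"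
  by (auto simp: coboundary_def fun_eq_iff sum.distrib algebra_simps)

lemma group_hom_coboundary:
  "group_hom (cochain_group p K) (cochain_group (Suc p) K) (coboundary p K)"
proof -
  have "coboundary p K \<in> hom (cochain_group p K) (cochain_group (Suc p) K)"
    by (rule homI) (auto simp: coboundary_closed, auto simp: cochain_group_def coboundary_add)
  then show ?thesis
    by (simp add: group_hom_def group_hom_axioms_def group_cochain_group)
qed

lemma subgroup_cocycles: "subgroup (cocycles p K) (cochain_group p K)"
  unfolding cocycles_def by (rule group_hom.subgroup_kernel[OF group_hom_coboundary])

lemma subgroup_coboundaries: "subgroup (coboundaries p K) (cochain_group p K)"
proof (cases p)
  case 0
  then show ?thesis
    by (simp add: coboundaries_def group.triv_subgroup group_cochain_group)
next
  case (Suc q)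
  have "subgroup (coboundary q K ` carrier (cochain_group q K)) (cochain_group (Suc q) K)"
    by (rule group_hom.img_is_subgroup[OF group_hom_coboundary])
  then show ?thesis
    by (simp add: coboundaries_def Suc)
qed

text \<open>The cocycles already form a subgroup, so passing to the generated subgroup adds nothing
  and the classes are the plain cosets of cocycles.\<close>

lemma carrier_simplicial_cohomology:
  "carrier (simplicial_cohomology p K) =
     (\<lambda>c. coboundaries p K #>\<^bsub>cochain_group p K\<^esub> c) ` cocycles p K"
proof -
  have "generate (cochain_group p K) (carrier (cochain_group p K) \<inter> cocycles p K) = cocycles p K"
    using subgroup_cocycles[of p K]
    by (metis group.generateI group_cochain_group inf_absorb2 subgroup.subset subset_refl
        group.generate_subgroup_incl subset_antisym generate.incl subsetI)
  then show ?thesis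
    by (auto simp: simplicial_cohomology_def FactGroup_def RCOSETS_def r_coset_def
        carrier_subgroup_generated)
qed

lemma one_simplicial_cohomology: "\<one>\<^bsub>simplicial_cohomology p K\<^esub> = coboundaries p K"
  by (simp add: simplicial_cohomology_def FactGroup_def)

lemma coset_coboundaries_self:
  "f \<in> coboundaries p K \<Longrightarrow> coboundaries p K #>\<^bsub>cochain_group p K\<^esub> f = coboundaries p K"
  using group.coset_join2[OF group_cochain_group _ subgroup_coboundaries]
    subgroup.subset[OF subgroup_coboundaries] by blast

lemma one_simplicial_cohomology_closed:
  "coboundaries p K \<in> carrier (simplicial_cohomology p K)"
  using coset_coboundaries_self[OF subgroup.one_closed[OF subgroup_coboundaries]]
    subgroup.one_closed[OF subgroup_cocycles] unfolding carrier_simplicial_cohomology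
  by (metis image_eqI)

lemma mult_one_simplicial_cohomology:
  "coboundaries p K \<otimes>\<^bsub>simplicial_cohomology p K\<^esub> coboundaries p K = coboundaries p K"
proof -
  have "coboundaries p K <#>\<^bsub>cochain_group p K\<^esub> coboundaries p K = coboundaries p K"
    by (rule group.subgroup_mult_id[OF group_cochain_group subgroup_coboundaries])
  then show ?thesis
    by (simp add: simplicial_cohomology_def FactGroup_def set_mult_def)
qed

text \<open>Images are taken as sets, so vertices may be collapsed; this suits cochains on lists
  with repetitions.\<close>

definition simplicial_map :: "('w \<Rightarrow> 'v) \<Rightarrow> 'w set set \<Rightarrow> 'v set set \<Rightarrow> bool" where
  "simplicial_map \<phi> L K \<longleftrightarrow> (\<forall>s\<in>L. \<phi> ` s \<in> K)"

text \<open>Deleting an entry commutes with applying \<open>\<phi>\<close> entrywise. Closure of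
  \<open>L\<close> under nonempty faces keeps the shortened lists among the simplices, where the
  pullback is not cut off to 0.\<close>

lemma cochain_pullback_coboundary:
  assumes "simplicial_map \<phi> L K" and sub: "\<And>s t. s \<in> L \<Longrightarrow> t \<subseteq> s \<Longrightarrow> t \<noteq> {} \<Longrightarrow> t \<in> L"
  shows "cochain_pullback (Suc p) \<phi> L (coboundary p K f) = coboundary p L (cochain_pullback p \<phi> L f)"
proof
  fix vs
  show "cochain_pullback (Suc p) \<phi> L (coboundary p K f) vs = coboundary p L (cochain_pullback p \<phi> L f) vs"
  proof (cases "vs \<in> ordered_simplices (Suc p) L")
    case True
    then have "map \<phi> vs \<in> ordered_simplices (Suc p) K"
      using assms(1) by (auto simp: ordered_simplices_def simplicial_map_def)
    moreover have "take i vs @ drop (Suc i) vs \<in> ordered_simplices p L" if "i \<le> Suc p" for i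
    proof -
      have "set (take i vs @ drop (Suc i) vs) \<in> L"
      proof (rule sub)
        show "set vs \<in> L" using True by (simp add: ordered_simplices_def)
        show "set (take i vs @ drop (Suc i) vs) \<subseteq> set vs"
          by (auto dest: in_set_takeD in_set_dropD)
        have "length (take i vs @ drop (Suc i) vs) = Suc p"
          using True that by (auto simp: ordered_simplices_def)
        then show "set (take i vs @ drop (Suc i) vs) \<noteq> {}" by (metis length_0_conv nat.simps(3) set_empty)
      qed
      then show ?thesis using True that by (auto simp: ordered_simplices_def)
    qed
    ultimately show ?thesis using True
      by (simp add: cochain_pullback_def coboundary_def take_map drop_map)
  qed (simp add: cochain_pullback_def coboundary_def)
qed

lemma cochain_pullback_add:
  "cochain_pullback p \<phi> L (\<lambda>vs. f vs + g vs) =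
     (\<lambda>vs. cochain_pullback p \<phi> L f vs + cochain_pullback p \<phi> L g vs)"
  by (auto simp: cochain_pullback_def)

lemma cochain_pullback_coboundaries:
  assumes "simplicial_map \<phi> L K" and "\<And>s t. s \<in> L \<Longrightarrow> t \<subseteq> s \<Longrightarrow> t \<noteq> {} \<Longrightarrow> t \<in> L"
    and "f \<in> coboundaries p K"
  shows "cochain_pullback p \<phi> L f \<in> coboundaries p L"
proof (cases p)
  case 0
  then show ?thesis using assms(3)
    by (auto simp: coboundaries_def cochain_group_def cochain_pullback_def fun_eq_iff)
next
  case (Suc q)
  then obtain g where "f = coboundary q K g"
    using assms(3) by (auto simp: coboundaries_def)
  moreover have "cochain_pullback q \<phi> L g \<in> carrier (cochain_group q L)"
    by (simp add: cochain_group_def cochain_pullback_def)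
  ultimately show ?thesis
    using cochain_pullback_coboundary[OF assms(1,2)] by (auto simp: coboundaries_def Suc)
qed

text \<open>\<open>cohomology_pullback\<close> unites cosets over all representatives. These differ
  by coboundaries, which pull back to coboundaries, so a single representative decides; the forward
  direction uses that \<open>c\<close> lies in its own coset.\<close>

lemma cohomology_pullback_eq_one_iff:
  assumes "simplicial_map \<phi> L K" and "\<And>s t. s \<in> L \<Longrightarrow> t \<subseteq> s \<Longrightarrow> t \<noteq> {} \<Longrightarrow> t \<in> L"
  shows "cohomology_pullback p \<phi> L (coboundaries p K #>\<^bsub>cochain_group p K\<^esub> c) = coboundaries p L
     \<longleftrightarrow> cochain_pullback p \<phi> L c \<in> coboundaries p L"
proof
  interpret BL: subgroup "coboundaries p L" "cochain_group p L" by (rule subgroup_coboundaries)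
  interpret BK: subgroup "coboundaries p K" "cochain_group p K" by (rule subgroup_coboundaries)
  have oneL: "(\<lambda>_. 0) \<in> coboundaries p L" using BL.one_closed by (simp add: cochain_group_def)
  have oneK: "(\<lambda>_. 0) \<in> coboundaries p K" using BK.one_closed by (simp add: cochain_group_def)
  {
    assume *: "cohomology_pullback p \<phi> L (coboundaries p K #>\<^bsub>cochain_group p K\<^esub> c) = coboundaries p L"
    have "c \<in> coboundaries p K #>\<^bsub>cochain_group p K\<^esub> c"
      using oneK by (force simp: r_coset_def cochain_group_def)
    moreover have "cochain_pullback p \<phi> L c \<in> coboundaries p L #>\<^bsub>cochain_group p L\<^esub> cochain_pullback p \<phi> L c"
      using oneL by (force simp: r_coset_def cochain_group_def)
    ultimately have "cochain_pullback p \<phi> L c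
        \<in> cohomology_pullback p \<phi> L (coboundaries p K #>\<^bsub>cochain_group p K\<^esub> c)"
      unfolding cohomology_pullback_def by blast
    then show "cochain_pullback p \<phi> L c \<in> coboundaries p L" using * by simp
  }
  {
    assume c: "cochain_pullback p \<phi> L c \<in> coboundaries p L"
    have "cochain_pullback p \<phi> L f \<in> coboundaries p L"
      if f: "f \<in> coboundaries p K #>\<^bsub>cochain_group p K\<^esub> c" for f
    proof -
      obtain b where b: "b \<in> coboundaries p K" "f = (\<lambda>vs. b vs + c vs)"
        using f by (auto simp: r_coset_def cochain_group_def)
      then show ?thesis
        using BL.m_closed[OF cochain_pullback_coboundaries[OF assms b(1)] c]
        by (simp add: cochain_pullback_add cochain_group_def)
    qed
    moreover have "c \<in> coboundaries p K #>\<^bsub>cochain_group p K\<^esub> c"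
      using oneK by (force simp: r_coset_def cochain_group_def)
    ultimately show "cohomology_pullback p \<phi> L (coboundaries p K #>\<^bsub>cochain_group p K\<^esub> c) = coboundaries p L"
      unfolding cohomology_pullback_def using coset_coboundaries_self
      by (auto simp: coset_coboundaries_self)
  }
qed

section \<open>Refinement maps and vanishing of the direct limit\<close>

lemma nerve_subset: "s \<in> nerve \<U> \<Longrightarrow> t \<subseteq> s \<Longrightarrow> t \<noteq> {} \<Longrightarrow> t \<in> nerve \<U>"
  using Inter_anti_mono[of t s] unfolding nerve_def by (auto intro: finite_subset)

lemma refinement_projection:
  assumes "refines \<V> \<U>" "V \<in> \<V>"
  shows "refinement_projection \<U> \<V> V \<in> \<U>" "V \<subseteq> refinement_projection \<U> \<V> V"
proof -
  have "\<exists>U. U \<in> \<U> \<and> V \<subseteq> U" using assms by (auto simp: refines_def)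
  then show "refinement_projection \<U> \<V> V \<in> \<U>" "V \<subseteq> refinement_projection \<U> \<V> V"
    unfolding refinement_projection_def by (metis (mono_tags, lifting) someI_ex)+
qed

text \<open>A point common to the members of a simplex remains common to the larger sets that
  contain them.\<close>

lemma simplicial_map_refinement_projection:
  assumes "refines \<V> \<U>"
  shows "simplicial_map (refinement_projection \<U> \<V>) (nerve \<V>) (nerve \<U>)"
  unfolding simplicial_map_def
proof
  fix s assume s: "s \<in> nerve \<V>"
  then obtain x where "x \<in> \<Inter>s" by (auto simp: nerve_def)
  then have "x \<in> \<Inter> (refinement_projection \<U> \<V> ` s)"
    using s refinement_projection[OF assms] by (auto simp: nerve_def)
  then show "refinement_projection \<U> \<V> ` s \<in> nerve \<U>"
    using s refinement_projection(1)[OF assms] by (auto simp: nerve_def)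
qed

lemma refines_refl: "refines \<U> \<U>"
  by (auto simp: refines_def)

lemma refines_trans: "refines \<W> \<V> \<Longrightarrow> refines \<V> \<U> \<Longrightarrow> refines \<W> \<U>"
  unfolding refines_def by (meson order_trans)

lemma common_refinement:
  assumes "\<U> \<in> open_covers X" "\<V> \<in> open_covers X"
  obtains \<W> where "\<W> \<in> open_covers X" "refines \<W> \<U>" "refines \<W> \<V>"
proof
  let ?W = "{U \<inter> V | U V. U \<in> \<U> \<and> V \<in> \<V>}"
  have "\<Union>?W = \<Union>\<U> \<inter> \<Union>\<V>" by blast
  then show "?W \<in> open_covers X"
    using assms by (auto simp: open_covers_def)
  show "refines ?W \<U>" "refines ?W \<V>" by (auto simp: refines_def)
qed

text \<open>Asking the class to vanish on all further refinements spares the comparison of composed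
  refinement projections.\<close>

lemma trivial_cech_cohomologyI:
  assumes kill: "\<And>\<U> c. \<U> \<in> open_covers X \<Longrightarrow> c \<in> cocycles p (nerve \<U>) \<Longrightarrow>
     \<exists>\<V>\<in>open_covers X. refines \<V> \<U> \<and>
       (\<forall>\<W>\<in>open_covers X. refines \<W> \<V> \<longrightarrow>
          cochain_pullback p (refinement_projection \<U> \<W>) (nerve \<W>) c \<in> coboundaries p (nerve \<W>))"
  shows "trivial_group (cech_cohomology p X)"
proof -
  let ?R = "\<lambda>\<U> \<V>. refines \<V> \<U>"
  let ?G = "\<lambda>\<U>. simplicial_cohomology p (nerve \<U>)"
  let ?\<rho> = "\<lambda>\<U> \<V>. cohomology_pullback p (refinement_projection \<U> \<V>) (nerve \<V>)"
  let ?rel = "direct_limit_rel (open_covers X) ?R ?G ?\<rho>"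
  let ?S = "SIGMA \<U>:open_covers X. carrier (?G \<U>)"
  have all: "(x, y) \<in> ?rel" if xy: "x \<in> ?S" "y \<in> ?S" for x y
  proof -
    have *: "\<exists>\<V>\<in>open_covers X. refines \<V> \<U> \<and>
       (\<forall>\<W>\<in>open_covers X. refines \<W> \<V> \<longrightarrow> ?\<rho> \<U> \<W> a = coboundaries p (nerve \<W>))"
      if "(\<U>, a) \<in> ?S" for \<U> a
    proof -
      from that obtain c where \<U>: "\<U> \<in> open_covers X" and c: "c \<in> cocycles p (nerve \<U>)"
        and a: "a = coboundaries p (nerve \<U>) #>\<^bsub>cochain_group p (nerve \<U>)\<^esub> c"
        by (auto simp: carrier_simplicial_cohomology)
      obtain \<V> where \<V>: "\<V> \<in> open_covers X" "refines \<V> \<U>"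
        and k: "\<And>\<W>. \<W> \<in> open_covers X \<Longrightarrow> refines \<W> \<V> \<Longrightarrow>
          cochain_pullback p (refinement_projection \<U> \<W>) (nerve \<W>) c \<in> coboundaries p (nerve \<W>)"
        using kill[OF \<U> c] by blast
      have "?\<rho> \<U> \<W> a = coboundaries p (nerve \<W>)" if "\<W> \<in> open_covers X" "refines \<W> \<V>" for \<W>
        using k[OF that] refines_trans[OF that(2) \<V>(2)] unfolding a
        by (subst cohomology_pullback_eq_one_iff)
          (auto intro: simplicial_map_refinement_projection nerve_subset)
      then show ?thesis using \<V> by blast
    qed
    obtain \<U> a \<U>' a' where xy': "x = (\<U>, a)" "y = (\<U>', a')" by (metis surj_pair)
    obtain \<V> where \<V>: "\<V> \<in> open_covers X" "refines \<V> \<U>"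
        "\<And>\<W>. \<W> \<in> open_covers X \<Longrightarrow> refines \<W> \<V> \<Longrightarrow> ?\<rho> \<U> \<W> a = coboundaries p (nerve \<W>)"
      using *[of \<U> a] xy xy' by blast
    obtain \<V>' where \<V>': "\<V>' \<in> open_covers X" "refines \<V>' \<U>'"
        "\<And>\<W>. \<W> \<in> open_covers X \<Longrightarrow> refines \<W> \<V>' \<Longrightarrow> ?\<rho> \<U>' \<W> a' = coboundaries p (nerve \<W>)"
      using *[of \<U>' a'] xy xy' by blast
    obtain \<W> where \<W>: "\<W> \<in> open_covers X" "refines \<W> \<V>" "refines \<W> \<V>'"
      using common_refinement[OF \<V>(1) \<V>'(1)] .
    then have "?\<rho> \<U> \<W> a = ?\<rho> \<U>' \<W> a'" using \<V>(3) \<V>'(3) by simp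
    moreover have "refines \<W> \<U>" "refines \<W> \<U>'"
      using \<W> \<V>(2) \<V>'(2) refines_trans by blast+
    ultimately show ?thesis
      using xy \<W>(1) unfolding direct_limit_rel_def xy' by blast
  qed
  \<comment> \<open>Any two classes agree far enough along the limit, so the relation is total and
    the quotient has at most one point; the one-member cover shows that it has one.\<close>
  have rel: "?rel = ?S \<times> ?S"
    using all by (force simp: direct_limit_rel_def)
  have img: "?rel `` A = ?S" if "A \<subseteq> ?S" "A \<noteq> {}" for A
    unfolding rel using that by blast
  have cov: "{topspace X} \<in> open_covers X" by (simp add: open_covers_def)
  then have mem: "({topspace X}, coboundaries p (nerve {topspace X})) \<in> ?S"
    by (simp add: one_simplicial_cohomology_closed)
  have carr: "carrier (cech_cohomology p X) = {?S}"
  proof -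
    have "?S // ?rel = {?S}" unfolding quotient_def using img[of "{_}"] mem by blast
    then show ?thesis by (simp add: cech_cohomology_def direct_limit_def)
  qed
  have one: "\<one>\<^bsub>cech_cohomology p X\<^esub> = ?S"
  proof -
    have "?rel `` {(k, \<one>\<^bsub>?G k\<^esub>) | k. k \<in> open_covers X} = ?S"
      using cov by (intro img) (auto simp: one_simplicial_cohomology one_simplicial_cohomology_closed)
    then show ?thesis by (simp add: cech_cohomology_def direct_limit_def)
  qed
  have mult: "?S \<otimes>\<^bsub>cech_cohomology p X\<^esub> ?S = ?S"
  proof -
    have "({topspace X}, coboundaries p (nerve {topspace X}))
        \<in> {(k, a \<otimes>\<^bsub>?G k\<^esub> b) | k a b. (k, a) \<in> ?S \<and> (k, b) \<in> ?S}"
      using mem mult_one_simplicial_cohomology by force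
    then have "?rel `` {(k, a \<otimes>\<^bsub>?G k\<^esub> b) | k a b. (k, a) \<in> ?S \<and> (k, b) \<in> ?S} = ?S"
      unfolding rel using mem by blast
    then show ?thesis by (simp add: cech_cohomology_def direct_limit_def)
  qed
  have "group (cech_cohomology p X)"
    by (rule groupI) (simp_all add: carr one mult)
  then show ?thesis by (simp add: trivial_group_def carr one)
qed

text \<open>The class of \<open>c\<close> in the limit equals the image of all neutral elements.
  Comparing both images at the zero class over \<open>\<U>\<close> relates the class of
  \<open>c\<close> directly to that zero class, hence gives one refinement on which their pullbacks
  agree.\<close>

lemma trivial_cech_cohomologyD:
  assumes triv: "trivial_group (cech_cohomology p X)"
    and \<U>: "\<U> \<in> open_covers X" and c: "c \<in> cocycles p (nerve \<U>)"
  shows "\<exists>\<V>\<in>open_covers X. refines \<V> \<U> \<and>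
     cochain_pullback p (refinement_projection \<U> \<V>) (nerve \<V>) c \<in> coboundaries p (nerve \<V>)"
proof -
  let ?R = "\<lambda>\<U> \<V>. refines \<V> \<U>"
  let ?G = "\<lambda>\<U>. simplicial_cohomology p (nerve \<U>)"
  let ?\<rho> = "\<lambda>\<U> \<V>. cohomology_pullback p (refinement_projection \<U> \<V>) (nerve \<V>)"
  let ?rel = "direct_limit_rel (open_covers X) ?R ?G ?\<rho>"
  let ?S = "SIGMA \<U>:open_covers X. carrier (?G \<U>)"
  let ?B = "coboundaries p (nerve \<U>)"
  define a where "a = ?B #>\<^bsub>cochain_group p (nerve \<U>)\<^esub> c"
  have "(\<U>, a) \<in> ?S" using \<U> c by (simp add: a_def carrier_simplicial_cohomology)
  then have "?rel `` {(\<U>, a)} \<in> carrier (cech_cohomology p X)"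
    by (auto simp: cech_cohomology_def direct_limit_def quotient_def)
  then have "?rel `` {(\<U>, a)} = \<one>\<^bsub>cech_cohomology p X\<^esub>"
    using triv by (auto simp: trivial_group_def)
  also have "\<dots> = ?rel `` {(k, coboundaries p (nerve k)) | k. k \<in> open_covers X}"
    by (simp add: cech_cohomology_def direct_limit_def one_simplicial_cohomology)
  finally have eq: "?rel `` {(\<U>, a)} = \<dots>" .
  have "((\<U>, ?B), (\<U>, ?B)) \<in> ?rel"
    unfolding direct_limit_rel_def
    using \<U> refines_refl one_simplicial_cohomology_closed by blast
  then have "(\<U>, ?B) \<in> ?rel `` {(k, coboundaries p (nerve k)) | k. k \<in> open_covers X}"
    using \<U> by blast
  then have "((\<U>, a), (\<U>, ?B)) \<in> ?rel" using eq by blast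
  then obtain \<V> where \<V>: "\<V> \<in> open_covers X" "refines \<V> \<U>" "?\<rho> \<U> \<V> a = ?\<rho> \<U> \<V> ?B"
    unfolding direct_limit_rel_def by blast
  \<comment> \<open>The zero class is written as the coset of the zero cochain, so that the
    criterion for vanishing pullbacks applies to it too.\<close>
  have "?B = ?B #>\<^bsub>cochain_group p (nerve \<U>)\<^esub> \<one>\<^bsub>cochain_group p (nerve \<U>)\<^esub>"
    by (metis coset_coboundaries_self subgroup.one_closed subgroup_coboundaries)
  moreover have "cochain_pullback p (refinement_projection \<U> \<V>) (nerve \<V>) \<one>\<^bsub>cochain_group p (nerve \<U>)\<^esub>
      \<in> coboundaries p (nerve \<V>)"
    by (rule cochain_pullback_coboundaries[OF simplicial_map_refinement_projection[OF \<V>(2)]])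
      (auto intro: nerve_subset subgroup.one_closed[OF subgroup_coboundaries])
  ultimately have "?\<rho> \<U> \<V> ?B = coboundaries p (nerve \<V>)"
    by (metis (no_types, lifting) cohomology_pullback_eq_one_iff nerve_subset
        simplicial_map_refinement_projection \<V>(2))
  then have "cochain_pullback p (refinement_projection \<U> \<V>) (nerve \<V>) c \<in> coboundaries p (nerve \<V>)"
    using \<V>(3) unfolding a_def
    by (metis (no_types, lifting) cohomology_pullback_eq_one_iff nerve_subset
        simplicial_map_refinement_projection \<V>(2))
  then show ?thesis using \<V> by blast
qed

section \<open>Identifying pairs of points in a zero-dimensional compact space\<close>

lemma nerve_two_iff: "{U, V} \<in> nerve \<U> \<longleftrightarrow> U \<in> \<U> \<and> V \<in> \<U> \<and> U \<inter> V \<noteq> {}"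
  by (auto simp: nerve_def)

lemma nerve_three_iff:
  "{U, V, W} \<in> nerve \<U> \<longleftrightarrow> U \<in> \<U> \<and> V \<in> \<U> \<and> W \<in> \<U> \<and> U \<inter> V \<inter> W \<noteq> {}"
  by (auto simp: nerve_def)

lemma ordered_simplices_1: "vs \<in> ordered_simplices 1 K \<longleftrightarrow> (\<exists>U V. vs = [U, V] \<and> {U, V} \<in> K)"
  by (auto simp: ordered_simplices_def length_Suc_conv)

lemma ordered_simplices_2:
  "vs \<in> ordered_simplices (Suc 1) K \<longleftrightarrow> (\<exists>U V W. vs = [U, V, W] \<and> {U, V, W} \<in> K)"
  by (auto simp: ordered_simplices_def length_Suc_conv)

lemma cocycles_1_iff:
  "c \<in> cocycles 1 K \<longleftrightarrow> (\<forall>vs. vs \<notin> ordered_simplices 1 K \<longrightarrow> c vs = 0) \<and>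
     (\<forall>U V W. {U, V, W} \<in> K \<longrightarrow> c [V, W] - c [U, W] + c [U, V] = 0)"
proof -
  have "coboundary 1 K c [U, V, W] = c [V, W] - c [U, W] + c [U, V]" if "{U, V, W} \<in> K" for U V W
  proof -
    have "[U, V, W] \<in> ordered_simplices (Suc 1) K" using that ordered_simplices_2 by blast
    then show ?thesis by (simp add: coboundary_def numeral_2_eq_2)
  qed
  moreover have "coboundary 1 K c vs = 0" if "vs \<notin> ordered_simplices (Suc 1) K" for vs
    using that by (simp add: coboundary_def)
  ultimately have "coboundary 1 K c = (\<lambda>_. 0) \<longleftrightarrow>
      (\<forall>U V W. {U, V, W} \<in> K \<longrightarrow> c [V, W] - c [U, W] + c [U, V] = 0)"
    unfolding fun_eq_iff using ordered_simplices_2[of _ K] by metis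
  then show ?thesis
    by (auto simp: cocycles_def kernel_def cochain_group_def)
qed

text \<open>A 0-cochain appears here as a function \<open>b\<close> on sets instead of one-element
  lists. Its values off the nonempty members of \<open>\<U>\<close> are irrelevant, because both
  ends of an edge of the nerve are vertices of the nerve.\<close>

lemma coboundaries_1_nerve_iff:
  "c \<in> coboundaries 1 (nerve \<U>) \<longleftrightarrow> (\<forall>vs. vs \<notin> ordered_simplices 1 (nerve \<U>) \<longrightarrow> c vs = 0) \<and>
     (\<exists>b. \<forall>U V. {U, V} \<in> nerve \<U> \<longrightarrow> c [U, V] = b V - b U)"
proof -
  let ?K = "nerve \<U>"
  have cob: "coboundary 0 ?K g [U, V] = g [V] - g [U]" if "{U, V} \<in> ?K" for g :: "'a set list \<Rightarrow> int" and U V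
  proof -
    have "[U, V] \<in> ordered_simplices (Suc 0) ?K" using that ordered_simplices_1[of "[U, V]" ?K] by simp
    then show ?thesis by (simp add: coboundary_def)
  qed
  have cob0: "coboundary 0 ?K g vs = 0" if "vs \<notin> ordered_simplices 1 ?K" for g vs
    using that by (simp add: coboundary_def)
  show ?thesis (is "_ \<longleftrightarrow> ?R")
  proof
    assume "c \<in> coboundaries 1 ?K"
    then obtain g where c: "c = coboundary 0 ?K g" by (auto simp: coboundaries_def)
    have "\<forall>U V. {U, V} \<in> ?K \<longrightarrow> c [U, V] = g [V] - g [U]" using cob c by blast
    then show ?R using cob0 c by (intro conjI exI[of _ "\<lambda>U. g [U]"]) blast+
  next
    assume R: ?R
    obtain b where b: "\<forall>U V. {U, V} \<in> ?K \<longrightarrow> c [U, V] = b V - b U"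
      using conjunct2[OF R] by (rule exE)
    define g where "g vs = (if vs \<in> ordered_simplices 0 ?K then b (hd vs) else 0)" for vs
    have "c = coboundary 0 ?K g"
    proof
      fix vs
      show "c vs = coboundary 0 ?K g vs"
      proof (cases "vs \<in> ordered_simplices 1 ?K")
        case True
        then obtain U V where UV: "vs = [U, V]" "{U, V} \<in> ?K"
          unfolding ordered_simplices_1 by (elim exE conjE) (rule that)
        have "{U} \<in> ?K" "{V} \<in> ?K" by (rule nerve_subset[OF UV(2)], simp_all)+
        then have "g [U] = b U" "g [V] = b V" by (simp_all add: g_def ordered_simplices_def)
        then show ?thesis using b[rule_format, OF UV(2)] cob[OF UV(2)] UV by simp
      next
        case False
        then show ?thesis using conjunct1[OF R] cob0 by simp
      qed
    qed
    moreover have "g \<in> carrier (cochain_group 0 ?K)" by (simp add: cochain_group_def g_def)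
    ultimately show "c \<in> coboundaries 1 ?K" unfolding coboundaries_def by simp
  qed
qed

text \<open>Ordered cochains admit the degenerate simplex \<open>[U, U, U]\<close>, whose cocycle
  identity reads c - c + c = 0.\<close>

lemma cocycle_1_diagonal:
  assumes "c \<in> cocycles 1 (nerve \<U>)" "U \<in> \<U>" "U \<noteq> {}"
  shows "c [U, U] = 0"
proof -
  have "{U, U, U} \<in> nerve \<U>" using assms(2,3) by (simp add: nerve_def)
  then show ?thesis using assms(1) unfolding cocycles_1_iff by fastforce
qed

lemma cocycle_1:
  assumes "c \<in> cocycles 1 (nerve \<U>)" "U \<in> \<U>" "V \<in> \<U>" "W \<in> \<U>" "y \<in> U" "y \<in> V" "y \<in> W"
  shows "c [V, W] - c [U, W] + c [U, V] = 0"
proof -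
  have "{U, V, W} \<in> nerve \<U>" using assms(2-) unfolding nerve_three_iff by blast
  then show ?thesis using assms(1) unfolding cocycles_1_iff by blast
qed

section \<open>Clopen sets and the quotient by disjoint pairs\<close>

definition clopenin :: "'a topology \<Rightarrow> 'a set \<Rightarrow> bool" where
  "clopenin X B \<longleftrightarrow> openin X B \<and> closedin X B"

lemma clopenin_Un: "clopenin X A \<Longrightarrow> clopenin X B \<Longrightarrow> clopenin X (A \<union> B)"
  and clopenin_Int: "clopenin X A \<Longrightarrow> clopenin X B \<Longrightarrow> clopenin X (A \<inter> B)"
  and clopenin_Diff: "clopenin X A \<Longrightarrow> clopenin X B \<Longrightarrow> clopenin X (A - B)"
  and clopenin_empty: "clopenin X {}"
  and clopenin_topspace: "clopenin X (topspace X)"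
  and clopenin_subset: "clopenin X A \<Longrightarrow> A \<subseteq> topspace X"
  by (auto simp: clopenin_def closedin_Un closedin_Int openin_diff closedin_diff openin_subset)

text \<open>A set adjoined later overrides the earlier ones, which turns a finite clopen cover into
  a clopen partition. Clopenness of all preimages says that the selection \<open>u\<close> is
  locally constant.\<close>

lemma clopen_cover_selection:
  assumes "finite \<B>" "\<And>B. B \<in> \<B> \<Longrightarrow> clopenin X B"
  shows "\<exists>u. (\<forall>p\<in>\<Union>\<B>. \<exists>B\<in>\<B>. p \<in> B \<and> u p = h B) \<and> (\<forall>Z. clopenin X {p \<in> \<Union>\<B>. u p \<in> Z})"
  using assms
proof (induction \<B> rule: finite_induct)
  case empty
  then show ?case by (simp add: clopenin_empty)
next
  case (insert B \<B>)
  have "\<exists>u. (\<forall>p\<in>\<Union>\<B>. \<exists>B\<in>\<B>. p \<in> B \<and> u p = h B) \<and> (\<forall>Z. clopenin X {p \<in> \<Union>\<B>. u p \<in> Z})"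
    by (rule insert.IH) (use insert.prems in auto)
  then obtain u where u: "\<And>p. p \<in> \<Union>\<B> \<Longrightarrow> \<exists>B\<in>\<B>. p \<in> B \<and> u p = h B"
    "\<And>Z. clopenin X {p \<in> \<Union>\<B>. u p \<in> Z}" by blast
  let ?u = "\<lambda>p. if p \<in> B then h B else u p"
  have "{p \<in> \<Union>(insert B \<B>). ?u p \<in> Z} = (if h B \<in> Z then B else {}) \<union> ({p \<in> \<Union>\<B>. u p \<in> Z} - B)" for Z
    by auto
  moreover have "clopenin X ((if h B \<in> Z then B else {}) \<union> ({p \<in> \<Union>\<B>. u p \<in> Z} - B))" for Z
    using insert.prems u(2)[of Z] by (intro clopenin_Un clopenin_Diff) (auto simp: clopenin_empty)
  ultimately have "\<forall>Z. clopenin X {p \<in> \<Union>(insert B \<B>). ?u p \<in> Z}" by simp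
  moreover have "\<forall>p\<in>\<Union>(insert B \<B>). \<exists>B'\<in>insert B \<B>. p \<in> B' \<and> ?u p = h B'"
    using u(1) by auto
  ultimately show ?case by (intro exI[of _ ?u] conjI)
qed

definition splits :: "'a set \<Rightarrow> 'a \<times> 'a \<Rightarrow> bool" where
  "splits A e \<longleftrightarrow> (fst e \<in> A) \<noteq> (snd e \<in> A)"

text \<open>\<open>finite_splits\<close> is the smallness condition: at each clopen scale all but
  finitely many pairs look like points. It takes the place of a metric and makes saturated open sets
  abundant. The order inside a pair only fixes the sign of a jump.\<close>

locale pair_identification =
  fixes X :: "'a topology" and E :: "('a \<times> 'a) set"
  assumes compact: "compact_space X"
    and pairs: "E \<subseteq> topspace X \<times> topspace X"
    and zero_dimensional: "\<And>U p. openin X U \<Longrightarrow> p \<in> U \<Longrightarrow> \<exists>B. clopenin X B \<and> p \<in> B \<and> B \<subseteq> U"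
    and clopen_separation: "\<And>p q. p \<in> topspace X \<Longrightarrow> q \<in> topspace X \<Longrightarrow> p \<noteq> q \<Longrightarrow>
       \<exists>B. clopenin X B \<and> p \<in> B \<and> q \<notin> B"
    and ends_distinct: "\<And>e. e \<in> E \<Longrightarrow> fst e \<noteq> snd e"
    and ends_disjoint: "\<And>e e'. e \<in> E \<Longrightarrow> e' \<in> E \<Longrightarrow> {fst e, snd e} \<inter> {fst e', snd e'} \<noteq> {} \<Longrightarrow> e = e'"
    and finite_splits: "\<And>B. clopenin X B \<Longrightarrow> finite {e \<in> E. splits B e}"
begin

definition r where "r = Restr ((E \<union> E\<inverse>)\<^sup>*) (topspace X)"

abbreviation D where "D \<equiv> quotient_topology X r"

abbreviation cls where "cls p \<equiv> r `` {p}"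

lemma equiv_r: "equiv (topspace X) r"
proof -
  have "sym ((E \<union> E\<inverse>)\<^sup>*)"
    by (intro sym_rtrancl sym_Un_converse)
  then show ?thesis
    unfolding r_def by (intro equivI refl_onI symI transI) (auto dest: symD intro: rtrancl_trans)
qed

lemma topspace_D: "topspace D = cls ` topspace X"
  by (simp add: topspace_quotient_topology[OF equiv_r] quotient_def UNION_singleton_eq_range)

lemma cls_self: "p \<in> topspace X \<Longrightarrow> p \<in> cls p"
  using equiv_class_self[OF equiv_r] by blast

lemma cls_eq: "q \<in> cls p \<Longrightarrow> cls q = cls p"
  using equiv_class_eq[OF equiv_r] by blast

lemma openin_D: "openin D V \<longleftrightarrow> V \<subseteq> topspace D \<and> openin X (\<Union>V)"
  by (simp add: openin_quotient_topology[OF equiv_r] topspace_quotient_topology[OF equiv_r])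

lemma in_Union_iff: "V \<subseteq> topspace D \<Longrightarrow> p \<in> topspace X \<Longrightarrow> p \<in> \<Union>V \<longleftrightarrow> cls p \<in> V"
proof
  assume V: "V \<subseteq> topspace D" and "p \<in> \<Union>V"
  then obtain y q where "y \<in> V" "p \<in> y" "y = cls q" unfolding topspace_D by blast
  then show "cls p \<in> V" using cls_eq by metis
next
  assume "p \<in> topspace X" "cls p \<in> V"
  then show "p \<in> \<Union>V" using cls_self by blast
qed

lemma Union_subset: "V \<subseteq> topspace D \<Longrightarrow> \<Union>V \<subseteq> topspace X"
proof
  fix p assume "V \<subseteq> topspace D" "p \<in> \<Union>V"
  then obtain q where "p \<in> cls q" unfolding topspace_D by blast
  then show "p \<in> topspace X" by (simp add: r_def)
qed

text \<open>Each further identification shares an end with \<open>e\<close>, and disjointness of the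
  pairs forces it to be \<open>e\<close> again.\<close>

lemma reachable_end:
  assumes "(p, q) \<in> (E \<union> E\<inverse>)\<^sup>*" "e \<in> E" "p \<in> {fst e, snd e}"
  shows "q \<in> {fst e, snd e}"
  using assms(1)
proof induction
  case base then show ?case using assms(3) .
next
  case (step y z)
  then obtain e' where e': "e' \<in> E" "{y, z} = {fst e', snd e'}" by fastforce
  then have "e = e'" using step ends_disjoint[OF assms(2) e'(1)] by blast
  then show ?case using e' by blast
qed

lemma cls_end: "e \<in> E \<Longrightarrow> p \<in> {fst e, snd e} \<Longrightarrow> cls p = {fst e, snd e}"
proof (intro equalityI subsetI)
  assume e: "e \<in> E" "p \<in> {fst e, snd e}"
  fix q
  show "q \<in> {fst e, snd e}" if "q \<in> cls p"
    using that reachable_end[OF _ e] by (auto simp: r_def)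
  show "q \<in> cls p" if "q \<in> {fst e, snd e}"
  proof -
    have "(fst e, snd e) \<in> E" using e by simp
    moreover have "fst e \<in> topspace X" "snd e \<in> topspace X" using e pairs by auto
    ultimately show ?thesis using e that by (auto simp: r_def)
  qed
qed

text \<open>Some step in the chain of identifications from \<open>p\<close> to \<open>q\<close>
  leaves \<open>A\<close>. The pair of that step splits \<open>A\<close>, and since \<open>p\<close>
  is reachable from its ends, it is the class of \<open>p\<close>. With a singleton as
  \<open>A\<close> this shows that every class with more than one point is a pair.\<close>

lemma cls_crossing:
  assumes "q \<in> cls p" "p \<in> A" "q \<notin> A"
  obtains e where "e \<in> E" "splits A e" "cls p = {fst e, snd e}"
proof -
  have "(p, q) \<in> (E \<union> E\<inverse>)\<^sup>*" using assms by (simp add: r_def)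
  then have "\<exists>y z. (p, y) \<in> (E \<union> E\<inverse>)\<^sup>* \<and> (y, z) \<in> E \<union> E\<inverse> \<and> y \<in> A \<and> z \<notin> A"
    using assms(3)
  proof induction
    case base then show ?case using assms(2) by blast
  next
    case (step y z) then show ?case by blast
  qed
  then obtain y z where yz: "(p, y) \<in> (E \<union> E\<inverse>)\<^sup>*" "(y, z) \<in> E \<union> E\<inverse>" "y \<in> A" "z \<notin> A"
    by blast
  then obtain e where e: "e \<in> E" "{y, z} = {fst e, snd e}" by fastforce
  have "splits A e" using e(2) yz by (auto simp: splits_def doubleton_eq_iff)
  moreover have "(y, p) \<in> (E \<union> E\<inverse>)\<^sup>*"
    using yz(1) by (metis sym_Un_converse sym_rtrancl symD)
  then have "p \<in> {fst e, snd e}" using reachable_end[OF _ e(1)] e(2) by blast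
  ultimately show ?thesis using that e(1) cls_end by blast
qed

lemma closedin_finite: "finite F \<Longrightarrow> F \<subseteq> topspace X \<Longrightarrow> closedin X F"
proof -
  have "t1_space X"
    unfolding t1_space_def using clopen_separation by (meson clopenin_def)
  then show "finite F \<Longrightarrow> F \<subseteq> topspace X \<Longrightarrow> closedin X F"
    by (simp add: t1_space_closedin_finite)
qed

lemma clopen_avoiding:
  assumes "finite F" "p \<in> topspace X" "p \<notin> F"
  obtains B where "clopenin X B" "p \<in> B" "B \<inter> F = {}"
proof -
  have "closedin X (F \<inter> topspace X)" using assms by (intro closedin_finite) auto
  then have "openin X (topspace X - F \<inter> topspace X)" by blast
  moreover have "p \<in> topspace X - F \<inter> topspace X" using assms by blast
  ultimately obtain B where B: "clopenin X B" "p \<in> B" "B \<subseteq> topspace X - F \<inter> topspace X"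
    using zero_dimensional by blast
  then have "B \<inter> F = {}" by blast
  then show ?thesis using that B by blast
qed

definition inner :: "'a set \<Rightarrow> 'a set set" where
  "inner B = {y \<in> topspace D. y \<subseteq> B}"

text \<open>A point of \<open>B\<close> has its class inside \<open>B\<close> unless it is an end of
  a pair split by \<open>B\<close>. So only finitely many points are removed from \<open>B\<close>,
  and finite sets are closed.\<close>

lemma openin_inner:
  assumes "clopenin X B" shows "openin D (inner B)"
proof -
  let ?S = "{e \<in> E. splits B e}"
  let ?F = "\<Union>e\<in>?S. {fst e, snd e}"
  have "\<Union>(inner B) = B - ?F"
  proof (intro equalityI subsetI)
    fix p assume p: "p \<in> \<Union>(inner B)"
    then have ptop: "p \<in> topspace X" using Union_subset[of "inner B"] by (auto simp: inner_def)
    then have "cls p \<in> inner B" using in_Union_iff[of "inner B" p] p by (auto simp: inner_def)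
    then have "cls p \<subseteq> B" by (simp add: inner_def)
    moreover have "\<not> splits B e" if "e \<in> E" "p \<in> {fst e, snd e}" for e
      using cls_end[OF that] \<open>cls p \<subseteq> B\<close> by (auto simp: splits_def)
    ultimately show "p \<in> B - ?F" using cls_self[OF ptop] by blast
  next
    fix p assume p: "p \<in> B - ?F"
    then have ptop: "p \<in> topspace X" using clopenin_subset[OF assms] by blast
    have "cls p \<subseteq> B"
    proof
      fix q assume q: "q \<in> cls p"
      show "q \<in> B"
      proof (rule ccontr)
        assume "q \<notin> B"
        then obtain e where "e \<in> E" "splits B e" "cls p = {fst e, snd e}"
          using cls_crossing[OF q] p by blast
        then show False using p cls_self[OF ptop] by blast
      qed
    qed
    then show "p \<in> \<Union>(inner B)" using cls_self[OF ptop] ptop by (auto simp: inner_def topspace_D)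
  qed
  moreover have "closedin X ?F"
    using finite_splits[OF assms] pairs by (intro closedin_finite) auto
  ultimately show ?thesis
    using assms by (auto simp: openin_D inner_def clopenin_def intro: openin_diff)
qed

text \<open>The loop created by gluing the ends of \<open>e\<close> is detected by a cocycle on four
  open sets. Once this becomes a coboundary, the potential \<open>G\<close> on \<open>X\<close> and
  the cochain \<open>b\<close> add up to a locally constant function whose only jump at a pair is at
  \<open>e\<close>.\<close>

theorem splitting_of_trivial_cohomology:
  assumes triv: "trivial_group (cech_cohomology 1 D)" and e: "e \<in> E"
  shows "\<exists>A. clopenin X A \<and> (\<forall>e'\<in>E. splits A e' \<longleftrightarrow> e' = e)"
proof -
  have etop: "fst e \<in> topspace X" "snd e \<in> topspace X" using e pairs by auto
  \<comment> \<open>\<open>A\<close> separates the ends of \<open>e\<close> but may split finitely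
    many other pairs; \<open>S\<close> collects these and \<open>F\<close> their ends.\<close>
  obtain A where A: "clopenin X A" "fst e \<in> A" "snd e \<notin> A"
    using clopen_separation[OF etop ends_distinct[OF e]] by blast
  define S where "S = {e' \<in> E. splits A e'} - {e}"
  define F where "F = (\<Union>e'\<in>S. {fst e', snd e'})"
  have finF: "finite F" using finite_splits[OF A(1)] by (auto simp: F_def S_def)
  have "x \<notin> F" if x: "x \<in> {fst e, snd e}" for x
  proof
    assume "x \<in> F"
    then obtain e' where e': "e' \<in> S" "x \<in> {fst e', snd e'}" unfolding F_def by blast
    then have "e = e'" using ends_disjoint[OF e, of e'] x unfolding S_def by blast
    then show False using e' by (simp add: S_def)
  qed
  then have nF: "fst e \<notin> F" "snd e \<notin> F" by blast+
  obtain B1 where "clopenin X B1" "fst e \<in> B1" "B1 \<inter> F = {}"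
    using clopen_avoiding[OF finF etop(1) nF(1)] .
  moreover obtain B2 where "clopenin X B2" "snd e \<in> B2" "B2 \<inter> F = {}"
    using clopen_avoiding[OF finF etop(2) nF(2)] .
  \<comment> \<open>\<open>Y\<close> is a neighbourhood of both ends of \<open>e\<close> that misses
    all other pairs split by \<open>A\<close>, so inside \<open>Y\<close> the jump at
    \<open>e\<close> is isolated.\<close>
  ultimately obtain Y where Y: "clopenin X Y" "fst e \<in> Y" "snd e \<in> Y" "Y \<inter> F = {}"
    using that[of "B1 \<union> B2"] clopenin_Un[of X B1 B2] by blast
  define WA WA' WY WY' where "WA = inner A" and "WA' = inner (topspace X - A)"
    and "WY = inner Y" and "WY' = inner (topspace X - Y)"
  note W_defs = WA_def WA'_def WY_def WY'_def
  have compl: "clopenin X (topspace X - A)" "clopenin X (topspace X - Y)"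
    using clopenin_Diff clopenin_topspace A(1) Y(1) by blast+
  define y0 where "y0 = {fst e, snd e}"
  have y0: "cls (fst e) = y0" "cls (snd e) = y0" using cls_end[OF e] by (auto simp: y0_def)
  have y0W: "y0 \<in> WY" "y0 \<notin> WA" "y0 \<notin> WA'" "y0 \<notin> WY'"
    using A Y etop y0 unfolding W_defs inner_def topspace_D by (auto simp: y0_def)
  define \<U> where "\<U> = {WA, WA', WY, WY'}"
  have \<U>: "\<U> \<in> open_covers D"
  proof -
    \<comment> \<open>A class in neither \<open>WA\<close> nor \<open>WA'\<close> is a pair split by
      \<open>A\<close>: either it is \<open>e\<close>, covered by \<open>WY\<close>, or its ends lie
      in \<open>F\<close> and \<open>WY'\<close> covers it.\<close>
    have "y \<in> \<Union>\<U>" if y: "y \<in> topspace D" for y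
    proof (rule ccontr)
      assume "y \<notin> \<Union>\<U>"
      then have ny: "y \<notin> WA" "y \<notin> WA'" "y \<notin> WY" "y \<notin> WY'" by (auto simp: \<U>_def)
      obtain p where p: "p \<in> topspace X" "y = cls p" using y by (auto simp: topspace_D)
      then have ysub: "y \<subseteq> topspace X" by (auto simp: r_def)
      have "\<not> y \<subseteq> A" "\<not> y \<subseteq> topspace X - A" using ny y by (auto simp: W_defs inner_def)
      then obtain q q' where q: "q \<in> y" "q \<in> A" "q' \<in> y" "q' \<notin> A" using ysub by blast
      then have "cls q = y" using cls_eq p by blast
      then obtain e' where e': "e' \<in> E" "splits A e'" "y = {fst e', snd e'}"
        using cls_crossing[of q' q A] q by metis
      show False
      proof (cases "e' = e")
        case True then show ?thesis using e' ny(3) y0W(1) by (simp add: y0_def)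
      next
        case False
        then have "y \<subseteq> topspace X - Y"
          using e' Y(4) ysub by (auto simp: F_def S_def)
        then show ?thesis using ny(4) y by (simp add: W_defs inner_def)
      qed
    qed
    moreover have "openin D U" if "U \<in> \<U>" for U
      using that openin_inner A(1) Y(1) compl by (auto simp: \<U>_def W_defs)
    ultimately show ?thesis
      unfolding open_covers_def using openin_subset by blast
  qed
  \<comment> \<open>On \<open>X\<close> the cocycle is a difference of values of \<open>G\<close>.
    This potential does not descend to the quotient, as \<open>G WY\<close> differs at the two ends
    of \<open>e\<close>.\<close>
  define G :: "'a set set \<Rightarrow> 'a \<Rightarrow> int" where "G U p = (if U = WY \<and> p \<in> A then 1 else 0)" for U p
  define cc :: "'a set set \<Rightarrow> 'a set set \<Rightarrow> int" where
    "cc U V = (if U = WY \<and> V = WA then 1 else if U = WA \<and> V = WY then -1 else 0)" for U V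
  have cc: "cc U V = G U p - G V p"
    if "U \<in> \<U>" "V \<in> \<U>" "p \<in> topspace X" "cls p \<in> U" "cls p \<in> V" for U V p
  proof -
    have p: "p \<in> cls p" using cls_self that by blast
    have "cls p \<in> WA \<Longrightarrow> p \<in> A" "cls p \<in> WA' \<Longrightarrow> p \<notin> A" "cls p \<in> WY \<Longrightarrow> cls p \<notin> WY'"
      using p by (auto simp: W_defs inner_def)
    moreover have "WA \<noteq> WY" "WA' \<noteq> WY" "WY' \<noteq> WY" using y0W by auto
    ultimately show ?thesis using that unfolding \<U>_def cc_def G_def by auto
  qed
  define c where "c vs = (if vs \<in> ordered_simplices 1 (nerve \<U>) then cc (vs ! 0) (vs ! 1) else 0)" for vs
  have c_eq: "c [U, V] = cc U V" if "{U, V} \<in> nerve \<U>" for U V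
    using that ordered_simplices_1[of "[U, V]"] by (simp add: c_def)
  have point: "\<exists>p\<in>topspace X. cls p = y" if "y \<in> U" "U \<in> \<U>" for y U
  proof -
    have "y \<in> topspace D" using that \<U> by (auto simp: open_covers_def)
    then show ?thesis by (auto simp: topspace_D)
  qed
  have "c \<in> cocycles 1 (nerve \<U>)"
    unfolding cocycles_1_iff
  proof (intro conjI allI impI)
    fix U V W assume UVW: "{U, V, W} \<in> nerve \<U>"
    then obtain y where y: "y \<in> U" "y \<in> V" "y \<in> W" and mem: "U \<in> \<U>" "V \<in> \<U>" "W \<in> \<U>"
      unfolding nerve_three_iff by blast
    obtain p where p: "p \<in> topspace X" "cls p = y" using point[OF y(1) mem(1)] by blast
    have "c [V, W] = cc V W" "c [U, W] = cc U W" "c [U, V] = cc U V"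
      by (rule c_eq, rule nerve_subset[OF UVW], auto)+
    then show "c [V, W] - c [U, W] + c [U, V] = 0"
      using cc[OF mem(2,3) p(1)] cc[OF mem(1,3) p(1)] cc[OF mem(1,2) p(1)] p y by simp
  qed (simp add: c_def)
  then obtain \<V> where \<V>: "\<V> \<in> open_covers D" "refines \<V> \<U>"
    and pb: "cochain_pullback 1 (refinement_projection \<U> \<V>) (nerve \<V>) c \<in> coboundaries 1 (nerve \<V>)"
    using trivial_cech_cohomologyD[OF triv \<U>] by blast
  let ?\<rho> = "refinement_projection \<U> \<V>"
  note \<rho> = refinement_projection[OF \<V>(2)]
  obtain b where b: "\<And>U V. {U, V} \<in> nerve \<V> \<Longrightarrow>
      cochain_pullback 1 ?\<rho> (nerve \<V>) c [U, V] = b V - b U"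
    using pb unfolding coboundaries_1_nerve_iff by blast
  \<comment> \<open>The sum is independent of the member of \<open>\<V>\<close> used, so
    \<open>G\<close> corrected by \<open>b\<close> is one function on all of \<open>X\<close>; it is
    locally constant because near a point the member can be kept fixed.\<close>
  have glue: "G (?\<rho> V) p + b V = G (?\<rho> V') p + b V'"
    if "V \<in> \<V>" "V' \<in> \<V>" "p \<in> topspace X" "cls p \<in> V" "cls p \<in> V'" for V V' p
  proof -
    have VV': "{V, V'} \<in> nerve \<V>" using that unfolding nerve_two_iff by blast
    have \<rho>VV': "{?\<rho> V, ?\<rho> V'} \<in> nerve \<U>"
      using that \<rho> unfolding nerve_two_iff by blast
    have "[V, V'] \<in> ordered_simplices 1 (nerve \<V>)" using VV' ordered_simplices_1[of "[V, V']"] by simp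
    then have "c [?\<rho> V, ?\<rho> V'] = b V' - b V" using b[OF VV'] by (simp add: cochain_pullback_def)
    moreover have "c [?\<rho> V, ?\<rho> V'] = G (?\<rho> V) p - G (?\<rho> V') p"
      unfolding c_eq[OF \<rho>VV']
      by (rule cc[OF \<rho>(1)[OF that(1)] \<rho>(1)[OF that(2)] that(3)])
        (use that \<rho>(2)[OF that(1)] \<rho>(2)[OF that(2)] in blast)+
    ultimately show ?thesis by simp
  qed
  define v where "v p = (SOME V. V \<in> \<V> \<and> cls p \<in> V)" for p
  have v: "v p \<in> \<V>" "cls p \<in> v p" if "p \<in> topspace X" for p
  proof -
    have "\<exists>V. V \<in> \<V> \<and> cls p \<in> V" using that \<V>(1) by (force simp: open_covers_def topspace_D)
    then show "v p \<in> \<V>" "cls p \<in> v p" unfolding v_def by (metis (mono_tags, lifting) someI_ex)+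
  qed
  define f where "f p = G (?\<rho> (v p)) p + b (v p)" for p
  have f: "f p = G (?\<rho> V) p + b V" if "V \<in> \<V>" "p \<in> topspace X" "cls p \<in> V" for V p
    unfolding f_def using glue[OF v(1) that(1,2) v(2) that(3)] that(2) by blast
  have loc: "\<exists>N. openin X N \<and> p \<in> N \<and> (\<forall>q\<in>N. f q = f p)" if p: "p \<in> topspace X" for p
  proof -
    let ?H = "if p \<in> A then A else topspace X - A"
    let ?N = "\<Union>(v p) \<inter> ?H"
    have vp: "openin D (v p)" using v(1)[OF p] \<V>(1) by (auto simp: open_covers_def)
    then have sub: "v p \<subseteq> topspace D" by (rule openin_subset)
    have "openin X ?N" using vp A(1) compl by (auto simp: openin_D clopenin_def)
    moreover have "p \<in> ?N" using v(2)[OF p] cls_self[OF p] p by auto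
    moreover have "f q = f p" if q: "q \<in> ?N" for q
    proof -
      have qtop: "q \<in> topspace X" using q Union_subset[OF sub] by blast
      then have "cls q \<in> v p" using q in_Union_iff[OF sub] by blast
      then have "f q = G (?\<rho> (v p)) q + b (v p)" using f v(1) p qtop by blast
      moreover have "G (?\<rho> (v p)) q = G (?\<rho> (v p)) p"
        using q by (auto simp: G_def split: if_splits)
      ultimately show ?thesis by (simp add: f_def)
    qed
    ultimately show ?thesis by blast
  qed
  \<comment> \<open>Parity suffices: the jump at \<open>e\<close> is 1 or -1 and the jump at every
    other pair is 0.\<close>
  define A' where "A' = {p \<in> topspace X. odd (f p)}"
  have opn: "openin X {p \<in> topspace X. Q (f p)}" for Q
  proof (subst openin_subopen, intro ballI)
    fix p assume "p \<in> {p \<in> topspace X. Q (f p)}"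
    then have p: "p \<in> topspace X" "Q (f p)" by simp_all
    obtain N where N: "openin X N" "p \<in> N" "\<forall>q\<in>N. f q = f p" using loc[OF p(1)] by (elim exE conjE)
    have "N \<subseteq> {p \<in> topspace X. Q (f p)}"
    proof
      fix q assume "q \<in> N"
      then show "q \<in> {p \<in> topspace X. Q (f p)}"
        using p N(3) openin_subset[OF N(1)] by auto
    qed
    with N show "\<exists>T. openin X T \<and> p \<in> T \<and> T \<subseteq> {p \<in> topspace X. Q (f p)}"
      by (intro exI[of _ N]) simp
  qed
  have "topspace X - A' = {p \<in> topspace X. \<not> odd (f p)}" by (auto simp: A'_def)
  then have "clopenin X A'" unfolding clopenin_def closedin_def
    using opn[of odd] opn[of "\<lambda>t. \<not> odd t"] by (auto simp: A'_def)
  moreover have "splits A' e' \<longleftrightarrow> e' = e" if e': "e' \<in> E" for e'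
  proof -
    have top: "fst e' \<in> topspace X" "snd e' \<in> topspace X" using e' pairs by auto
    define V where "V = v (fst e')"
    have cl: "cls (fst e') = {fst e', snd e'}" "cls (snd e') = {fst e', snd e'}"
      using cls_end[OF e'] by auto
    have V: "V \<in> \<V>" "cls (fst e') \<in> V" using v[OF top(1)] by (simp_all add: V_def)
    then have \<rho>V: "?\<rho> V \<in> \<U>" "cls (fst e') \<in> ?\<rho> V" using \<rho>[OF V(1)] by blast+
    have "f (fst e') = G (?\<rho> V) (fst e') + b V" "f (snd e') = G (?\<rho> V) (snd e') + b V"
      using f[OF V(1) top(1)] f[OF V(1) top(2)] V(2) cl by simp_all
    then have "splits A' e' \<longleftrightarrow> ?\<rho> V = WY \<and> splits A e'"
      using top by (auto simp: splits_def A'_def G_def)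
    moreover have "?\<rho> V = WY \<and> splits A e'" if "e' = e"
      using \<rho>V y0 y0W A that by (auto simp: \<U>_def splits_def)
    moreover have False if "?\<rho> V = WY" "splits A e'" "e' \<noteq> e"
    proof -
      have "fst e' \<in> F" using that e' by (auto simp: F_def S_def)
      moreover have "fst e' \<in> Y" using \<rho>V that(1) cl by (auto simp: WY_def inner_def)
      ultimately show False using Y(4) by blast
    qed
    ultimately show ?thesis by blast
  qed
  ultimately show ?thesis by blast
qed

section \<open>Killing cocycles when every pair can be split alone\<close>

text \<open>Compactness of \<open>X\<close> provides a finite clopen refinement upstairs, hence a
  locally constant choice of cover members. The two ends of a pair may still receive different
  members, and this discrepancy is what remains to be corrected.\<close>

lemma locally_constant_choice:
  assumes \<U>: "\<U> \<in> open_covers D"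
  shows "\<exists>u. (\<forall>p\<in>topspace X. u p \<in> \<U> \<and> cls p \<in> u p) \<and> finite (u ` topspace X) \<and>
    (\<forall>Z. clopenin X {p \<in> topspace X. u p \<in> Z})"
proof -
  define \<C> where "\<C> = {B. clopenin X B \<and> (\<exists>U\<in>\<U>. B \<subseteq> \<Union>U)}"
  have sub: "U \<subseteq> topspace D" if "U \<in> \<U>" for U
    using that \<U> openin_subset unfolding open_covers_def by blast
  have cover: "topspace X \<subseteq> \<Union>\<C>"
  proof
    fix p assume p: "p \<in> topspace X"
    then have "cls p \<in> \<Union>\<U>" using \<U> by (simp add: open_covers_def topspace_D)
    then obtain U where U: "U \<in> \<U>" "cls p \<in> U" by blast
    then have "openin X (\<Union>U)" "p \<in> \<Union>U"
      using \<U> in_Union_iff[OF sub p] by (simp_all add: open_covers_def openin_D)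
    then obtain B where B: "clopenin X B" "p \<in> B" "B \<subseteq> \<Union>U"
      using zero_dimensional by blast
    then have "B \<in> \<C>" using U(1) by (auto simp: \<C>_def)
    then show "p \<in> \<Union>\<C>" using B(2) by (rule UnionI)
  qed
  have "\<And>B. B \<in> \<C> \<Longrightarrow> openin X B" by (simp add: \<C>_def clopenin_def)
  then have "(\<forall>U\<in>\<C>. openin X U) \<and> topspace X \<subseteq> \<Union>\<C>" using cover by simp
  then have "\<exists>\<F>. finite \<F> \<and> \<F> \<subseteq> \<C> \<and> topspace X \<subseteq> \<Union>\<F>"
    using compact unfolding compact_space_alt by (elim allE impE)
  then obtain \<F> where \<F>: "finite \<F>" "\<F> \<subseteq> \<C>" "topspace X \<subseteq> \<Union>\<F>"
    by (elim exE conjE)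
  define h where "h B = (SOME U. U \<in> \<U> \<and> B \<subseteq> \<Union>U)" for B
  have h: "h B \<in> \<U>" "B \<subseteq> \<Union>(h B)" if "B \<in> \<F>" for B
  proof -
    have "\<exists>U. U \<in> \<U> \<and> B \<subseteq> \<Union>U" using that \<F>(2) unfolding \<C>_def by blast
    then have "h B \<in> \<U> \<and> B \<subseteq> \<Union>(h B)" unfolding h_def by (rule someI_ex)
    then show "h B \<in> \<U>" "B \<subseteq> \<Union>(h B)" by simp_all
  qed
  have clop: "\<And>B. B \<in> \<F> \<Longrightarrow> clopenin X B" using \<F>(2) by (auto simp: \<C>_def)
  have top: "\<Union>\<F> = topspace X" using \<F>(3) clop clopenin_subset by (metis Union_least subset_antisym)
  have "\<exists>u. (\<forall>p\<in>\<Union>\<F>. \<exists>B\<in>\<F>. p \<in> B \<and> u p = h B) \<and> (\<forall>Z. clopenin X {p \<in> \<Union>\<F>. u p \<in> Z})"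
    by (rule clopen_cover_selection[OF \<F>(1)]) (rule clop)
  then obtain u where u': "\<forall>p\<in>\<Union>\<F>. \<exists>B\<in>\<F>. p \<in> B \<and> u p = h B"
    "\<forall>Z. clopenin X {p \<in> \<Union>\<F>. u p \<in> Z}"
    by (elim exE conjE)
  note u = u'(1)[rule_format] u'(2)[rule_format]
  show ?thesis
  proof (intro exI[of _ u] conjI ballI allI)
    fix p assume p: "p \<in> topspace X"
    then obtain B where B: "B \<in> \<F>" "p \<in> B" "u p = h B" using u(1)[of p] top by metis
    then have "p \<in> \<Union>(h B)" using h(2) by blast
    then show "u p \<in> \<U>" "cls p \<in> u p" using B h(1)[OF B(1)] in_Union_iff[OF sub p] by simp_all
  next
    have "u ` topspace X \<subseteq> h ` \<F>" using u(1) top by blast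
    then show "finite (u ` topspace X)" using \<F>(1) finite_surj by blast
  next
    show "clopenin X {p \<in> topspace X. u p \<in> Z}" for Z using u(2)[of Z] top by simp
  qed
qed

text \<open>The function is a sum of multiples of indicators of sets that split one pair of
  \<open>F\<close> each; finiteness of \<open>F\<close> keeps it locally constant.\<close>

lemma prescribed_jumps:
  fixes d :: "'a \<times> 'a \<Rightarrow> int"
  assumes sep: "\<And>e. e \<in> E \<Longrightarrow> \<exists>A. clopenin X A \<and> (\<forall>e'\<in>E. splits A e' \<longleftrightarrow> e' = e)"
    and fin: "finite F" and F: "F \<subseteq> E"
  shows "\<exists>f. (\<forall>e\<in>E. f (fst e) - f (snd e) = (if e \<in> F then d e else 0)) \<and>
    (\<forall>p\<in>topspace X. \<exists>N. clopenin X N \<and> p \<in> N \<and> (\<forall>q\<in>N. f q = f p))"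
proof -
  obtain A where A: "\<And>e. e \<in> E \<Longrightarrow> clopenin X (A e)"
    "\<And>e e'. e \<in> E \<Longrightarrow> e' \<in> E \<Longrightarrow> splits (A e) e' \<longleftrightarrow> e' = e"
    using sep by metis
  \<comment> \<open>The sign makes the jump equal to \<open>d e\<close> whichever end of
    \<open>e\<close> lies in \<open>A e\<close>.\<close>
  define \<eta> where "\<eta> e p = (if p \<in> A e then d e * (if fst e \<in> A e then 1 else -1) else 0)" for e p
  define f where "f p = (\<Sum>e\<in>F. \<eta> e p)" for p
  have \<eta>: "\<eta> e (fst e') - \<eta> e (snd e') = (if e' = e then d e else 0)" if "e \<in> E" "e' \<in> E" for e e'
    using A(2)[OF that] by (auto simp: \<eta>_def splits_def split: if_splits)
  have "f (fst e') - f (snd e') = (\<Sum>e\<in>F. if e' = e then d e else 0)" if "e' \<in> E" for e'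
    unfolding f_def sum_subtractf[symmetric] by (intro sum.cong refl \<eta> subsetD[OF F] that)
  then have jump: "f (fst e') - f (snd e') = (if e' \<in> F then d e' else 0)" if "e' \<in> E" for e'
    using that fin by simp
  have loc: "\<exists>N. clopenin X N \<and> p \<in> N \<and> (\<forall>q\<in>N. \<forall>e\<in>F. \<eta> e q = \<eta> e p)" if p: "p \<in> topspace X" for p
    using fin F
  proof (induction F rule: finite_induct)
    case empty
    then show ?case using p clopenin_topspace by (intro exI[of _ "topspace X"]) simp
  next
    case (insert e F)
    have "\<exists>N. clopenin X N \<and> p \<in> N \<and> (\<forall>q\<in>N. \<forall>e\<in>F. \<eta> e q = \<eta> e p)"
      using insert by simp
    then obtain N where N: "clopenin X N" "p \<in> N" "\<forall>q\<in>N. \<forall>e\<in>F. \<eta> e q = \<eta> e p"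
      by (elim exE conjE)
    let ?H = "if p \<in> A e then A e else topspace X - A e"
    have Ae: "clopenin X (A e)" using A(1) insert.prems by simp
    have "clopenin X (N \<inter> ?H)" using N(1) Ae clopenin_Int clopenin_Diff[OF clopenin_topspace Ae]
      by auto
    moreover have "p \<in> N \<inter> ?H" using N(2) p by simp
    moreover have "\<forall>q\<in>N \<inter> ?H. \<forall>e'\<in>insert e F. \<eta> e' q = \<eta> e' p"
      using N(3) by (auto simp: \<eta>_def)
    ultimately show ?case by (intro exI[of _ "N \<inter> ?H"] conjI)
  qed
  have "\<exists>N. clopenin X N \<and> p \<in> N \<and> (\<forall>q\<in>N. f q = f p)" if p: "p \<in> topspace X" for p
  proof -
    obtain N where N: "clopenin X N" "p \<in> N" "\<forall>q\<in>N. \<forall>e\<in>F. \<eta> e q = \<eta> e p"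
      using loc[OF p] by (elim exE conjE)
    have "f q = f p" if "q \<in> N" for q
      unfolding f_def by (rule sum.cong[OF refl]) (use N(3) that in blast)
    then have "\<forall>q\<in>N. f q = f p" ..
    then show ?thesis using N by (intro exI[of _ N] conjI)
  qed
  then show ?thesis using jump by (intro exI[of _ f] conjI ballI) simp_all
qed

text \<open>Sending \<open>p\<close> to \<open>c [u p, U]\<close> trivializes the cocycle on
  \<open>X\<close>. By the cocycle identity its jump at a pair \<open>e\<close> is
  \<open>c [u (fst e), u (snd e)]\<close>, so subtracting a function \<open>f\<close> with the same
  jumps makes the trivialization constant on classes.\<close>

theorem trivial_cohomology_of_splitting:
  assumes sep: "\<And>e. e \<in> E \<Longrightarrow> \<exists>A. clopenin X A \<and> (\<forall>e'\<in>E. splits A e' \<longleftrightarrow> e' = e)"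
  shows "trivial_group (cech_cohomology 1 D)"
proof (rule trivial_cech_cohomologyI)
  fix \<U> c assume \<U>: "\<U> \<in> open_covers D" and c: "c \<in> cocycles 1 (nerve \<U>)"
  have sub: "U \<subseteq> topspace D" if "U \<in> \<U>" for U
    using that \<U> openin_subset unfolding open_covers_def by blast
  obtain u where u': "\<forall>p\<in>topspace X. u p \<in> \<U> \<and> cls p \<in> u p"
    and ufin: "finite (u ` topspace X)" and uclop': "\<forall>Z. clopenin X {p \<in> topspace X. u p \<in> Z}"
    using locally_constant_choice[OF \<U>] by (elim exE conjE)
  note u = u'[rule_format] and uclop = uclop'[rule_format]
  define F where "F = {e \<in> E. u (fst e) \<noteq> u (snd e)}"
  \<comment> \<open>A pair whose ends get different members is split by a level set of
    \<open>u\<close>; there are finitely many level sets, and each splits finitely many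
    pairs.\<close>
  have "F \<subseteq> (\<Union>U\<in>u ` topspace X. {e \<in> E. splits {p \<in> topspace X. u p \<in> {U}} e})"
  proof
    fix e assume e: "e \<in> F"
    then have eE: "e \<in> E" "u (fst e) \<noteq> u (snd e)" by (simp_all add: F_def)
    then have "fst e \<in> topspace X" using pairs by auto
    moreover have "splits {p \<in> topspace X. u p \<in> {u (fst e)}} e"
      using eE pairs by (auto simp: splits_def)
    ultimately show "e \<in> (\<Union>U\<in>u ` topspace X. {e \<in> E. splits {p \<in> topspace X. u p \<in> {U}} e})"
      using eE(1) by (intro UN_I[of "u (fst e)"] imageI CollectI conjI)
  qed
  then have finF: "finite F"
    by (rule finite_subset) (intro finite_UN_I ufin finite_splits uclop)
  have FE: "F \<subseteq> E" by (auto simp: F_def)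
  have "\<exists>f. (\<forall>e\<in>E. f (fst e) - f (snd e) = (if e \<in> F then c [u (fst e), u (snd e)] else 0)) \<and>
      (\<forall>p\<in>topspace X. \<exists>N. clopenin X N \<and> p \<in> N \<and> (\<forall>q\<in>N. f q = f p))"
    by (rule prescribed_jumps[OF _ finF FE, where d = "\<lambda>e. c [u (fst e), u (snd e)]"]) (rule sep)
  then obtain f where
    f: "\<forall>e\<in>E. f (fst e) - f (snd e) = (if e \<in> F then c [u (fst e), u (snd e)] else 0)"
      "\<forall>p\<in>topspace X. \<exists>N. clopenin X N \<and> p \<in> N \<and> (\<forall>q\<in>N. f q = f p)"
    by (elim exE conjE)
  note jump = f(1)[rule_format] and floc = f(2)[rule_format]
  have top: "fst e \<in> topspace X" "snd e \<in> topspace X" if "e \<in> E" for e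
    using that pairs by auto
  have jump': "f (fst e) - f (snd e) = c [u (fst e), u (snd e)]" if e: "e \<in> E" for e
  proof (cases "e \<in> F")
    case False
    then have "u (fst e) = u (snd e)" using e by (simp add: F_def)
    moreover have "c [u (fst e), u (fst e)] = 0"
      using u[OF top(1)[OF e]] by (intro cocycle_1_diagonal[OF c]) auto
    ultimately show ?thesis using jump[OF e] False by simp
  qed (use jump[OF e] in simp)
  define b where "b U p = c [u p, U] - f p" for U p
  have b_diff: "c [U, V] = b V p - b U p"
    if "U \<in> \<U>" "V \<in> \<U>" "p \<in> topspace X" "cls p \<in> U" "cls p \<in> V" for U V p
    using cocycle_1[OF c, of "u p" U V "cls p"] u[OF that(3)] that by (simp add: b_def)
  have b_end: "b U (fst e) = b U (snd e)" if e: "e \<in> E" and U: "U \<in> \<U>" "cls (fst e) \<in> U" for U e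
  proof -
    have "cls (snd e) = cls (fst e)" using cls_end[OF e] by simp
    then show ?thesis
      using cocycle_1[OF c, of "u (fst e)" "u (snd e)" U "cls (fst e)"] u[OF top(1)[OF e]]
        u[OF top(2)[OF e]] U jump'[OF e] by (simp add: b_def)
  qed
  have b_cls: "b U q = b U p" if U: "U \<in> \<U>" "cls p \<in> U" and p: "p \<in> topspace X" and q: "q \<in> cls p" for U p q
  proof (cases "p = q")
    case False
    then obtain e where e: "e \<in> E" "cls p = {fst e, snd e}"
      using cls_crossing[of q p "{p}"] q by blast
    then have "p \<in> {fst e, snd e}" "q \<in> {fst e, snd e}" using cls_self[OF p] q by simp_all
    moreover have "cls (fst e) \<in> U" using cls_end[OF e(1), of "fst e"] e(2) U(2) by simp
    ultimately show ?thesis using b_end[OF e(1) U(1)] by auto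
  qed simp
  have b_loc: "\<exists>N. openin X N \<and> p \<in> N \<and> (\<forall>q\<in>N. b U q = b U p)" if p: "p \<in> topspace X" for U p
  proof -
    obtain N where N: "clopenin X N" "p \<in> N" "\<forall>q\<in>N. f q = f p" using floc[OF p] by (elim exE conjE)
    let ?N = "N \<inter> {q \<in> topspace X. u q \<in> {u p}}"
    have "openin X ?N"
      using N(1) uclop[of "{u p}"] by (auto simp: clopenin_def)
    moreover have "b U q = b U p" if "q \<in> ?N" for q
      using bspec[OF N(3), of q] that by (simp add: b_def)
    then have "\<forall>q\<in>?N. b U q = b U p" ..
    moreover have "p \<in> ?N" using N(2) p by simp
    ultimately show ?thesis by (intro exI[of _ ?N] conjI)
  qed
  \<comment> \<open>A coboundary needs one value per set, so the refinement consists of open sets on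
    which \<open>b U\<close> is constant for some \<open>U\<close> containing them.\<close>
  define const where "const U V \<longleftrightarrow> (\<exists>t. \<forall>p\<in>topspace X. cls p \<in> V \<longrightarrow> b U p = t)" for U V
  define \<V> where "\<V> = {V. openin D V \<and> (\<exists>U\<in>\<U>. V \<subseteq> U \<and> const U V)}"
  have "topspace D \<subseteq> \<Union>\<V>"
  proof
    fix y assume "y \<in> topspace D"
    then obtain p where p: "p \<in> topspace X" "y = cls p" unfolding topspace_D by blast
    \<comment> \<open>This level set of \<open>b (u p)\<close> is saturated because the function is
      constant on classes, and open because the function is locally constant.\<close>
    let ?V = "{z \<in> u p. \<exists>q\<in>topspace X. z = cls q \<and> b (u p) q = b (u p) p}"
    have up: "u p \<in> \<U>" "cls p \<in> u p" using u[OF p(1)] by simp_all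
    have Vsub: "?V \<subseteq> topspace D" using sub[OF up(1)] by blast
    have *: "\<Union>?V = {q \<in> \<Union>(u p). b (u p) q = b (u p) p}"
    proof (intro equalityI subsetI)
      fix q assume "q \<in> \<Union>?V"
      then obtain q' where q': "q' \<in> topspace X" "cls q' \<in> u p" "b (u p) q' = b (u p) p" "q \<in> cls q'"
        by blast
      then show "q \<in> {q \<in> \<Union>(u p). b (u p) q = b (u p) p}" using b_cls[OF up(1) q'(2,1,4)] by auto
    next
      fix q assume q: "q \<in> {q \<in> \<Union>(u p). b (u p) q = b (u p) p}"
      then have qtop: "q \<in> topspace X" using Union_subset[OF sub[OF up(1)]] by blast
      then have "cls q \<in> u p" using q in_Union_iff[OF sub[OF up(1)]] by simp
      then have "cls q \<in> ?V" using q qtop by auto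
      then show "q \<in> \<Union>?V" using cls_self[OF qtop] by (rule UnionI)
    qed
    have "openin X (\<Union>?V)"
      unfolding *
    proof (subst openin_subopen, intro ballI)
      fix q assume "q \<in> {q \<in> \<Union>(u p). b (u p) q = b (u p) p}"
      then have q: "q \<in> \<Union>(u p)" "b (u p) q = b (u p) p" by simp_all
      then have qtop: "q \<in> topspace X" using Union_subset[OF sub[OF up(1)]] by blast
      obtain N where N: "openin X N" "q \<in> N" "\<forall>q'\<in>N. b (u p) q' = b (u p) q"
        using b_loc[OF qtop, of "u p"] by (elim exE conjE)
      have "openin X (\<Union>(u p))" using up(1) \<U> by (simp add: open_covers_def openin_D)
      then have "openin X (N \<inter> \<Union>(u p))" using N(1) by blast
      moreover have "N \<inter> \<Union>(u p) \<subseteq> {q \<in> \<Union>(u p). b (u p) q = b (u p) p}"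
      proof
        fix q' assume q': "q' \<in> N \<inter> \<Union>(u p)"
        then have "b (u p) q' = b (u p) q" using bspec[OF N(3)] by (rule IntE)
        then show "q' \<in> {q \<in> \<Union>(u p). b (u p) q = b (u p) p}" using q' q(2) by simp
      qed
      moreover have "q \<in> N \<inter> \<Union>(u p)" using N(2) q(1) by (rule IntI)
      ultimately show "\<exists>T. openin X T \<and> q \<in> T \<and> T \<subseteq> {q \<in> \<Union>(u p). b (u p) q = b (u p) p}"
        by (intro exI[of _ "N \<inter> \<Union>(u p)"] conjI)
    qed
    then have "openin D ?V" using Vsub by (simp add: openin_D)
    moreover have "const (u p) ?V"
      unfolding const_def
    proof (intro exI[of _ "b (u p) p"] ballI impI)
      fix q assume q: "q \<in> topspace X" "cls q \<in> ?V"
      then have "q \<in> \<Union>?V" using cls_self[OF q(1)] by (intro UnionI)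
      then show "b (u p) q = b (u p) p" unfolding * by simp
    qed
    ultimately have "?V \<in> \<V>" unfolding \<V>_def using up(1) by blast
    moreover have "y \<in> ?V" using up(2) p by auto
    ultimately show "y \<in> \<Union>\<V>" by (rule UnionI)
  qed
  then have "\<V> \<in> open_covers D"
    using openin_subset unfolding open_covers_def \<V>_def by blast
  moreover have "refines \<V> \<U>" unfolding refines_def \<V>_def by blast
  moreover have "cochain_pullback 1 (refinement_projection \<U> \<W>) (nerve \<W>) c \<in> coboundaries 1 (nerve \<W>)"
    if \<W>: "\<W> \<in> open_covers D" "refines \<W> \<V>" for \<W>
  proof -
    let ?\<rho> = "refinement_projection \<U> \<W>"
    note \<rho> = refinement_projection[OF refines_trans[OF \<W>(2) \<open>refines \<V> \<U>\<close>]]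
    \<comment> \<open>The projection may pick another member than the \<open>U\<close> that
      witnesses constancy. The two functions differ by \<open>c [U, ?\<rho> W]\<close>, again a
      constant.\<close>
    have const_\<rho>: "const (?\<rho> W) W" if W: "W \<in> \<W>" for W
    proof -
      obtain V where V: "V \<in> \<V>" "W \<subseteq> V" using \<W>(2) W unfolding refines_def by blast
      then obtain U where U: "U \<in> \<U>" "V \<subseteq> U" "const U V" unfolding \<V>_def by blast
      then obtain t where t: "\<And>p. p \<in> topspace X \<Longrightarrow> cls p \<in> V \<Longrightarrow> b U p = t"
        unfolding const_def by blast
      have "b (?\<rho> W) p = c [U, ?\<rho> W] + t" if p: "p \<in> topspace X" "cls p \<in> W" for p
      proof -
        have "c [U, ?\<rho> W] = b (?\<rho> W) p - b U p"
          using U V p \<rho>[OF W] by (intro b_diff) blast+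
        then show ?thesis using t[OF p(1)] p(2) V(2) by auto
      qed
      then show ?thesis unfolding const_def by blast
    qed
    define \<beta> where "\<beta> W = b (?\<rho> W) (SOME p. p \<in> topspace X \<and> cls p \<in> W)" for W
    have \<beta>: "\<beta> W = b (?\<rho> W) p" if W: "W \<in> \<W>" and p: "p \<in> topspace X" "cls p \<in> W" for W p
    proof -
      let ?q = "SOME p. p \<in> topspace X \<and> cls p \<in> W"
      have q: "?q \<in> topspace X \<and> cls ?q \<in> W"
        by (rule someI[where P = "\<lambda>p. p \<in> topspace X \<and> cls p \<in> W", OF conjI[OF p]])
      obtain t where t: "\<forall>p\<in>topspace X. cls p \<in> W \<longrightarrow> b (?\<rho> W) p = t"
        using const_\<rho>[OF W] unfolding const_def by (elim exE)
      have "\<beta> W = t" unfolding \<beta>_def by (rule t[rule_format]) (use q in simp_all)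
      also have "t = b (?\<rho> W) p" using t[rule_format, OF p] by simp
      finally show ?thesis .
    qed
    have "cochain_pullback 1 ?\<rho> (nerve \<W>) c [W, W'] = \<beta> W' - \<beta> W" if WW': "{W, W'} \<in> nerve \<W>" for W W'
    proof -
      have W: "W \<in> \<W>" "W' \<in> \<W>" using WW' by (auto simp: nerve_two_iff)
      obtain y where y: "y \<in> W" "y \<in> W'" using WW' by (auto simp: nerve_two_iff)
      then have "y \<in> topspace D" using W \<W>(1) unfolding open_covers_def by blast
      then obtain p where p: "p \<in> topspace X" "y = cls p" unfolding topspace_D by blast
      have "c [?\<rho> W, ?\<rho> W'] = b (?\<rho> W') p - b (?\<rho> W) p"
        using y p \<rho>[OF W(1)] \<rho>[OF W(2)] by (intro b_diff) auto
      moreover have "[W, W'] \<in> ordered_simplices 1 (nerve \<W>)"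
        using WW' ordered_simplices_1[of "[W, W']"] by simp
      ultimately show ?thesis
        using \<beta>[OF W(1) p(1)] \<beta>[OF W(2) p(1)] y p by (simp add: cochain_pullback_def)
    qed
    then show ?thesis unfolding coboundaries_1_nerve_iff
      by (intro conjI exI[of _ \<beta>]) (simp_all add: cochain_pullback_def)
  qed
  ultimately show "\<exists>\<V>\<in>open_covers D. refines \<V> \<U> \<and> (\<forall>\<W>\<in>open_covers D. refines \<W> \<V> \<longrightarrow>
      cochain_pullback 1 (refinement_projection \<U> \<W>) (nerve \<W>) c \<in> coboundaries 1 (nerve \<W>))"
    by (intro bexI[of _ \<V>] conjI ballI impI)
qed

end

section \<open>The boundary of a free group as a space of rays\<close>

definition inv_word :: "letter list \<Rightarrow> letter list" where
  "inv_word u = rev (map inv_letter u)"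

lemma inv_word_simps [simp]:
  "inv_word [] = []" "inv_word (a # u) = inv_word u @ [inv_letter a]"
  "inv_word (u @ v) = inv_word v @ inv_word u" "inv_word (inv_word u) = u"
  "length (inv_word u) = length u"
  by (simp_all add: inv_word_def rev_map comp_def)

lemma inv_word_eq_Nil_iff [simp]: "inv_word u = [] \<longleftrightarrow> u = []"
  by (simp add: inv_word_def)

lemma inv_letter_neq [simp]: "inv_letter a \<noteq> a" "a \<noteq> inv_letter a"
  by (cases a; simp add: inv_letter_def)+

lemma reduced_append:
  "reduced (u @ v) \<longleftrightarrow> reduced u \<and> reduced v \<and> (u = [] \<or> v = [] \<or> hd v \<noteq> inv_letter (last u))"
  by (simp add: reduced_def successively_append_iff)

lemma reduced_inv_word [simp]: "reduced (inv_word u) \<longleftrightarrow> reduced u"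
proof -
  have "(\<lambda>x y. inv_letter x \<noteq> inv_letter (inv_letter y)) = (\<lambda>a b. b \<noteq> inv_letter a)"
    by (metis inv_letter_inv_letter)
  then show ?thesis
    unfolding inv_word_def reduced_def successively_rev successively_map by (rule arg_cong)
qed

lemma set_inv_word: "set (inv_word u) \<subseteq> letters n \<longleftrightarrow> set u \<subseteq> letters n"
  by (auto simp: inv_word_def simp del: split_paired_All)

lemma reduce_inv_left [simp]: "reduce (inv_word u @ u) = []"
  by (simp add: inv_word_def reduce_inverse)

lemma reduce_inv_right [simp]: "reduce (u @ inv_word u) = []"
  using reduce_inv_left[of "inv_word u"] by simp

lemma reduce_cong_append:
  "reduce u = reduce u' \<Longrightarrow> reduce v = reduce v' \<Longrightarrow> reduce (u @ v) = reduce (u' @ v')"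
  by (metis reduce_append_left reduce_append_right)

lemma reduce_cancel_middle:
  assumes "reduce s = []" shows "reduce (u @ s @ v) = reduce (u @ v)"
proof -
  have "reduce (s @ v) = reduce v"
    using reduce_cong_append[of s "[]" v v] assms by (simp add: reduce_def)
  then show ?thesis using reduce_cong_append[of u u] by blast
qed

lemma reduce_Nil [simp]: "reduce [] = []"
  by (simp add: reduce_def)

lemma reduce_reduce [simp]: "reduce (reduce u) = reduce u"
  by (simp add: reduce_reduced reduced_reduce)

lemma length_reduce: "length (reduce w) \<le> length w"
proof (induction w)
  case (Cons a w)
  have "reduce (a # w) = cancel_Cons a (reduce w)" by (simp add: reduce_def)
  then show ?case using Cons by (auto simp: cancel_Cons_def)
qed simp

lemma reduce_cancel_left [simp]:
  "reduce (inv_word u @ reduce (u @ v)) = reduce v" "reduce (u @ reduce (inv_word u @ v)) = reduce v"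
  "reduce (inv_word u @ u @ v) = reduce v" "reduce (u @ inv_word u @ v) = reduce v"
  using reduce_cancel_middle[of "inv_word u @ u" "[]" v] reduce_cancel_middle[of "u @ inv_word u" "[]" v]
  by (simp_all add: reduce_append_right)

lemma reduce_cancel_right [simp]:
  "reduce (reduce (v @ u) @ inv_word u) = reduce v" "reduce (reduce (v @ inv_word u) @ u) = reduce v"
  "reduce (v @ u @ inv_word u) = reduce v" "reduce (v @ inv_word u @ u) = reduce v"
  using reduce_cancel_middle[of "u @ inv_word u" v "[]"] reduce_cancel_middle[of "inv_word u @ u" v "[]"]
  by (simp_all add: reduce_append_left)

lemma carrier_free_group: "carrier (free_group n) = {w. set w \<subseteq> letters n \<and> reduced w}"
  by (simp add: free_group_def)

lemma mult_free_group: "u \<otimes>\<^bsub>free_group n\<^esub> v = reduce (u @ v)"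
  by (simp add: free_group_def)

lemma one_free_group: "\<one>\<^bsub>free_group n\<^esub> = []"
  by (simp add: free_group_def)

lemma reduce_in_carrier: "set w \<subseteq> letters n \<Longrightarrow> reduce w \<in> carrier (free_group n)"
  using set_reduce[of w] by (auto simp: carrier_free_group reduced_reduce)

lemma inv_free_group:
  assumes "u \<in> carrier (free_group n)"
  shows "inv\<^bsub>free_group n\<^esub> u = inv_word u"
proof (rule group.inv_equality[OF group_free_group])
  show "inv_word u \<otimes>\<^bsub>free_group n\<^esub> u = \<one>\<^bsub>free_group n\<^esub>"
    by (simp add: mult_free_group one_free_group)
  show "inv_word u \<in> carrier (free_group n)"
    using assms by (simp add: carrier_free_group set_inv_word)
qed (rule assms)

section \<open>Word metric and Gromov product in the Cayley tree\<close>

definition lcp_length :: "letter list \<Rightarrow> letter list \<Rightarrow> nat" where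
  "lcp_length g h = length (longest_common_prefix g h)"

lemma le_lcp_length_iff:
  "k \<le> lcp_length g h \<longleftrightarrow> k \<le> length g \<and> k \<le> length h \<and> take k g = take k h"
  unfolding lcp_length_def
proof (induction g h arbitrary: k rule: longest_common_prefix.induct)
  case (1 x xs y ys)
  show ?case using 1 by (cases k) auto
qed auto

lemma lcp_decomposition:
  obtains c g' h' where "g = c @ g'" "h = c @ h'" "length c = lcp_length g h"
    "g' = [] \<or> h' = [] \<or> hd g' \<noteq> hd h'"
proof -
  let ?k = "lcp_length g h"
  have k: "?k \<le> length g" "?k \<le> length h" "take ?k g = take ?k h"
    using le_lcp_length_iff[of ?k g h] by auto
  have "drop ?k g = [] \<or> drop ?k h = [] \<or> hd (drop ?k g) \<noteq> hd (drop ?k h)"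
  proof (rule ccontr)
    assume *: "\<not> ?thesis"
    then have l: "?k < length g" "?k < length h" by auto
    then have "g ! ?k = h ! ?k" using * by (simp add: hd_drop_conv_nth)
    then have "take (Suc ?k) g = take (Suc ?k) h" using k l by (simp add: take_Suc_conv_app_nth)
    then have "Suc ?k \<le> ?k" using le_lcp_length_iff[of "Suc ?k" g h] l by auto
    then show False by simp
  qed
  then show thesis
    using k by (intro that[of "take ?k g" "drop ?k g" "drop ?k h"]) (simp_all, metis append_take_drop_id)
qed

text \<open>Once the common prefix is cancelled the next letters differ and no further cancellation
  occurs: the geodesic from \<open>g\<close> to \<open>h\<close> turns at the common prefix. The
  additive form avoids truncated subtraction.\<close>

lemma length_reduce_inv_append:
  assumes "reduced g" "reduced h"
  shows "length (reduce (inv_word g @ h)) + 2 * lcp_length g h = length g + length h"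
proof -
  obtain c g' h' where *: "g = c @ g'" "h = c @ h'" "length c = lcp_length g h"
    "g' = [] \<or> h' = [] \<or> hd g' \<noteq> hd h'" by (rule lcp_decomposition)
  have "reduce (inv_word g @ h) = reduce (inv_word g' @ h')"
    using reduce_cancel_middle[of "inv_word c @ c" "inv_word g'" h'] by (simp add: *)
  moreover have "last (inv_word g') = inv_letter (hd g')" if "g' \<noteq> []"
    using that by (simp add: inv_word_def last_rev hd_map)
  then have "reduced (inv_word g' @ h')"
    using assms * by (auto simp: reduced_append)
  ultimately show ?thesis
    using * by (simp add: reduce_reduced)
qed

text \<open>Edge paths may backtrack, so they are spelled by arbitrary words \<open>s\<close>,
  reduced or not.\<close>

lemma relpow_cayley_edges:
  assumes "g \<in> carrier (free_group n)"
  shows "(g, h) \<in> cayley_edges n ^^ k \<longleftrightarrow>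
    (\<exists>s. length s = k \<and> set s \<subseteq> letters n \<and> h = reduce (g @ s))"
proof (induction k arbitrary: h)
  case 0
  then show ?case using assms by (auto simp: carrier_free_group reduce_reduced)
next
  case (Suc k)
  show ?case
  proof
    assume "(g, h) \<in> cayley_edges n ^^ Suc k"
    then obtain f where f: "(g, f) \<in> cayley_edges n ^^ k" "(f, h) \<in> cayley_edges n" by auto
    then obtain s where s: "length s = k" "set s \<subseteq> letters n" "f = reduce (g @ s)" using Suc by auto
    obtain a where a: "a \<in> letters n" "h = reduce (f @ [a])"
      using f(2) by (auto simp: cayley_edges_def mult_free_group)
    have "h = reduce (g @ s @ [a])" using s a by (simp add: reduce_append_left)
    then show "\<exists>s. length s = Suc k \<and> set s \<subseteq> letters n \<and> h = reduce (g @ s)"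
      using s a by (intro exI[of _ "s @ [a]"]) simp
  next
    assume "\<exists>s. length s = Suc k \<and> set s \<subseteq> letters n \<and> h = reduce (g @ s)"
    then obtain s where s: "length s = Suc k" "set s \<subseteq> letters n" "h = reduce (g @ s)" by auto
    then obtain s' a where sa: "s = s' @ [a]" by (metis length_Suc_conv_rev)
    have f: "(g, reduce (g @ s')) \<in> cayley_edges n ^^ k" using Suc s sa by auto
    have "reduce (g @ s') \<in> carrier (free_group n)"
      using assms s sa by (intro reduce_in_carrier) (auto simp: carrier_free_group)
    moreover have "h = reduce (reduce (g @ s') @ [a])" using s sa by (simp add: reduce_append_left)
    moreover have "a \<in> letters n" using s sa by simp
    ultimately have "(reduce (g @ s'), h) \<in> cayley_edges n"
      unfolding cayley_edges_def mult_free_group by blast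
    then show "(g, h) \<in> cayley_edges n ^^ Suc k" using f by auto
  qed
qed

text \<open>The reduced word spells a path, and reduction never lengthens a word, so no path is
  shorter.\<close>

lemma cayley_dist_eq:
  assumes g: "g \<in> carrier (free_group n)" and h: "h \<in> carrier (free_group n)"
  shows "cayley_dist n g h = length (reduce (inv_word g @ h))"
  unfolding cayley_dist_def relpow_cayley_edges[OF g]
proof (rule Least_equality)
  have "reduce (inv_word g @ h) \<in> carrier (free_group n)"
    using g h by (intro reduce_in_carrier) (simp add: carrier_free_group set_inv_word)
  moreover have "h = reduce h" using h by (simp add: carrier_free_group reduce_reduced)
  ultimately show "\<exists>s. length s = length (reduce (inv_word g @ h)) \<and> set s \<subseteq> letters n \<and> h = reduce (g @ s)"
    by (intro exI[of _ "reduce (inv_word g @ h)"]) (simp add: carrier_free_group)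
next
  fix k assume "\<exists>s. length s = k \<and> set s \<subseteq> letters n \<and> h = reduce (g @ s)"
  then obtain s where "length s = k" "h = reduce (g @ s)" by auto
  then show "length (reduce (inv_word g @ h)) \<le> k" using length_reduce[of s] by simp
qed

abbreviation free_dist :: "nat \<Rightarrow> letter list \<Rightarrow> letter list \<Rightarrow> real" where
  "free_dist n g h \<equiv> real (cayley_dist n g h)"

text \<open>In a tree the Gromov product is the distance from the base point to the branching point,
  here the end of the common prefix.\<close>

lemma gromov_product_free:
  assumes g: "g \<in> carrier (free_group n)" and h: "h \<in> carrier (free_group n)"
  shows "gromov_product (free_dist n) [] g h = real (lcp_length g h)"
proof -
  have "[] \<in> carrier (free_group n)" by (simp add: carrier_free_group)
  then have "cayley_dist n g [] = length g" "cayley_dist n h [] = length h"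
    using g h by (simp_all add: cayley_dist_eq reduce_reduced carrier_free_group)
  moreover have "real (length (reduce (inv_word g @ h))) + 2 * real (lcp_length g h) = real (length g) + real (length h)"
    using arg_cong[OF length_reduce_inv_append[of g h], of real] g h by (simp add: carrier_free_group)
  ultimately show ?thesis using g h by (simp add: gromov_product_def cayley_dist_eq)
qed

section \<open>Rays as points of the Gromov boundary\<close>

definition ray_prefix :: "(nat \<Rightarrow> letter) \<Rightarrow> nat \<Rightarrow> letter list" where
  "ray_prefix \<omega> k = map \<omega> [0..<k]"

definition rays :: "nat \<Rightarrow> (nat \<Rightarrow> letter) set" where
  "rays n = {\<omega>. \<forall>k. ray_prefix \<omega> k \<in> carrier (free_group n)}"

definition tends_to_ray :: "(nat \<Rightarrow> letter list) \<Rightarrow> (nat \<Rightarrow> letter) \<Rightarrow> bool" where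
  "tends_to_ray x \<omega> \<longleftrightarrow> (\<forall>k. \<exists>M. \<forall>i\<ge>M. k \<le> length (x i) \<and> take k (x i) = ray_prefix \<omega> k)"

text \<open>All vertex sequences converging to the ray are collected, so that for a ray this is
  literally the Gromov class and not a representative of it.\<close>

definition ray_end :: "nat \<Rightarrow> (nat \<Rightarrow> letter) \<Rightarrow> (nat \<Rightarrow> letter list) set" where
  "ray_end n \<omega> = {x. range x \<subseteq> carrier (free_group n) \<and> tends_to_ray x \<omega>}"

lemma length_ray_prefix [simp]: "length (ray_prefix \<omega> k) = k"
  by (simp add: ray_prefix_def)

lemma take_ray_prefix: "take j (ray_prefix \<omega> k) = ray_prefix \<omega> (min j k)"
  by (rule nth_equalityI) (auto simp: ray_prefix_def)

lemma nth_ray_prefix [simp]: "i < k \<Longrightarrow> ray_prefix \<omega> k ! i = \<omega> i"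
  by (simp add: ray_prefix_def)

lemma ray_eqI:
  assumes "\<And>k. ray_prefix \<omega> k = ray_prefix \<omega>' k" shows "\<omega> = \<omega>'"
proof
  fix i
  have "ray_prefix \<omega> (Suc i) ! i = ray_prefix \<omega>' (Suc i) ! i" using assms by simp
  then show "\<omega> i = \<omega>' i" by simp
qed

lemma ray_prefix_mono: "ray_prefix \<omega> k = ray_prefix \<omega>' k \<Longrightarrow> j \<le> k \<Longrightarrow> ray_prefix \<omega> j = ray_prefix \<omega>' j"
  by (metis min.absorb1 take_ray_prefix)

lemma tends_to_ray_unique: "tends_to_ray x \<omega> \<Longrightarrow> tends_to_ray x \<omega>' \<Longrightarrow> \<omega> = \<omega>'"
proof (rule ray_eqI)
  fix k assume "tends_to_ray x \<omega>" "tends_to_ray x \<omega>'"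
  then obtain M M' where "\<forall>i\<ge>M. take k (x i) = ray_prefix \<omega> k" "\<forall>i\<ge>M'. take k (x i) = ray_prefix \<omega>' k"
    unfolding tends_to_ray_def by meson
  then have "take k (x (max M M')) = ray_prefix \<omega> k" "take k (x (max M M')) = ray_prefix \<omega>' k"
    using max.cobounded1 max.cobounded2 by blast+
  then show "ray_prefix \<omega> k = ray_prefix \<omega>' k" by simp
qed

lemma tends_to_ray_prefix: "tends_to_ray (ray_prefix \<omega>) \<omega>"
  unfolding tends_to_ray_def by (metis take_ray_prefix length_ray_prefix min.absorb1)

text \<open>Letter \<open>k\<close> of the limit is read off from a term so late that the first
  \<open>k + 1\<close> letters are frozen.\<close>

lemma ray_of_stable_prefixes:
  assumes x: "range x \<subseteq> carrier (free_group n)"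
    and stable: "\<And>k. \<exists>M. \<forall>i\<ge>M. \<forall>j\<ge>M. k \<le> length (x i) \<and> take k (x i) = take k (x j)"
  obtains \<omega> where "\<omega> \<in> rays n" "tends_to_ray x \<omega>"
proof -
  obtain M where M: "\<And>k i j. i \<ge> M k \<Longrightarrow> j \<ge> M k \<Longrightarrow> k \<le> length (x i) \<and> take k (x i) = take k (x j)"
    using stable by metis
  define \<omega> where "\<omega> k = x (M (Suc k)) ! k" for k
  have pre: "take k (x i) = ray_prefix \<omega> k" if "i \<ge> M k" for k i
  proof (rule nth_equalityI)
    show "length (take k (x i)) = length (ray_prefix \<omega> k)" using M[OF that that] by simp
    fix m assume "m < length (take k (x i))"
    then have m: "m < k" by simp
    let ?l = "max i (M (Suc m))"
    have "take k (x i) = take k (x ?l)" using M[OF that, of ?l] that by simp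
    moreover have "take (Suc m) (x ?l) = take (Suc m) (x (M (Suc m)))"
      using M[of "Suc m" ?l "M (Suc m)"] by simp
    ultimately have "take k (x i) ! m = x (M (Suc m)) ! m"
      using m by (metis lessI nth_take)
    then show "take k (x i) ! m = ray_prefix \<omega> k ! m" using m by (simp add: \<omega>_def)
  qed
  then have "tends_to_ray x \<omega>" using M unfolding tends_to_ray_def by blast
  moreover have "ray_prefix \<omega> k \<in> carrier (free_group n)" for k
  proof -
    have "x (M k) \<in> carrier (free_group n)" using x by auto
    then have "set (take k (x (M k))) \<subseteq> letters n" "reduced (take k (x (M k)) @ drop k (x (M k)))"
      by (auto simp: carrier_free_group dest: in_set_takeD)
    then have "take k (x (M k)) \<in> carrier (free_group n)"
      unfolding reduced_append carrier_free_group by simp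
    then show ?thesis using pre[of k "M k"] by simp
  qed
  then have "\<omega> \<in> rays n" by (simp add: rays_def)
  ultimately show thesis using that by blast
qed

text \<open>The products are integers, so divergence can be tested at natural thresholds, where it
  says that ever longer prefixes agree.\<close>

lemma gromov_filterlim_iff:
  assumes "range x \<subseteq> carrier (free_group n)" "range y \<subseteq> carrier (free_group n)"
  shows "filterlim (\<lambda>(i, j). gromov_product (free_dist n) [] (x i) (y j)) at_top (sequentially \<times>\<^sub>F sequentially)
    \<longleftrightarrow> (\<forall>k. \<exists>M. \<forall>i\<ge>M. \<forall>j\<ge>M. k \<le> length (x i) \<and> k \<le> length (y j) \<and> take k (x i) = take k (y j))"
proof -
  have gp: "gromov_product (free_dist n) [] (x i) (y j) = real (lcp_length (x i) (y j))" for i j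
    using assms by (intro gromov_product_free) auto
  have "filterlim (\<lambda>(i, j). real (lcp_length (x i) (y j))) at_top (sequentially \<times>\<^sub>F sequentially)
      \<longleftrightarrow> (\<forall>Z::real. \<exists>M. \<forall>j\<ge>M. \<forall>i\<ge>M. Z \<le> real (lcp_length (x i) (y j)))"
    by (simp add: filterlim_at_top eventually_prod_sequentially)
  also have "\<dots> \<longleftrightarrow> (\<forall>k. \<exists>M. \<forall>j\<ge>M. \<forall>i\<ge>M. k \<le> lcp_length (x i) (y j))"
  proof
    assume "\<forall>Z::real. \<exists>M. \<forall>j\<ge>M. \<forall>i\<ge>M. Z \<le> real (lcp_length (x i) (y j))"
    from this[THEN spec, of "real _"]
    show "\<forall>k. \<exists>M. \<forall>j\<ge>M. \<forall>i\<ge>M. k \<le> lcp_length (x i) (y j)" unfolding of_nat_le_iff by (rule allI)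
  next
    assume *: "\<forall>k. \<exists>M. \<forall>j\<ge>M. \<forall>i\<ge>M. k \<le> lcp_length (x i) (y j)"
    show "\<forall>Z::real. \<exists>M. \<forall>j\<ge>M. \<forall>i\<ge>M. Z \<le> real (lcp_length (x i) (y j))"
    proof
      fix Z :: real
      obtain k where k: "Z \<le> real k" using real_arch_simple by blast
      obtain M where M: "\<forall>j\<ge>M. \<forall>i\<ge>M. k \<le> lcp_length (x i) (y j)" using spec[OF *, of k] by (elim exE)
      have "Z \<le> real (lcp_length (x i) (y j))" if "M \<le> j" "M \<le> i" for i j
        using M[rule_format, OF that] k by linarith
      then show "\<exists>M. \<forall>j\<ge>M. \<forall>i\<ge>M. Z \<le> real (lcp_length (x i) (y j))" by (intro exI allI impI)
    qed
  qed
  also have "\<dots> \<longleftrightarrow> (\<forall>k. \<exists>M. \<forall>i\<ge>M. \<forall>j\<ge>M. k \<le> lcp_length (x i) (y j))"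
    by (intro all_cong1 ex_cong1 iffI allI impI; simp)
  finally show ?thesis unfolding gp le_lcp_length_iff .
qed

lemma gromov_sequences_free:
  "x \<in> gromov_sequences (carrier (free_group n)) (free_dist n) [] \<longleftrightarrow>
     range x \<subseteq> carrier (free_group n) \<and> (\<exists>\<omega>\<in>rays n. tends_to_ray x \<omega>)"
proof (cases "range x \<subseteq> carrier (free_group n)")
  case True
  have "x \<in> gromov_sequences (carrier (free_group n)) (free_dist n) [] \<longleftrightarrow>
    (\<forall>k. \<exists>M. \<forall>i\<ge>M. \<forall>j\<ge>M. k \<le> length (x i) \<and> k \<le> length (x j) \<and> take k (x i) = take k (x j))"
    using True gromov_filterlim_iff[OF True True] by (simp add: gromov_sequences_def)
  also have "\<dots> \<longleftrightarrow> (\<exists>\<omega>\<in>rays n. tends_to_ray x \<omega>)"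
  proof
    assume *: "\<forall>k. \<exists>M. \<forall>i\<ge>M. \<forall>j\<ge>M. k \<le> length (x i) \<and> k \<le> length (x j) \<and> take k (x i) = take k (x j)"
    show "\<exists>\<omega>\<in>rays n. tends_to_ray x \<omega>"
      by (rule ray_of_stable_prefixes[OF True]) (use * in blast)+
  next
    assume "\<exists>\<omega>\<in>rays n. tends_to_ray x \<omega>"
    then obtain \<omega> where \<omega>: "tends_to_ray x \<omega>" by blast
    show "\<forall>k. \<exists>M. \<forall>i\<ge>M. \<forall>j\<ge>M. k \<le> length (x i) \<and> k \<le> length (x j) \<and> take k (x i) = take k (x j)"
    proof
      fix k
      obtain M where "\<forall>i\<ge>M. k \<le> length (x i) \<and> take k (x i) = ray_prefix \<omega> k"
        using \<omega> unfolding tends_to_ray_def by blast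
      then show "\<exists>M. \<forall>i\<ge>M. \<forall>j\<ge>M. k \<le> length (x i) \<and> k \<le> length (x j) \<and> take k (x i) = take k (x j)"
        by (intro exI[of _ M]) simp
    qed
  qed
  finally show ?thesis using True by simp
qed (simp add: gromov_sequences_def)

text \<open>Both sequences converge to rays, and agreement of ever longer prefixes forces these rays
  to coincide.\<close>

lemma gromov_equivalence_free:
  "(x, y) \<in> gromov_equivalence (carrier (free_group n)) (free_dist n) [] \<longleftrightarrow>
     (\<exists>\<omega>\<in>rays n. x \<in> ray_end n \<omega> \<and> y \<in> ray_end n \<omega>)" (is "?l \<longleftrightarrow> ?r")
proof
  assume l: ?l
  then have seq: "x \<in> gromov_sequences (carrier (free_group n)) (free_dist n) []"
      "y \<in> gromov_sequences (carrier (free_group n)) (free_dist n) []"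
    by (simp_all add: gromov_equivalence_def)
  then obtain \<omega> \<omega>' where \<omega>: "\<omega> \<in> rays n" "tends_to_ray x \<omega>" "tends_to_ray y \<omega>'"
    and ran: "range x \<subseteq> carrier (free_group n)" "range y \<subseteq> carrier (free_group n)"
    unfolding gromov_sequences_free by blast
  have lim: "\<forall>k. \<exists>M. \<forall>i\<ge>M. \<forall>j\<ge>M. k \<le> length (x i) \<and> k \<le> length (y j) \<and> take k (x i) = take k (y j)"
    using l gromov_filterlim_iff[OF ran] by (simp add: gromov_equivalence_def)
  have "\<omega> = \<omega>'"
  proof (rule ray_eqI)
    fix k
    obtain M1 where M1: "\<forall>i\<ge>M1. take k (x i) = ray_prefix \<omega> k" using \<omega>(2) unfolding tends_to_ray_def by blast
    obtain M2 where M2: "\<forall>i\<ge>M2. take k (y i) = ray_prefix \<omega>' k" using \<omega>(3) unfolding tends_to_ray_def by blast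
    obtain M3 where M3: "\<forall>i\<ge>M3. \<forall>j\<ge>M3. take k (x i) = take k (y j)" using lim by blast
    let ?m = "max M1 (max M2 M3)"
    have "take k (x ?m) = ray_prefix \<omega> k" "take k (y ?m) = ray_prefix \<omega>' k" "take k (x ?m) = take k (y ?m)"
      using M1[rule_format, of ?m] M2[rule_format, of ?m] M3[rule_format, of ?m ?m] by simp_all
    then show "ray_prefix \<omega> k = ray_prefix \<omega>' k" by simp
  qed
  then show ?r using \<omega> ran by (auto simp: ray_end_def)
next
  assume ?r
  then obtain \<omega> where \<omega>: "\<omega> \<in> rays n" "tends_to_ray x \<omega>" "tends_to_ray y \<omega>"
    and ran: "range x \<subseteq> carrier (free_group n)" "range y \<subseteq> carrier (free_group n)"
    unfolding ray_end_def by blast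
  have "\<exists>M. \<forall>i\<ge>M. \<forall>j\<ge>M. k \<le> length (x i) \<and> k \<le> length (y j) \<and> take k (x i) = take k (y j)" for k
  proof -
    obtain M1 where M1: "\<forall>i\<ge>M1. k \<le> length (x i) \<and> take k (x i) = ray_prefix \<omega> k"
      using \<omega>(2) unfolding tends_to_ray_def by blast
    obtain M2 where M2: "\<forall>i\<ge>M2. k \<le> length (y i) \<and> take k (y i) = ray_prefix \<omega> k"
      using \<omega>(3) unfolding tends_to_ray_def by blast
    show ?thesis using M1 M2 by (intro exI[of _ "max M1 M2"]) simp
  qed
  then show ?l
    unfolding gromov_equivalence_def using gromov_filterlim_iff[OF ran] gromov_sequences_free \<omega> ran
    by (simp add: Bex_def) blast
qed

lemma ray_prefix_in_ray_end: "\<omega> \<in> rays n \<Longrightarrow> ray_prefix \<omega> \<in> ray_end n \<omega>"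
  by (auto simp: ray_end_def rays_def tends_to_ray_prefix)

lemma ray_end_unique: "x \<in> ray_end n \<omega> \<Longrightarrow> x \<in> ray_end n \<omega>' \<Longrightarrow> \<omega> = \<omega>'"
  by (auto simp: ray_end_def intro: tends_to_ray_unique)

lemma ray_end_eq_iff: "\<omega> \<in> rays n \<Longrightarrow> ray_end n \<omega> = ray_end n \<omega>' \<longleftrightarrow> \<omega> = \<omega>'"
  using ray_prefix_in_ray_end ray_end_unique by blast

lemma boundary_limit_eq: "\<omega> \<in> rays n \<Longrightarrow> x \<in> ray_end n \<omega> \<Longrightarrow> boundary_limit n x = ray_end n \<omega>"
  unfolding boundary_limit_def one_free_group
  by (auto simp: gromov_equivalence_free dest: ray_end_unique[of x n \<omega>])

lemma gromov_boundary_points_free: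
  "gromov_boundary_points (carrier (free_group n)) (free_dist n) [] = ray_end n ` rays n"
proof -
  have *: "gromov_equivalence (carrier (free_group n)) (free_dist n) [] `` {x} = ray_end n \<omega>"
    if "\<omega> \<in> rays n" "x \<in> ray_end n \<omega>" for x \<omega>
    using boundary_limit_eq[OF that] by (simp add: boundary_limit_def one_free_group)
  show ?thesis
  proof (intro equalityI subsetI)
    fix p assume "p \<in> gromov_boundary_points (carrier (free_group n)) (free_dist n) []"
    then obtain x where x: "x \<in> gromov_sequences (carrier (free_group n)) (free_dist n) []"
      "p = gromov_equivalence (carrier (free_group n)) (free_dist n) [] `` {x}"
      unfolding gromov_boundary_points_def by (rule quotientE)
    then obtain \<omega> where "\<omega> \<in> rays n" "x \<in> ray_end n \<omega>"
      unfolding gromov_sequences_free by (auto simp: ray_end_def)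
    then show "p \<in> ray_end n ` rays n" using * x(2) by blast
  next
    fix p assume "p \<in> ray_end n ` rays n"
    then obtain \<omega> where \<omega>: "\<omega> \<in> rays n" "p = ray_end n \<omega>" by blast
    have "ray_prefix \<omega> \<in> gromov_sequences (carrier (free_group n)) (free_dist n) []"
      using \<omega>(1) ray_prefix_in_ray_end[OF \<omega>(1)] unfolding gromov_sequences_free ray_end_def by blast
    then show "p \<in> gromov_boundary_points (carrier (free_group n)) (free_dist n) []"
      unfolding gromov_boundary_points_def \<omega>(2) *[OF \<omega>(1) ray_prefix_in_ray_end[OF \<omega>(1)], symmetric]
      by (rule quotientI)
  qed
qed

lemma ray_end_in_gromov_nhd_iff:
  assumes \<omega>: "\<omega> \<in> rays n" and \<omega>': "\<omega>' \<in> rays n"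
  shows "ray_end n \<omega>' \<in> gromov_nhd (carrier (free_group n)) (free_dist n) [] (ray_end n \<omega>) (real k)
     \<longleftrightarrow> ray_prefix \<omega>' k = ray_prefix \<omega> k"
proof
  assume "ray_end n \<omega>' \<in> gromov_nhd (carrier (free_group n)) (free_dist n) [] (ray_end n \<omega>) (real k)"
  then obtain x y where xy: "x \<in> ray_end n \<omega>" "y \<in> ray_end n \<omega>'"
    and L: "ereal (real k) \<le> Liminf (sequentially \<times>\<^sub>F sequentially)
              (\<lambda>(i, j). ereal (gromov_product (free_dist n) [] (x i) (y j)))"
    unfolding gromov_nhd_def by blast
  have gp: "gromov_product (free_dist n) [] (x i) (y j) = real (lcp_length (x i) (y j))" for i j
    using xy by (intro gromov_product_free) (auto simp: ray_end_def)
  \<comment> \<open>\<open>k - 1/2\<close> lies strictly below the lower limit, and an integer above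
    it is at least \<open>k\<close>.\<close>
  have "ereal (real k - 1/2) < ereal (real k)" by simp
  then have "eventually (\<lambda>z. ereal (real k - 1/2) < (case z of (i, j) \<Rightarrow> ereal (real (lcp_length (x i) (y j)))))
      (sequentially \<times>\<^sub>F sequentially)"
    using L unfolding le_Liminf_iff gp by blast
  then obtain M where M: "\<forall>j\<ge>M. \<forall>i\<ge>M. real k - 1/2 < real (lcp_length (x i) (y j))"
    by (auto simp: eventually_prod_sequentially)
  obtain M1 where M1: "\<forall>i\<ge>M1. take k (x i) = ray_prefix \<omega> k"
    using xy(1) unfolding ray_end_def tends_to_ray_def by blast
  obtain M2 where M2: "\<forall>i\<ge>M2. take k (y i) = ray_prefix \<omega>' k"
    using xy(2) unfolding ray_end_def tends_to_ray_def by blast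
  let ?m = "max M (max M1 M2)"
  have "real k - 1/2 < real (lcp_length (x ?m) (y ?m))" using M by simp
  then have "k \<le> lcp_length (x ?m) (y ?m)" by linarith
  then have "take k (x ?m) = take k (y ?m)" by (simp add: le_lcp_length_iff)
  then show "ray_prefix \<omega>' k = ray_prefix \<omega> k" using M1[rule_format, of ?m] M2[rule_format, of ?m] by simp
next
  assume *: "ray_prefix \<omega>' k = ray_prefix \<omega> k"
  have "ereal (real k) \<le> Liminf (sequentially \<times>\<^sub>F sequentially)
      (\<lambda>(i, j). ereal (gromov_product (free_dist n) [] (ray_prefix \<omega> i) (ray_prefix \<omega>' j)))"
  proof (rule Liminf_bounded)
    have "k \<le> lcp_length (ray_prefix \<omega> i) (ray_prefix \<omega>' j)" if "i \<ge> k" "j \<ge> k" for i j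
      using that * by (simp add: le_lcp_length_iff take_ray_prefix)
    moreover have "gromov_product (free_dist n) [] (ray_prefix \<omega> i) (ray_prefix \<omega>' j)
        = real (lcp_length (ray_prefix \<omega> i) (ray_prefix \<omega>' j))" for i j
      using \<omega> \<omega>' by (intro gromov_product_free) (auto simp: rays_def)
    ultimately show "\<forall>\<^sub>F z in sequentially \<times>\<^sub>F sequentially. ereal (real k) \<le>
        (case z of (i, j) \<Rightarrow> ereal (gromov_product (free_dist n) [] (ray_prefix \<omega> i) (ray_prefix \<omega>' j)))"
      unfolding eventually_prod_sequentially by (intro exI[of _ k]) simp
  qed
  then show "ray_end n \<omega>' \<in> gromov_nhd (carrier (free_group n)) (free_dist n) [] (ray_end n \<omega>) (real k)"
    unfolding gromov_nhd_def gromov_boundary_points_free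
    using \<omega> \<omega>' ray_prefix_in_ray_end by blast
qed

lemma gromov_nhd_antimono: "r \<le> s \<Longrightarrow> gromov_nhd V d e p s \<subseteq> gromov_nhd V d e p r"
  unfolding gromov_nhd_def by (force intro: order_trans[of "ereal r" "ereal s"])

text \<open>Neighbourhoods shrink as the radius grows, so real radii may be replaced by natural
  ones; what remains is the topology with the cylinders as a basis.\<close>

lemma openin_free_boundary:
  "openin (free_boundary n) U \<longleftrightarrow> U \<subseteq> ray_end n ` rays n \<and>
     (\<forall>\<omega>\<in>rays n. ray_end n \<omega> \<in> U \<longrightarrow>
        (\<exists>k. \<forall>\<omega>'\<in>rays n. ray_prefix \<omega>' k = ray_prefix \<omega> k \<longrightarrow> ray_end n \<omega>' \<in> U))"
proof -
  have nhd: "(\<exists>r. gromov_nhd (carrier (free_group n)) (free_dist n) [] (ray_end n \<omega>) r \<subseteq> U) \<longleftrightarrow>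
      (\<exists>k. \<forall>\<omega>'\<in>rays n. ray_prefix \<omega>' k = ray_prefix \<omega> k \<longrightarrow> ray_end n \<omega>' \<in> U)"
    (is "?l \<longleftrightarrow> ?r") if \<omega>: "\<omega> \<in> rays n" for \<omega>
  proof
    assume ?l
    then obtain r where r: "gromov_nhd (carrier (free_group n)) (free_dist n) [] (ray_end n \<omega>) r \<subseteq> U" ..
    obtain k where "r \<le> real k" using real_arch_simple by blast
    then have "gromov_nhd (carrier (free_group n)) (free_dist n) [] (ray_end n \<omega>) (real k) \<subseteq> U"
      using r gromov_nhd_antimono by (meson order_trans)
    then have "\<forall>\<omega>'\<in>rays n. ray_prefix \<omega>' k = ray_prefix \<omega> k \<longrightarrow> ray_end n \<omega>' \<in> U"
      using ray_end_in_gromov_nhd_iff[OF \<omega>] by blast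
    then show ?r ..
  next
    assume ?r
    then obtain k where k: "\<forall>\<omega>'\<in>rays n. ray_prefix \<omega>' k = ray_prefix \<omega> k \<longrightarrow> ray_end n \<omega>' \<in> U" ..
    have "gromov_nhd (carrier (free_group n)) (free_dist n) [] (ray_end n \<omega>) (real k) \<subseteq> U"
    proof
      fix q assume q: "q \<in> gromov_nhd (carrier (free_group n)) (free_dist n) [] (ray_end n \<omega>) (real k)"
      then obtain \<omega>' where "\<omega>' \<in> rays n" "q = ray_end n \<omega>'"
        unfolding gromov_nhd_def gromov_boundary_points_free by blast
      then show "q \<in> U" using q k ray_end_in_gromov_nhd_iff[OF \<omega>] by blast
    qed
    then show ?l ..
  qed
  show ?thesis
    unfolding free_boundary_def one_free_group openin_gromov_boundary gromov_boundary_points_free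
  proof (rule conj_cong[OF refl])
    assume U: "U \<subseteq> ray_end n ` rays n"
    have *: "(\<forall>p\<in>U. Q p) \<longleftrightarrow> (\<forall>\<omega>\<in>rays n. ray_end n \<omega> \<in> U \<longrightarrow> Q (ray_end n \<omega>))" for Q
      using U by blast
    show "(\<forall>p\<in>U. \<exists>r. gromov_nhd (carrier (free_group n)) (free_dist n) [] p r \<subseteq> U) \<longleftrightarrow>
      (\<forall>\<omega>\<in>rays n. ray_end n \<omega> \<in> U \<longrightarrow>
        (\<exists>k. \<forall>\<omega>'\<in>rays n. ray_prefix \<omega>' k = ray_prefix \<omega> k \<longrightarrow> ray_end n \<omega>' \<in> U))"
      unfolding * by (intro ball_cong[OF refl] imp_cong[OF refl] nhd)
  qed
qed

lemma topspace_free_boundary: "topspace (free_boundary n) = ray_end n ` rays n"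
proof -
  have "openin (free_boundary n) (ray_end n ` rays n)" by (auto simp: openin_free_boundary)
  then show ?thesis
    using openin_free_boundary by (meson openin_subset openin_topspace subset_antisym)
qed

section \<open>Cylinders, compactness and clopen sets of the boundary\<close>

definition cylinder :: "nat \<Rightarrow> letter list \<Rightarrow> (nat \<Rightarrow> letter list) set set" where
  "cylinder n v = ray_end n ` {\<omega> \<in> rays n. ray_prefix \<omega> (length v) = v}"

lemma ray_end_in_image_iff:
  "\<omega> \<in> rays n \<Longrightarrow> R \<subseteq> rays n \<Longrightarrow> ray_end n \<omega> \<in> ray_end n ` R \<longleftrightarrow> \<omega> \<in> R"
  using ray_end_eq_iff by (metis (no_types, lifting) image_iff)

text \<open>The complement is determined by the same \<open>N\<close> letters, so one openness
  argument serves both sets.\<close>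

lemma clopenin_free_boundaryI:
  assumes R: "R \<subseteq> rays n"
    and N: "\<And>\<omega> \<omega>'. \<omega> \<in> rays n \<Longrightarrow> \<omega>' \<in> rays n \<Longrightarrow> ray_prefix \<omega> N = ray_prefix \<omega>' N \<Longrightarrow> \<omega> \<in> R \<Longrightarrow> \<omega>' \<in> R"
  shows "clopenin (free_boundary n) (ray_end n ` R)"
proof -
  have op: "openin (free_boundary n) (ray_end n ` S)"
    if S: "S \<subseteq> rays n" and SN: "\<And>\<omega> \<omega>'. \<omega> \<in> rays n \<Longrightarrow> \<omega>' \<in> rays n \<Longrightarrow>
        ray_prefix \<omega> N = ray_prefix \<omega>' N \<Longrightarrow> \<omega> \<in> S \<Longrightarrow> \<omega>' \<in> S" for S
    unfolding openin_free_boundary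
  proof (intro conjI ballI impI exI[of _ N])
    show "ray_end n ` S \<subseteq> ray_end n ` rays n" using S by blast
    fix \<omega> \<omega>'
    assume *: "\<omega> \<in> rays n" "ray_end n \<omega> \<in> ray_end n ` S" "\<omega>' \<in> rays n" "ray_prefix \<omega>' N = ray_prefix \<omega> N"
    then have "\<omega> \<in> S" using ray_end_in_image_iff[OF _ S] by simp
    then have "\<omega>' \<in> S" using SN[of \<omega> \<omega>'] * by simp
    then show "ray_end n \<omega>' \<in> ray_end n ` S" by (rule imageI)
  qed
  have "inj_on (ray_end n) (rays n)" by (rule inj_onI) (simp add: ray_end_eq_iff)
  then have "topspace (free_boundary n) - ray_end n ` R = ray_end n ` (rays n - R)"
    using R by (simp add: topspace_free_boundary inj_on_image_set_diff)
  moreover have "openin (free_boundary n) (ray_end n ` (rays n - R))"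
  proof (rule op)
    fix \<omega> \<omega>' assume "\<omega> \<in> rays n" "\<omega>' \<in> rays n" "ray_prefix \<omega> N = ray_prefix \<omega>' N" "\<omega> \<in> rays n - R"
    then show "\<omega>' \<in> rays n - R" using N[of \<omega>' \<omega>] by auto
  qed blast
  moreover have "openin (free_boundary n) (ray_end n ` R)" by (rule op[OF R N])
  ultimately show ?thesis
    unfolding clopenin_def closedin_def by (simp add: openin_subset)
qed

lemma clopenin_cylinder: "clopenin (free_boundary n) (cylinder n v)"
  unfolding cylinder_def by (rule clopenin_free_boundaryI[where N = "length v"]) auto

lemma ray_prefix_Suc: "ray_prefix \<omega> (Suc k) = ray_prefix \<omega> k @ [\<omega> k]"
  by (simp add: ray_prefix_def)

lemma finite_letters: "finite (letters n)"
  by (simp add: letters_def)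

lemma cylinder_split: "cylinder n v \<subseteq> (\<Union>a\<in>letters n. cylinder n (v @ [a]))"
proof
  fix p assume "p \<in> cylinder n v"
  then obtain \<omega> where \<omega>: "\<omega> \<in> rays n" "ray_prefix \<omega> (length v) = v" "p = ray_end n \<omega>"
    by (auto simp: cylinder_def)
  let ?a = "\<omega> (length v)"
  have pre: "ray_prefix \<omega> (length (v @ [?a])) = v @ [?a]" using \<omega>(2) by (simp add: ray_prefix_Suc)
  have "ray_prefix \<omega> (length (v @ [?a])) \<in> carrier (free_group n)" using \<omega>(1) unfolding rays_def by blast
  then have "?a \<in> letters n" unfolding pre carrier_free_group by simp
  moreover have "p \<in> cylinder n (v @ [?a])" using \<omega> pre by (auto simp: cylinder_def)
  ultimately show "p \<in> (\<Union>a\<in>letters n. cylinder n (v @ [a]))" by (rule UN_I)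
qed

text \<open>Koenig's lemma: a cylinder without finite subcover has a one-letter extension of the
  same kind, while a member of the cover around the resulting ray contains one of these
  cylinders.\<close>

lemma compact_space_free_boundary: "compact_space (free_boundary n)"
  unfolding compact_space_alt
proof (intro allI impI)
  fix \<U> assume \<U>: "(\<forall>U\<in>\<U>. openin (free_boundary n) U) \<and> topspace (free_boundary n) \<subseteq> \<Union>\<U>"
  define bad where "bad v \<longleftrightarrow> \<not> (\<exists>\<F>. finite \<F> \<and> \<F> \<subseteq> \<U> \<and> cylinder n v \<subseteq> \<Union>\<F>)" for v
  have step: "\<exists>a. bad (v @ [a])" if "bad v" for v
  proof (rule ccontr)
    assume "\<not> ?thesis"
    then have "\<forall>a. \<exists>\<F>. finite \<F> \<and> \<F> \<subseteq> \<U> \<and> cylinder n (v @ [a]) \<subseteq> \<Union>\<F>"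
      unfolding bad_def by blast
    then have "\<exists>\<F>. \<forall>a. finite (\<F> a) \<and> \<F> a \<subseteq> \<U> \<and> cylinder n (v @ [a]) \<subseteq> \<Union>(\<F> a)"
      by (rule choice)
    then obtain \<F> where \<F>: "\<forall>a. finite (\<F> a) \<and> \<F> a \<subseteq> \<U> \<and> cylinder n (v @ [a]) \<subseteq> \<Union>(\<F> a)" ..
    have "cylinder n v \<subseteq> \<Union>(\<Union>a\<in>letters n. \<F> a)"
    proof
      fix p assume "p \<in> cylinder n v"
      then have "p \<in> (\<Union>a\<in>letters n. cylinder n (v @ [a]))" by (rule subsetD[OF cylinder_split])
      then obtain a where a: "a \<in> letters n" "p \<in> cylinder n (v @ [a])" by (rule UN_E)
      have "p \<in> \<Union>(\<F> a)" using spec[OF \<F>, of a] a(2) by (elim conjE) (rule subsetD)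
      then show "p \<in> \<Union>(\<Union>a\<in>letters n. \<F> a)" using a(1) by blast
    qed
    moreover have "finite (\<Union>a\<in>letters n. \<F> a)" using \<F> finite_letters by auto
    moreover have "(\<Union>a\<in>letters n. \<F> a) \<subseteq> \<U>" using \<F> by auto
    ultimately show False using that unfolding bad_def by blast
  qed
  show "\<exists>\<F>. finite \<F> \<and> \<F> \<subseteq> \<U> \<and> topspace (free_boundary n) \<subseteq> \<Union>\<F>"
  proof (rule ccontr)
    assume contr: "\<not> ?thesis"
    have "cylinder n [] = topspace (free_boundary n)"
      by (simp add: cylinder_def topspace_free_boundary ray_prefix_def)
    then have bad0: "bad []" using contr by (simp add: bad_def)
    define vs where "vs = rec_nat [] (\<lambda>_ v. v @ [SOME a. bad (v @ [a])])"
    have vs_Suc: "vs (Suc k) = vs k @ [SOME a. bad (vs k @ [a])]" for k by (simp add: vs_def)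
    have bad: "bad (vs k)" for k
    proof (induction k)
      case 0 then show ?case using bad0 by (simp add: vs_def)
    next
      case (Suc k) then show ?case unfolding vs_Suc using step someI_ex by metis
    qed
    define \<omega> where "\<omega> k = (SOME a. bad (vs k @ [a]))" for k
    have pre: "ray_prefix \<omega> k = vs k" for k
    proof (induction k)
      case 0 then show ?case by (simp add: vs_def ray_prefix_def)
    next
      case (Suc k) then show ?case by (simp add: ray_prefix_Suc vs_Suc \<omega>_def)
    qed
    have len: "length (vs k) = k" for k by (metis pre length_ray_prefix)
    have "vs k \<in> carrier (free_group n)" for k
    proof -
      \<comment> \<open>The empty family covers an empty cylinder, so a bad cylinder contains a ray.
        Hence the chosen words are reduced words in the alphabet.\<close>
      have "cylinder n (vs k) \<noteq> {}" using bad[of k] by (auto simp: bad_def)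
      then obtain \<omega>' where "\<omega>' \<in> rays n" "ray_prefix \<omega>' (length (vs k)) = vs k" by (auto simp: cylinder_def)
      then show ?thesis unfolding rays_def by (metis mem_Collect_eq)
    qed
    then have \<omega>: "\<omega> \<in> rays n" by (simp add: rays_def pre)
    then have "ray_end n \<omega> \<in> topspace (free_boundary n)" by (simp add: topspace_free_boundary)
    then have "ray_end n \<omega> \<in> \<Union>\<U>" by (rule subsetD[OF conjunct2[OF \<U>]])
    then obtain U where U: "U \<in> \<U>" "ray_end n \<omega> \<in> U" by (rule UnionE)
    have "openin (free_boundary n) U" using conjunct1[OF \<U>] U(1) by (rule bspec)
    then have "\<exists>k. \<forall>\<omega>'\<in>rays n. ray_prefix \<omega>' k = ray_prefix \<omega> k \<longrightarrow> ray_end n \<omega>' \<in> U"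
      using \<omega> U(2) unfolding openin_free_boundary by simp
    then obtain k where k: "\<forall>\<omega>'\<in>rays n. ray_prefix \<omega>' k = ray_prefix \<omega> k \<longrightarrow> ray_end n \<omega>' \<in> U" ..
    have "cylinder n (vs k) \<subseteq> \<Union>{U}" using k by (auto simp: cylinder_def len pre)
    then show False using bad[of k] U(1) unfolding bad_def by blast
  qed
qed

lemma zero_dimensional_free_boundary:
  assumes "openin (free_boundary n) U" "p \<in> U"
  shows "\<exists>B. clopenin (free_boundary n) B \<and> p \<in> B \<and> B \<subseteq> U"
proof -
  obtain \<omega> where \<omega>: "\<omega> \<in> rays n" "p = ray_end n \<omega>"
    using assms unfolding openin_free_boundary by blast
  obtain k where k: "\<forall>\<omega>'\<in>rays n. ray_prefix \<omega>' k = ray_prefix \<omega> k \<longrightarrow> ray_end n \<omega>' \<in> U"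
    using assms \<omega> unfolding openin_free_boundary by blast
  have "cylinder n (ray_prefix \<omega> k) \<subseteq> U" using k by (auto simp: cylinder_def)
  moreover have "p \<in> cylinder n (ray_prefix \<omega> k)" using \<omega> by (auto simp: cylinder_def)
  ultimately show ?thesis using clopenin_cylinder by (intro exI[of _ "cylinder n (ray_prefix \<omega> k)"]) simp
qed

lemma clopen_separation_free_boundary:
  assumes "p \<in> topspace (free_boundary n)" "q \<in> topspace (free_boundary n)" "p \<noteq> q"
  shows "\<exists>B. clopenin (free_boundary n) B \<and> p \<in> B \<and> q \<notin> B"
proof -
  obtain \<omega> \<omega>' where \<omega>: "\<omega> \<in> rays n" "p = ray_end n \<omega>" "\<omega>' \<in> rays n" "q = ray_end n \<omega>'"
    using assms(1,2) unfolding topspace_free_boundary by blast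
  then have "\<omega> \<noteq> \<omega>'" using assms(3) by blast
  then obtain k where k: "ray_prefix \<omega> k \<noteq> ray_prefix \<omega>' k" using ray_eqI by blast
  have "p \<in> cylinder n (ray_prefix \<omega> k)" using \<omega> by (auto simp: cylinder_def)
  moreover have "q \<notin> cylinder n (ray_prefix \<omega> k)"
  proof
    assume "q \<in> cylinder n (ray_prefix \<omega> k)"
    then have "\<omega>' \<in> {\<omega>' \<in> rays n. ray_prefix \<omega>' (length (ray_prefix \<omega> k)) = ray_prefix \<omega> k}"
      unfolding \<omega>(4) cylinder_def by (subst (asm) ray_end_in_image_iff[OF \<omega>(3)]) auto
    then show False using k by simp
  qed
  ultimately show ?thesis using clopenin_cylinder by (intro exI[of _ "cylinder n (ray_prefix \<omega> k)"]) simp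
qed

text \<open>By compactness finitely many cylinders, each inside \<open>A\<close> or disjoint from
  it, cover the boundary; the longest of their words gives \<open>N\<close>.\<close>

lemma clopenin_free_boundaryD:
  assumes A: "clopenin (free_boundary n) A"
  shows "\<exists>N. \<forall>\<omega>\<in>rays n. \<forall>\<omega>'\<in>rays n. ray_prefix \<omega> N = ray_prefix \<omega>' N \<longrightarrow>
     (ray_end n \<omega> \<in> A \<longleftrightarrow> ray_end n \<omega>' \<in> A)"
proof -
  define V where "V = {v. cylinder n v \<subseteq> A \<or> cylinder n v \<inter> A = {}}"
  have "clopenin (free_boundary n) (topspace (free_boundary n) - A)"
    using clopenin_Diff[OF clopenin_topspace A] .
  then have op: "openin (free_boundary n) (topspace (free_boundary n) - A)" "openin (free_boundary n) A"
    using A by (simp_all add: clopenin_def)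
  have "topspace (free_boundary n) \<subseteq> \<Union>(cylinder n ` V)"
  proof
    fix p assume "p \<in> topspace (free_boundary n)"
    then obtain \<omega> where \<omega>: "\<omega> \<in> rays n" "p = ray_end n \<omega>" unfolding topspace_free_boundary by blast
    define B where "B = (if p \<in> A then A else topspace (free_boundary n) - A)"
    have "openin (free_boundary n) B" "p \<in> B" using op \<omega> by (auto simp: B_def topspace_free_boundary)
    then obtain k where k: "\<forall>\<omega>'\<in>rays n. ray_prefix \<omega>' k = ray_prefix \<omega> k \<longrightarrow> ray_end n \<omega>' \<in> B"
      using \<omega> unfolding openin_free_boundary by blast
    have "cylinder n (ray_prefix \<omega> k) \<subseteq> B" using k by (auto simp: cylinder_def)
    then have "ray_prefix \<omega> k \<in> V" by (auto simp: V_def B_def split: if_splits)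
    moreover have "p \<in> cylinder n (ray_prefix \<omega> k)" using \<omega> by (auto simp: cylinder_def)
    ultimately show "p \<in> \<Union>(cylinder n ` V)" by blast
  qed
  moreover have "\<forall>U\<in>cylinder n ` V. openin (free_boundary n) U"
    using clopenin_cylinder by (auto simp: clopenin_def)
  ultimately obtain \<F> where "finite \<F>" "\<F> \<subseteq> cylinder n ` V" "topspace (free_boundary n) \<subseteq> \<Union>\<F>"
    using compact_space_free_boundary[of n] unfolding compact_space_alt by meson
  then obtain V' where V': "finite V'" "V' \<subseteq> V" "topspace (free_boundary n) \<subseteq> \<Union>(cylinder n ` V')"
    using finite_subset_image by metis
  define N where "N = Max (insert 0 (length ` V'))"
  show ?thesis
  proof (intro exI[of _ N] ballI impI)
    fix \<omega> \<omega>' assume *: "\<omega> \<in> rays n" "\<omega>' \<in> rays n" "ray_prefix \<omega> N = ray_prefix \<omega>' N"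
    have "ray_end n \<omega> \<in> topspace (free_boundary n)" using * by (simp add: topspace_free_boundary)
    then obtain v where v: "v \<in> V'" "ray_end n \<omega> \<in> cylinder n v" using V'(3) by blast
    have "\<omega> \<in> {\<omega> \<in> rays n. ray_prefix \<omega> (length v) = v}"
      using v(2) unfolding cylinder_def by (subst (asm) ray_end_in_image_iff[OF *(1)]) auto
    moreover have "length v \<le> N" using v(1) V'(1) by (simp add: N_def)
    ultimately have "ray_prefix \<omega>' (length v) = v" using ray_prefix_mono[OF *(3)] by simp
    then have "ray_end n \<omega>' \<in> cylinder n v" using *(2) by (auto simp: cylinder_def)
    then show "ray_end n \<omega> \<in> A \<longleftrightarrow> ray_end n \<omega>' \<in> A" using v V'(2) by (auto simp: V_def)
  qed
qed

section \<open>Lines and their end points\<close>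

lemma nat_pow_free_group:
  assumes "reduced u"
  shows "u [^]\<^bsub>free_group n\<^esub> (k::nat) = reduce (concat (replicate k u))"
proof (induction k)
  case 0
  then show ?case by (simp add: one_free_group nat_pow_def)
next
  case (Suc k)
  have "concat (replicate (Suc k) u) = concat (replicate k u) @ u"
    by (induction k) simp_all
  then show ?case
    using Suc by (simp add: nat_pow_def mult_free_group reduce_append_left)
qed

text \<open>Free groups are torsion free. Either the copies of \<open>w\<close> meet without
  cancellation and the power is reduced as it stands, or \<open>w\<close> is conjugate to its
  shorter middle part \<open>m\<close> and the powers are conjugate as well.\<close>

lemma reduce_concat_replicate_nonempty:
  assumes "reduced w" "w \<noteq> []" "k > 0"
  shows "reduce (concat (replicate k w)) \<noteq> []"
  using assms(1,2)
proof (induction "length w" arbitrary: w rule: less_induct)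
  case less
  show ?case
  proof (cases "hd w = inv_letter (last w)")
    case False
    \<comment> \<open>The claim also tracks the first letter of the power, so that the next copy can
      be attached without cancellation.\<close>
    have "reduced (concat (replicate k w)) \<and> (k > 0 \<longrightarrow> concat (replicate k w) \<noteq> [] \<and> hd (concat (replicate k w)) = hd w)" for k
    proof (induction k)
      case (Suc k)
      then show ?case using less.prems False by (cases k) (auto simp: reduced_append)
    qed simp
    then show ?thesis using assms(3) by (simp add: reduce_reduced)
  next
    case True
    define a where "a = hd w"
    obtain w' where w': "w = a # w'" using less.prems by (cases w) (auto simp: a_def)
    have "w' \<noteq> []" using True unfolding w' by auto
    then obtain m b where m: "w' = m @ [b]" by (metis rev_exhaust)
    have w: "w = a # m @ [inv_letter a]" using True unfolding w' m by simp
    have red: "reduced m" "m \<noteq> []" using less.prems unfolding w by (auto simp: reduced_Cons reduced_append)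
    \<comment> \<open>Inverse letters cancel between consecutive copies and leave a single
      conjugation around the power of \<open>m\<close>.\<close>
    have M: "reduce (concat (replicate j w)) = reduce ([a] @ concat (replicate j m) @ inv_word [a])" for j
    proof (induction j)
      case 0 then show ?case using reduce_inv_right[of "[a]"] by simp
    next
      case (Suc j)
      have "reduce (concat (replicate (Suc j) w)) = reduce (w @ [a] @ concat (replicate j m) @ inv_word [a])"
        using Suc by (metis concat.simps(2) reduce_append_right replicate_Suc)
      also have "\<dots> = reduce (([a] @ m) @ (inv_word [a] @ [a]) @ concat (replicate j m) @ inv_word [a])"
        by (simp add: w)
      also have "\<dots> = reduce (([a] @ m) @ concat (replicate j m) @ inv_word [a])"
        by (rule reduce_cancel_middle[OF reduce_inv_left])
      finally show ?case by simp
    qed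
    show ?thesis
    proof
      assume "reduce (concat (replicate k w)) = []"
      then have "reduce ([a] @ concat (replicate k m) @ inv_word [a]) = []" using M by simp
      then have "reduce (inv_word [a] @ ([a] @ concat (replicate k m) @ inv_word [a]) @ [a]) = reduce (inv_word [a] @ [a])"
        by (rule reduce_cancel_middle)
      then have "reduce (inv_word [a] @ [a] @ (concat (replicate k m) @ inv_word [a] @ [a])) = []"
        using reduce_inv_left[of "[a]"] by simp
      then have "reduce (concat (replicate k m)) = []"
        unfolding reduce_cancel_left(3) reduce_cancel_right(4) .
      moreover have "length m < length w" by (simp add: w)
      ultimately show False using less.hyps red by blast
    qed
  qed
qed

lemma int_pow_free_group_eq_one:
  assumes "u \<in> carrier (free_group n)" "u \<noteq> []" "u [^]\<^bsub>free_group n\<^esub> (k::int) = []"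
  shows "k = 0"
proof (rule ccontr)
  assume "k \<noteq> 0"
  interpret G: group "free_group n" by (rule group_free_group)
  let ?p = "u [^]\<^bsub>free_group n\<^esub> (nat \<bar>k\<bar>)"
  have p: "?p \<in> carrier (free_group n)" using assms(1) by (rule G.nat_pow_closed)
  have "?p = \<one>\<^bsub>free_group n\<^esub>"
  proof (cases "k < 0")
    case True
    then have "inv\<^bsub>free_group n\<^esub> ?p = \<one>\<^bsub>free_group n\<^esub>"
      using assms(3) by (simp add: int_pow_def2[of _ _ k] one_free_group)
    then show ?thesis using G.inv_eq_1_iff[OF p] by simp
  next
    case False
    then have "u [^]\<^bsub>free_group n\<^esub> k = ?p" by (subst int_pow_def2) simp
    then show ?thesis using assms(3) by (simp only: one_free_group)
  qed
  moreover have "reduced u" using assms(1) by (simp add: carrier_free_group)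
  ultimately have "reduce (concat (replicate (nat \<bar>k\<bar>) u)) = []"
    by (simp only: nat_pow_free_group one_free_group)
  then show False
    using reduce_concat_replicate_nonempty[of u "nat \<bar>k\<bar>"] assms(2) \<open>k \<noteq> 0\<close> \<open>reduced u\<close> by simp
qed

lemma inj_int_pow_free_group:
  assumes g: "g \<in> carrier (free_group n)" and u: "u \<in> carrier (free_group n)" "u \<noteq> []"
    and eq: "g \<otimes>\<^bsub>free_group n\<^esub> u [^]\<^bsub>free_group n\<^esub> (i::int) = g \<otimes>\<^bsub>free_group n\<^esub> u [^]\<^bsub>free_group n\<^esub> j"
  shows "i = j"
proof -
  interpret G: group "free_group n" by (rule group_free_group)
  have "u [^]\<^bsub>free_group n\<^esub> i = u [^]\<^bsub>free_group n\<^esub> j" using eq g u by (simp add: G.Units_eq)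
  then have "u [^]\<^bsub>free_group n\<^esub> (i - j) = \<one>\<^bsub>free_group n\<^esub>" using u by (simp add: G.int_pow_diff)
  then show ?thesis using int_pow_free_group_eq_one[OF u, of "i - j"] by (simp add: one_free_group)
qed

section \<open>Paths with bounded steps in the tree\<close>

text \<open>Moving a distance \<open>L\<close> in the tree can alter only the last \<open>L\<close>
  letters of a reduced word.\<close>

lemma take_eq_of_close:
  assumes "reduced g" "reduced h" "length (reduce (inv_word g @ h)) \<le> L" "N + L \<le> length g"
  shows "N \<le> length h \<and> take N g = take N h"
proof -
  have "length (reduce (inv_word g @ h)) + 2 * lcp_length g h = length g + length h"
    using assms by (intro length_reduce_inv_append)
  moreover have "lcp_length g h \<le> length h" using le_lcp_length_iff[of "lcp_length g h" g h] by simp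
  ultimately have "N \<le> lcp_length g h" using assms(3,4) by linarith
  then show ?thesis by (simp add: le_lcp_length_iff)
qed

lemma finite_ball: "finite {w \<in> carrier (free_group n). length w \<le> d}"
proof (rule finite_subset)
  show "{w \<in> carrier (free_group n). length w \<le> d} \<subseteq> {w. set w \<subseteq> letters n \<and> length w \<le> d}"
    by (auto simp: carrier_free_group)
  show "finite {w. set w \<subseteq> letters n \<and> length w \<le> d}"
    by (rule finite_lists_length_le[OF finite_letters])
qed

text \<open>Balls are finite, so an injective sequence of vertices leaves each of them for
  good.\<close>

lemma eventually_long:
  assumes x: "range x \<subseteq> carrier (free_group n)" and inj: "inj x"
  shows "\<exists>M::nat. \<forall>i\<ge>M. d \<le> length (x i)"
proof -
  have "finite (x -` {w \<in> carrier (free_group n). length w \<le> d})"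
    by (rule finite_vimageI[OF finite_ball inj])
  then obtain M where "\<forall>i\<in>x -` {w \<in> carrier (free_group n). length w \<le> d}. i < M"
    using finite_nat_set_iff_bounded by metis
  then have M: "\<forall>i. length (x i) \<le> d \<longrightarrow> i < M" using x by (auto simp: image_subset_iff)
  show ?thesis
  proof (intro exI allI impI)
    fix i assume "M \<le> i"
    then show "d \<le> length (x i)" using M[rule_format, of i] by linarith
  qed
qed

text \<open>From the moment on when all words have length at least \<open>d + L\<close>, no step can
  change the first \<open>d\<close> letters.\<close>

lemma quasi_path_converges:
  assumes x: "range x \<subseteq> carrier (free_group n)" and inj: "inj x"
    and step: "\<And>k. length (reduce (inv_word (x k) @ x (Suc k))) \<le> L"
  shows "\<exists>\<omega>\<in>rays n. tends_to_ray x \<omega>"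
proof -
  have red: "reduced (x k)" for k using x by (auto simp: carrier_free_group)
  have "\<exists>M. \<forall>i\<ge>M. \<forall>j\<ge>M. d \<le> length (x i) \<and> take d (x i) = take d (x j)" for d
  proof -
    obtain M where M: "\<forall>i\<ge>M. d + L \<le> length (x i)" using eventually_long[OF x inj] by blast
    have take: "take d (x i) = take d (x M)" if "M \<le> i" for i
      using that
    proof (induction i rule: dec_induct)
      case (step i)
      then have "take d (x i) = take d (x (Suc i))"
        using take_eq_of_close[OF red red assms(3)[of i]] M by simp
      then show ?case using step by simp
    qed simp
    show ?thesis
    proof (intro exI allI impI conjI)
      fix i j assume "M \<le> i" "M \<le> j"
      then show "d \<le> length (x i)" "take d (x i) = take d (x j)"
        using M[rule_format, of i] take[of i] take[of j] by simp_all
    qed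
  qed
  then obtain \<omega> where "\<omega> \<in> rays n" "tends_to_ray x \<omega>" by (rule ray_of_stable_prefixes[OF x])
  then show ?thesis by (intro bexI)
qed

lemma first_change: "\<not> Q 0 \<Longrightarrow> Q m \<Longrightarrow> \<exists>k::nat. \<not> Q k \<and> Q (Suc k)"
  by (induction m) auto

text \<open>Removing the ray vertex at depth \<open>d\<close> separates the start from the limit, so
  a step that creates the prefix of length \<open>d\<close> has this vertex on its geodesic, within
  \<open>L\<close> of its starting point. The bound on \<open>length (x 0)\<close> puts the start on
  the near side.\<close>

lemma quasi_path_near_ray:
  assumes x: "range x \<subseteq> carrier (free_group n)" and lim: "tends_to_ray x \<omega>"
    and step: "\<And>k. length (reduce (inv_word (x k) @ x (Suc k))) \<le> L"
    and d: "length (x 0) < d"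
  shows "\<exists>k. length (reduce (inv_word (x k) @ ray_prefix \<omega> d)) \<le> L"
proof -
  define Q where "Q k \<longleftrightarrow> d \<le> length (x k) \<and> take d (x k) = ray_prefix \<omega> d" for k
  obtain m where "\<forall>i\<ge>m. d \<le> length (x i) \<and> take d (x i) = ray_prefix \<omega> d"
    using lim unfolding tends_to_ray_def by blast
  then have "Q m" by (simp add: Q_def)
  moreover have "\<not> Q 0" using d by (simp add: Q_def)
  ultimately obtain k where k: "\<not> Q k" "Q (Suc k)" using first_change[of Q m] by blast
  have red: "reduced (x k)" for k using x by (auto simp: carrier_free_group)
  let ?p = "ray_prefix \<omega> d"
  let ?j = "lcp_length (x k) (x (Suc k))"
  have p: "?p = take d (x (Suc k))" "d \<le> length (x (Suc k))" using k(2) by (simp_all add: Q_def)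
  then have redp: "reduced ?p" using red[of "Suc k"] by (metis append_take_drop_id reduced_append)
  have nj: "?j < d"
  proof (rule ccontr)
    assume "\<not> ?j < d"
    then have "d \<le> ?j" by simp
    then show False using k(1) p unfolding le_lcp_length_iff Q_def by simp
  qed
  have "?j \<le> length (x k)" "take ?j (x k) = take ?j (x (Suc k))"
    using le_lcp_length_iff[of ?j "x k" "x (Suc k)"] by simp_all
  then have "?j \<le> lcp_length (x k) ?p"
    unfolding le_lcp_length_iff[of ?j "x k" ?p] using nj p by (simp add: min_absorb1)
  moreover have "length (reduce (inv_word (x k) @ x (Suc k))) + 2 * ?j = length (x k) + length (x (Suc k))"
    by (rule length_reduce_inv_append[OF red red])
  moreover have "length (reduce (inv_word (x k) @ ?p)) + 2 * lcp_length (x k) ?p = length (x k) + length ?p"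
    by (rule length_reduce_inv_append[OF red redp])
  ultimately show ?thesis using step[of k] p(2) by (intro exI[of _ k]) simp
qed

locale free_group_of_rank =
  fixes n :: nat
begin

abbreviation "F \<equiv> free_group n"

sublocale G: group F by (rule group_free_group)

definition axis_path :: "letter list \<Rightarrow> letter list \<Rightarrow> nat \<Rightarrow> letter list" where
  "axis_path g u k = g \<otimes>\<^bsub>F\<^esub> u [^]\<^bsub>F\<^esub> k"

lemma axis_path_closed: "g \<in> carrier F \<Longrightarrow> u \<in> carrier F \<Longrightarrow> range (axis_path g u) \<subseteq> carrier F"
  by (auto simp: axis_path_def)

lemma inj_axis_path:
  assumes "g \<in> carrier F" "u \<in> carrier F" "u \<noteq> []" shows "inj (axis_path g u)"
proof (rule injI)
  fix i j assume "axis_path g u i = axis_path g u j"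
  then have "g \<otimes>\<^bsub>F\<^esub> u [^]\<^bsub>F\<^esub> int i = g \<otimes>\<^bsub>F\<^esub> u [^]\<^bsub>F\<^esub> int j" by (simp add: axis_path_def int_pow_int)
  then have "int i = int j" by (rule inj_int_pow_free_group[OF assms])
  then show "i = j" by simp
qed

lemma axis_path_Suc: "g \<in> carrier F \<Longrightarrow> u \<in> carrier F \<Longrightarrow> axis_path g u (Suc k) = reduce (axis_path g u k @ u)"
  by (simp add: axis_path_def G.m_assoc flip: mult_free_group[of n])

lemma axis_path_step:
  assumes "g \<in> carrier F" "u \<in> carrier F"
  shows "length (reduce (inv_word (axis_path g u k) @ axis_path g u (Suc k))) \<le> length u"
  using length_reduce[of u] assms by (simp add: axis_path_Suc)

lemma axis_path_converges:
  assumes "g \<in> carrier F" "u \<in> carrier F" "u \<noteq> []"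
  shows "\<exists>\<omega>\<in>rays n. tends_to_ray (axis_path g u) \<omega>"
  by (rule quasi_path_converges[OF axis_path_closed[OF assms(1,2)] inj_axis_path[OF assms] axis_path_step[OF assms(1,2)]])

text \<open>Both paths come within bounded distance of every deep ray vertex, so the differences
  \<open>z d\<close> between them lie in a finite ball. Equal differences at two depths yield
  conjugate powers. Both exponents are positive because the two paths run towards the common end;
  this orientation is what tells the two ends of a line apart.\<close>

lemma commensurable_of_common_end:
  assumes g: "g \<in> carrier F" and u: "u \<in> carrier F" "u \<noteq> []" and h: "h \<in> carrier F" and v: "v \<in> carrier F" "v \<noteq> []"
    and lim: "tends_to_ray (axis_path g u) \<omega>" "tends_to_ray (axis_path h v) \<omega>"
  shows "\<exists>a>0. \<exists>b>0. (inv\<^bsub>F\<^esub> g \<otimes>\<^bsub>F\<^esub> h) \<otimes>\<^bsub>F\<^esub> v [^]\<^bsub>F\<^esub> (b::nat) \<otimes>\<^bsub>F\<^esub> inv\<^bsub>F\<^esub> (inv\<^bsub>F\<^esub> g \<otimes>\<^bsub>F\<^esub> h)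
     = u [^]\<^bsub>F\<^esub> (a::nat)"
proof -
  let ?x = "axis_path g u" and ?y = "axis_path h v"
  \<comment> \<open>Both starting words are shorter than \<open>d0\<close>, so ray vertices from
    this depth on lie beyond them.\<close>
  define d0 where "d0 = Suc (max (length g) (length h))"
  have "?x 0 = g" "?y 0 = h" using g h by (simp_all add: axis_path_def)
  then have "\<forall>d. \<exists>k m. d \<ge> d0 \<longrightarrow> length (reduce (inv_word (?x k) @ ray_prefix \<omega> d)) \<le> length u \<and>
      length (reduce (inv_word (?y m) @ ray_prefix \<omega> d)) \<le> length v"
    using quasi_path_near_ray[OF axis_path_closed[OF g u(1)] lim(1) axis_path_step[OF g u(1)]]
      quasi_path_near_ray[OF axis_path_closed[OF h v(1)] lim(2) axis_path_step[OF h v(1)]]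
    by (metis Suc_le_lessD d0_def le_less_trans max.cobounded1 max.cobounded2)
  then obtain K M where KM: "\<And>d. d \<ge> d0 \<Longrightarrow> length (reduce (inv_word (?x (K d)) @ ray_prefix \<omega> d)) \<le> length u \<and>
      length (reduce (inv_word (?y (M d)) @ ray_prefix \<omega> d)) \<le> length v"
    by metis
  have red: "reduced (?x k)" "reduced (?y k)" for k
    using subsetD[OF axis_path_closed[OF g u(1)], of "?x k"]
      subsetD[OF axis_path_closed[OF h v(1)], of "?y k"] by (simp_all add: carrier_free_group)
  define z where "z d = reduce (inv_word (?x (K d)) @ ?y (M d))" for d
  have z: "z d \<in> {w \<in> carrier F. length w \<le> length u + length v}" if d: "d \<ge> d0" for d
  proof -
    \<comment> \<open>The difference is routed through the ray vertex at depth \<open>d\<close>,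
      which bounds its length by the sum of the two distances.\<close>
    have "z d = reduce (reduce (inv_word (?x (K d)) @ ray_prefix \<omega> d) @ inv_word (reduce (inv_word (?y (M d)) @ ray_prefix \<omega> d)))"
    proof -
      have "reduce (inv_word (reduce w)) = reduce (inv_word w)" for w
        by (metis append_Nil reduce_append_right reduce_cancel_left(1) reduce_cancel_right(2) reduce_inv_left append_Nil2 reduce_append_left)
      then have "reduce (reduce (inv_word (?x (K d)) @ ray_prefix \<omega> d) @ inv_word (reduce (inv_word (?y (M d)) @ ray_prefix \<omega> d)))
          = reduce ((inv_word (?x (K d)) @ ray_prefix \<omega> d) @ inv_word (inv_word (?y (M d)) @ ray_prefix \<omega> d))"
        by (metis reduce_append_left reduce_append_right)
      then show ?thesis
        using reduce_cancel_middle[OF reduce_inv_right, of "inv_word (?x (K d))" "ray_prefix \<omega> d" "?y (M d)"]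
        by (simp add: z_def)
    qed
    then have "length (z d) \<le> length u + length v"
      using KM[OF d] length_reduce[of "reduce (inv_word (?x (K d)) @ ray_prefix \<omega> d) @ inv_word (reduce (inv_word (?y (M d)) @ ray_prefix \<omega> d))"]
      by simp
    moreover have "?x (K d) \<in> carrier F" "?y (M d) \<in> carrier F"
      using axis_path_closed[OF g u(1)] axis_path_closed[OF h v(1)] by auto
    then have "z d \<in> carrier F"
      unfolding z_def by (intro reduce_in_carrier) (auto simp: carrier_free_group set_inv_word[THEN iffD2, THEN subsetD])
    ultimately show ?thesis by simp
  qed
  have "infinite {d0..}" by (rule infinite_Ici)
  moreover have "finite (z ` {d0..})"
    using z by (intro finite_subset[OF _ finite_ball]) auto
  ultimately obtain e where e: "e \<in> {d0..}" "infinite {d \<in> {d0..}. z d = z e}"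
    using pigeonhole_infinite by blast
  \<comment> \<open>Up to the indices \<open>K e\<close> and \<open>M e\<close> no vertex is longer
    than \<open>B\<close>. A ray vertex deeper than \<open>B + length u + length v\<close> is near
    none of them, which forces strictly larger indices and thus positive exponents.\<close>
  define B where "B = Max (insert 0 (length ` (?x ` {..K e} \<union> ?y ` {..M e})))"
  have B: "length (?x k) \<le> B" if "k \<le> K e" for k
    unfolding B_def using that by (intro Max_ge) auto
  have B': "length (?y k) \<le> B" if "k \<le> M e" for k
    unfolding B_def using that by (intro Max_ge) auto
  obtain d where d: "d \<ge> d0" "z d = z e" "d > B + length u + length v"
    using e(2) unfolding infinite_nat_iff_unbounded by auto
  have far: "d \<le> length w + L" if "reduced w" "length (reduce (inv_word w @ ray_prefix \<omega> d)) \<le> L" for w L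
  proof -
    have "reduced (ray_prefix \<omega> d)"
    proof -
      obtain j where "take d (?x j) = ray_prefix \<omega> d" using lim(1) unfolding tends_to_ray_def by blast
      then show ?thesis using red(1)[of j] by (metis append_take_drop_id reduced_append)
    qed
    then have "length (reduce (inv_word w @ ray_prefix \<omega> d)) + 2 * lcp_length w (ray_prefix \<omega> d) = length w + d"
      using length_reduce_inv_append[OF that(1)] by simp
    moreover have "lcp_length w (ray_prefix \<omega> d) \<le> length w"
      using le_lcp_length_iff[of "lcp_length w (ray_prefix \<omega> d)" w "ray_prefix \<omega> d"] by simp
    ultimately show ?thesis using that(2) by linarith
  qed
  have K: "K e < K d"
  proof (rule ccontr)
    assume "\<not> ?thesis"
    then have "length (?x (K d)) \<le> B" by (intro B) simp
    moreover have "d \<le> length (?x (K d)) + length u" using far[OF red(1)] KM[OF d(1)] by blast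
    ultimately show False using d(3) by linarith
  qed
  have M: "M e < M d"
  proof (rule ccontr)
    assume "\<not> ?thesis"
    then have "length (?y (M d)) \<le> B" by (intro B') simp
    moreover have "d \<le> length (?y (M d)) + length v" using far[OF red(2)] KM[OF d(1)] by blast
    ultimately show False using d(3) by linarith
  qed
  define \<gamma> where "\<gamma> = inv\<^bsub>F\<^esub> g \<otimes>\<^bsub>F\<^esub> h"
  have \<gamma>: "\<gamma> \<in> carrier F" using g h by (simp add: \<gamma>_def)
  have zz: "z d = inv\<^bsub>F\<^esub> (u [^]\<^bsub>F\<^esub> K d) \<otimes>\<^bsub>F\<^esub> \<gamma> \<otimes>\<^bsub>F\<^esub> v [^]\<^bsub>F\<^esub> M d" for d
  proof -
    have "?x (K d) \<in> carrier F" using axis_path_closed[OF g u(1)] by auto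
    then have "z d = inv\<^bsub>F\<^esub> (?x (K d)) \<otimes>\<^bsub>F\<^esub> ?y (M d)" by (simp add: z_def mult_free_group inv_free_group)
    then show ?thesis using g h u v by (simp add: axis_path_def \<gamma>_def G.inv_mult_group G.m_assoc)
  qed
  define a b where "a = K d - K e" and "b = M d - M e"
  have pa: "u [^]\<^bsub>F\<^esub> K d = u [^]\<^bsub>F\<^esub> a \<otimes>\<^bsub>F\<^esub> u [^]\<^bsub>F\<^esub> K e"
    using K u by (simp add: a_def G.nat_pow_mult)
  have pb: "v [^]\<^bsub>F\<^esub> M d = v [^]\<^bsub>F\<^esub> b \<otimes>\<^bsub>F\<^esub> v [^]\<^bsub>F\<^esub> M e"
    using M v by (simp add: b_def G.nat_pow_mult)
  define P Q S T where "P = u [^]\<^bsub>F\<^esub> K e" and "Q = v [^]\<^bsub>F\<^esub> M e" and "S = u [^]\<^bsub>F\<^esub> a" and "T = v [^]\<^bsub>F\<^esub> b"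
  have car: "P \<in> carrier F" "Q \<in> carrier F" "S \<in> carrier F" "T \<in> carrier F"
    using u v by (simp_all add: P_def Q_def S_def T_def)
  have "inv\<^bsub>F\<^esub> (S \<otimes>\<^bsub>F\<^esub> P) \<otimes>\<^bsub>F\<^esub> \<gamma> \<otimes>\<^bsub>F\<^esub> (T \<otimes>\<^bsub>F\<^esub> Q) = inv\<^bsub>F\<^esub> P \<otimes>\<^bsub>F\<^esub> \<gamma> \<otimes>\<^bsub>F\<^esub> Q"
    using d(2) unfolding zz pa pb by (simp add: P_def Q_def S_def T_def)
  then have "(inv\<^bsub>F\<^esub> P \<otimes>\<^bsub>F\<^esub> (inv\<^bsub>F\<^esub> S \<otimes>\<^bsub>F\<^esub> \<gamma> \<otimes>\<^bsub>F\<^esub> T)) \<otimes>\<^bsub>F\<^esub> Q = (inv\<^bsub>F\<^esub> P \<otimes>\<^bsub>F\<^esub> \<gamma>) \<otimes>\<^bsub>F\<^esub> Q"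
    using car \<gamma> by (simp add: G.inv_mult_group G.m_assoc)
  then have "inv\<^bsub>F\<^esub> S \<otimes>\<^bsub>F\<^esub> \<gamma> \<otimes>\<^bsub>F\<^esub> T = \<gamma>"
    using car \<gamma> by (simp only: G.right_cancel G.Units_l_cancel G.Units_eq G.inv_closed G.m_closed)
  then have "\<gamma> \<otimes>\<^bsub>F\<^esub> T = S \<otimes>\<^bsub>F\<^esub> \<gamma>"
    using car \<gamma> G.inv_solve_left'[of \<gamma> S "\<gamma> \<otimes>\<^bsub>F\<^esub> T"] by (simp add: G.m_assoc)
  then have "\<gamma> \<otimes>\<^bsub>F\<^esub> T \<otimes>\<^bsub>F\<^esub> inv\<^bsub>F\<^esub> \<gamma> = S"
    using car \<gamma> by (simp add: G.m_assoc)
  moreover have "a > 0" "b > 0" using K M by (simp_all add: a_def b_def)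
  ultimately show ?thesis unfolding S_def T_def \<gamma>_def by blast
qed

end

section \<open>Lines of a malnormal family and their ends\<close>

locale malnormal_words = free_group_of_rank n for n +
  fixes ws :: "letter list list"
  assumes letters: "\<And>w. w \<in> set ws \<Longrightarrow> set w \<subseteq> letters n"
    and malnormal: "malnormal_family (free_group n) (map reduce ws)"
begin

definition root :: "nat \<Rightarrow> letter list" where
  "root i = reduce (ws ! i)"

text \<open>The sign selects the direction of travel, so that both ends of a line are limits of
  forward paths.\<close>

definition signed_root :: "nat \<Rightarrow> bool \<Rightarrow> letter list" where
  "signed_root i s = (if s then root i else inv\<^bsub>F\<^esub> (root i))"

lemma root_closed: "i < length ws \<Longrightarrow> root i \<in> carrier F"
  unfolding root_def by (intro reduce_in_carrier letters) simp

lemma root_nonempty: "i < length ws \<Longrightarrow> root i \<noteq> []"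
  using malnormal by (simp add: malnormal_family_def root_def one_free_group)

lemma signed_root_closed: "i < length ws \<Longrightarrow> signed_root i s \<in> carrier F"
  by (simp add: signed_root_def root_closed)

lemma signed_root_nonempty: "i < length ws \<Longrightarrow> signed_root i s \<noteq> []"
  using root_nonempty[of i] root_closed[of i] by (simp add: signed_root_def inv_free_group)

lemma signed_root_pow:
  "i < length ws \<Longrightarrow> signed_root i s [^]\<^bsub>F\<^esub> (k::nat) = root i [^]\<^bsub>F\<^esub> (if s then int k else - int k)"
  by (simp add: signed_root_def root_closed int_pow_int G.int_pow_neg G.nat_pow_inv)

definition limit_ray :: "letter list \<Rightarrow> letter list \<Rightarrow> nat \<Rightarrow> letter" where
  "limit_ray g u = (SOME \<omega>. \<omega> \<in> rays n \<and> tends_to_ray (axis_path g u) \<omega>)"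

lemma limit_ray:
  assumes "g \<in> carrier F" "u \<in> carrier F" "u \<noteq> []"
  shows "limit_ray g u \<in> rays n" "tends_to_ray (axis_path g u) (limit_ray g u)"
proof -
  have "\<exists>\<omega>. \<omega> \<in> rays n \<and> tends_to_ray (axis_path g u) \<omega>"
    using axis_path_converges[OF assms] by (elim bexE) (intro exI conjI)
  then have "limit_ray g u \<in> rays n \<and> tends_to_ray (axis_path g u) (limit_ray g u)"
    unfolding limit_ray_def by (rule someI_ex)
  then show "limit_ray g u \<in> rays n" "tends_to_ray (axis_path g u) (limit_ray g u)" by simp_all
qed

text \<open>Starting elsewhere on the same line shifts the index by \<open>c\<close>, and a limit
  ignores any initial segment.\<close>

lemma limit_ray_shift:
  assumes g: "g \<in> carrier F" and u: "u \<in> carrier F" "u \<noteq> []"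
  shows "limit_ray (g \<otimes>\<^bsub>F\<^esub> u [^]\<^bsub>F\<^esub> (c::int)) u = limit_ray g u"
proof -
  let ?h = "g \<otimes>\<^bsub>F\<^esub> u [^]\<^bsub>F\<^esub> c"
  have h: "?h \<in> carrier F" using g u by simp
  \<comment> \<open>For negative \<open>c\<close> the shifted index is a natural number only once
    \<open>k\<close> has reached the absolute value of \<open>c\<close>.\<close>
  have eq: "axis_path ?h u k = axis_path g u (nat (c + int k))" if "nat \<bar>c\<bar> \<le> k" for k
  proof -
    have "axis_path ?h u k = g \<otimes>\<^bsub>F\<^esub> u [^]\<^bsub>F\<^esub> (c + int k)"
      using g u by (simp add: axis_path_def G.int_pow_mult G.m_assoc int_pow_int)
    also have "c + int k = int (nat (c + int k))" using that by linarith
    finally show ?thesis by (simp only: axis_path_def int_pow_int)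
  qed
  have "tends_to_ray (axis_path ?h u) (limit_ray g u)"
    unfolding tends_to_ray_def
  proof
    fix d
    obtain M where M: "\<forall>i\<ge>M. d \<le> length (axis_path g u i) \<and> take d (axis_path g u i) = ray_prefix (limit_ray g u) d"
      using limit_ray(2)[OF g u] unfolding tends_to_ray_def by blast
    show "\<exists>M. \<forall>i\<ge>M. d \<le> length (axis_path ?h u i) \<and> take d (axis_path ?h u i) = ray_prefix (limit_ray g u) d"
    proof (intro exI allI impI)
      fix i assume i: "M + nat \<bar>c\<bar> \<le> i"
      then have "M \<le> nat (c + int i)" by linarith
      then show "d \<le> length (axis_path ?h u i) \<and> take d (axis_path ?h u i) = ray_prefix (limit_ray g u) d"
        using M eq[of i] i by simp
    qed
  qed
  then show ?thesis using limit_ray(2)[OF h u] tends_to_ray_unique by blast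
qed

definition signed_end :: "nat \<Rightarrow> bool \<Rightarrow> letter list \<Rightarrow> nat \<Rightarrow> letter" where
  "signed_end i s g = limit_ray g (signed_root i s)"

lemma signed_end_in_rays: "i < length ws \<Longrightarrow> g \<in> carrier F \<Longrightarrow> signed_end i s g \<in> rays n"
  unfolding signed_end_def by (rule limit_ray(1)[OF _ signed_root_closed signed_root_nonempty])

lemma tends_to_signed_end:
  "i < length ws \<Longrightarrow> g \<in> carrier F \<Longrightarrow> tends_to_ray (axis_path g (signed_root i s)) (signed_end i s g)"
  unfolding signed_end_def by (rule limit_ray(2)[OF _ signed_root_closed signed_root_nonempty])

lemma signed_end_shift:
  assumes i: "i < length ws" and g: "g \<in> carrier F"
  shows "signed_end i s (g \<otimes>\<^bsub>F\<^esub> root i [^]\<^bsub>F\<^esub> (c::int)) = signed_end i s g"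
proof -
  have "root i [^]\<^bsub>F\<^esub> c = signed_root i s [^]\<^bsub>F\<^esub> (if s then c else - c)"
    using root_closed[OF i] by (simp add: signed_root_def G.int_pow_inv G.int_pow_neg)
  then show ?thesis
    unfolding signed_end_def
    using limit_ray_shift[OF g signed_root_closed[OF i, of s] signed_root_nonempty[OF i, of s]] by simp
qed

lemma generate_root: "i < length ws \<Longrightarrow> generate F {map reduce ws ! i} = range (\<lambda>k::int. root i [^]\<^bsub>F\<^esub> k)"
  using G.generate_pow[OF root_closed] by (auto simp: root_def)

text \<open>Malnormality acts here: a common end makes powers of the two roots conjugate, so the
  indices agree and \<open>\<gamma>\<close> is a power of the root. It then commutes with the root,
  the exponents \<open>\<alpha>\<close> and \<open>\<beta>\<close> coincide, and positivity of
  \<open>a\<close> and \<open>b\<close> excludes opposite directions.\<close>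

lemma signed_end_eqD:
  assumes i: "i < length ws" and g: "g \<in> carrier F" and j: "j < length ws" and h: "h \<in> carrier F"
    and eq: "signed_end i s g = signed_end j t h"
  shows "i = j \<and> s = t \<and> (\<exists>c::int. h = g \<otimes>\<^bsub>F\<^esub> root i [^]\<^bsub>F\<^esub> c)"
proof -
  define \<gamma> where "\<gamma> = inv\<^bsub>F\<^esub> g \<otimes>\<^bsub>F\<^esub> h"
  have \<gamma>: "\<gamma> \<in> carrier F" using g h by (simp add: \<gamma>_def)
  have "tends_to_ray (axis_path h (signed_root j t)) (signed_end i s g)"
    using tends_to_signed_end[OF j h, of t] eq by simp
  then obtain a b :: nat where ab: "a > 0" "b > 0"
    and conj: "\<gamma> \<otimes>\<^bsub>F\<^esub> signed_root j t [^]\<^bsub>F\<^esub> b \<otimes>\<^bsub>F\<^esub> inv\<^bsub>F\<^esub> \<gamma> = signed_root i s [^]\<^bsub>F\<^esub> a"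
    using commensurable_of_common_end[OF g signed_root_closed[OF i] signed_root_nonempty[OF i] h
        signed_root_closed[OF j] signed_root_nonempty[OF j] tends_to_signed_end[OF i g]]
    unfolding \<gamma>_def by blast
  define \<alpha> \<beta> where "\<alpha> = (if s then int a else - int a)" and "\<beta> = (if t then int b else - int b)"
  have conj': "\<gamma> \<otimes>\<^bsub>F\<^esub> root j [^]\<^bsub>F\<^esub> \<beta> \<otimes>\<^bsub>F\<^esub> inv\<^bsub>F\<^esub> \<gamma> = root i [^]\<^bsub>F\<^esub> \<alpha>"
    using conj by (simp add: signed_root_pow i j \<alpha>_def \<beta>_def)
  have "root i [^]\<^bsub>F\<^esub> \<alpha> \<noteq> \<one>\<^bsub>F\<^esub>"
    using int_pow_free_group_eq_one[OF root_closed[OF i] root_nonempty[OF i], of \<alpha>] ab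
    by (auto simp: one_free_group \<alpha>_def)
  moreover have "root i [^]\<^bsub>F\<^esub> \<alpha> \<in> \<gamma> <#\<^bsub>F\<^esub> generate F {map reduce ws ! j} #>\<^bsub>F\<^esub> inv\<^bsub>F\<^esub> \<gamma>"
    unfolding generate_root[OF j] l_coset_def r_coset_def conj'[symmetric] by blast
  moreover have "root i [^]\<^bsub>F\<^esub> \<alpha> \<in> generate F {map reduce ws ! i}"
    unfolding generate_root[OF i] by blast
  ultimately have "(\<gamma> <#\<^bsub>F\<^esub> generate F {map reduce ws ! j} #>\<^bsub>F\<^esub> inv\<^bsub>F\<^esub> \<gamma>) \<inter> generate F {map reduce ws ! i} \<noteq> {\<one>\<^bsub>F\<^esub>}"
    by blast
  then have *: "j = i \<and> \<gamma> \<in> generate F {map reduce ws ! j}"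
    using malnormal i j \<gamma> unfolding malnormal_family_def by simp
  have ij: "j = i" and \<gamma>j: "\<gamma> \<in> generate F {map reduce ws ! j}"
    by (rule conjunct1[OF *], rule conjunct2[OF *])
  obtain c :: int where c: "\<gamma> = root i [^]\<^bsub>F\<^esub> c"
    using \<gamma>j unfolding ij generate_root[OF i] by blast
  have "h = g \<otimes>\<^bsub>F\<^esub> \<gamma>" using g h by (simp add: \<gamma>_def flip: G.m_assoc)
  moreover have "s = t"
  proof -
    have "root i [^]\<^bsub>F\<^esub> (c + \<beta> - c) = root i [^]\<^bsub>F\<^esub> \<alpha>"
      using conj' root_closed[OF i] unfolding ij c by (simp only: G.int_pow_diff G.int_pow_mult)
    then have "\<one>\<^bsub>F\<^esub> \<otimes>\<^bsub>F\<^esub> root i [^]\<^bsub>F\<^esub> \<beta> = \<one>\<^bsub>F\<^esub> \<otimes>\<^bsub>F\<^esub> root i [^]\<^bsub>F\<^esub> \<alpha>" by simp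
    then have "\<beta> = \<alpha>"
      by (rule inj_int_pow_free_group[OF G.one_closed root_closed[OF i] root_nonempty[OF i]])
    then show ?thesis using ab by (auto simp: \<alpha>_def \<beta>_def split: if_splits)
  qed
  ultimately show ?thesis using ij c by blast
qed

definition line :: "nat \<Rightarrow> letter list \<Rightarrow> (nat \<Rightarrow> letter list) set \<times> (nat \<Rightarrow> letter list) set" where
  "line i g = (ray_end n (signed_end i True g), ray_end n (signed_end i False g))"

definition lines :: "((nat \<Rightarrow> letter list) set \<times> (nat \<Rightarrow> letter list) set) set" where
  "lines = {line i g | i g. i < length ws \<and> g \<in> carrier F}"

lemma line_endpoints_pattern: "line_endpoints n ` line_pattern n (map reduce ws) = lines"
proof -
  have ep: "line_endpoints n (\<lambda>k. g \<otimes>\<^bsub>F\<^esub> root i [^]\<^bsub>F\<^esub> k) = line i g" if i: "i < length ws" and g: "g \<in> carrier F" for i g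
  proof -
    have seq: "axis_path g (signed_root i s) \<in> ray_end n (signed_end i s g)" for s
      using axis_path_closed[OF g signed_root_closed[OF i]] tends_to_signed_end[OF i g]
      by (simp add: ray_end_def)
    have "(\<lambda>k. g \<otimes>\<^bsub>F\<^esub> root i [^]\<^bsub>F\<^esub> int k) = axis_path g (signed_root i True)"
      by (simp add: axis_path_def fun_eq_iff signed_root_pow[OF i])
    moreover have "(\<lambda>k. g \<otimes>\<^bsub>F\<^esub> root i [^]\<^bsub>F\<^esub> (- int k)) = axis_path g (signed_root i False)"
      by (simp add: axis_path_def fun_eq_iff signed_root_pow[OF i])
    ultimately show ?thesis
      unfolding line_endpoints_def line_def
      by (simp only: boundary_limit_eq[OF signed_end_in_rays[OF i g] seq])
  qed
  show ?thesis
  proof (intro equalityI subsetI)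
    fix e assume "e \<in> line_endpoints n ` line_pattern n (map reduce ws)"
    then obtain g u where gu: "g \<in> carrier F" "u \<in> set (map reduce ws)"
      "e = line_endpoints n (\<lambda>k. g \<otimes>\<^bsub>F\<^esub> u [^]\<^bsub>F\<^esub> k)" unfolding line_pattern_def by blast
    then obtain i where "i < length ws" "u = root i" by (auto simp: in_set_conv_nth root_def)
    then show "e \<in> lines" using gu ep unfolding lines_def by blast
  next
    fix e assume "e \<in> lines"
    then obtain i g where ig: "i < length ws" "g \<in> carrier F" "e = line i g" unfolding lines_def by blast
    have "root i \<in> set (map reduce ws)" using ig(1) by (simp add: root_def)
    then have "(\<lambda>k. g \<otimes>\<^bsub>F\<^esub> root i [^]\<^bsub>F\<^esub> k) \<in> line_pattern n (map reduce ws)"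
      unfolding line_pattern_def using ig(2) by blast
    then show "e \<in> line_endpoints n ` line_pattern n (map reduce ws)"
      using ep[OF ig(1,2)] ig(3) by (metis imageI)
  qed
qed

lemma line_shift:
  "i < length ws \<Longrightarrow> g \<in> carrier F \<Longrightarrow> line i (g \<otimes>\<^bsub>F\<^esub> root i [^]\<^bsub>F\<^esub> (c::int)) = line i g"
  by (simp add: line_def signed_end_shift)

lemma line_common_end:
  assumes i: "i < length ws" "g \<in> carrier F" and j: "j < length ws" "h \<in> carrier F"
    and common: "{fst (line i g), snd (line i g)} \<inter> {fst (line j h), snd (line j h)} \<noteq> {}"
  shows "i = j \<and> (\<exists>c::int. h = g \<otimes>\<^bsub>F\<^esub> root i [^]\<^bsub>F\<^esub> c)"
proof -
  obtain s t where "ray_end n (signed_end i s g) = ray_end n (signed_end j t h)"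
    using common by (auto simp: line_def)
  then have "signed_end i s g = signed_end j t h"
    using ray_end_eq_iff signed_end_in_rays[OF i] by blast
  then show ?thesis using signed_end_eqD[OF i j] by blast
qed

lemma line_eq_iff:
  assumes i: "i < length ws" "g \<in> carrier F" and j: "j < length ws" "h \<in> carrier F"
  shows "line j h = line i g \<longleftrightarrow> i = j \<and> (\<exists>c::int. h = g \<otimes>\<^bsub>F\<^esub> root i [^]\<^bsub>F\<^esub> c)"
  using line_common_end[OF i j] line_shift[OF i] by auto

text \<open>Membership in \<open>B\<close> is decided by the first \<open>N\<close> letters. If all
  vertices \<open>x k\<close> of a line have length above \<open>N + length (root i)\<close>, they
  share one prefix of length \<open>N\<close>, and \<open>B\<close> cannot separate the ends. A
  split line thus has such a vertex in a finite ball.\<close>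

lemma finite_splitting_lines:
  assumes B: "clopenin (free_boundary n) B"
  shows "finite {e \<in> lines. splits B e}"
proof -
  obtain N where N': "\<forall>\<omega>\<in>rays n. \<forall>\<omega>'\<in>rays n. ray_prefix \<omega> N = ray_prefix \<omega>' N \<longrightarrow>
     (ray_end n \<omega> \<in> B \<longleftrightarrow> ray_end n \<omega>' \<in> B)"
    using clopenin_free_boundaryD[OF B] by (rule exE)
  note N = N'[rule_format]
  have "\<exists>h\<in>{w \<in> carrier F. length w \<le> N + length (root i)}. line i g = line i h"
    if i: "i < length ws" and g: "g \<in> carrier F" and sp: "splits B (line i g)" for i g
  proof -
    define x where "x k = g \<otimes>\<^bsub>F\<^esub> root i [^]\<^bsub>F\<^esub> (k::int)" for k
    have x: "x k \<in> carrier F" for k using g root_closed[OF i] by (simp add: x_def)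
    have xs: "x (k + 1) = reduce (x k @ root i)" for k
      using g root_closed[OF i] by (simp add: x_def G.int_pow_mult G.m_assoc flip: mult_free_group[of n])
    have "\<exists>k. length (x k) \<le> N + length (root i)"
    proof (rule ccontr)
      assume "\<not> ?thesis"
      then have long: "N + length (root i) \<le> length (x k)" for k by (simp add: not_le less_imp_le)
      have st: "take N (x k) = take N (x (k + 1))" for k
        using take_eq_of_close[of "x k" "x (k + 1)" "length (root i)" N] long[of k] x[of k] x[of "k + 1"]
          length_reduce[of "root i"] by (simp add: carrier_free_group xs)
      \<comment> \<open>Induction in both directions over the integers: the whole line keeps the
        prefix of its vertex 0.\<close>
      have const: "take N (x k) = take N (x 0)" for k
      proof (induction k rule: int_induct[where k = 0])
        case (step1 k) then show ?case using st[of k] by simp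
      next
        case (step2 k) then show ?case using st[of "k - 1"] by simp
      qed simp
      have "ray_prefix (signed_end i s g) N = take N (x 0)" for s
      proof -
        obtain M where "take N (axis_path g (signed_root i s) M) = ray_prefix (signed_end i s g) N"
          using tends_to_signed_end[OF i g, of s] unfolding tends_to_ray_def by blast
        then show ?thesis using const by (simp add: axis_path_def signed_root_pow[OF i] x_def)
      qed
      then have "ray_prefix (signed_end i True g) N = ray_prefix (signed_end i False g) N" by simp
      then have "ray_end n (signed_end i True g) \<in> B \<longleftrightarrow> ray_end n (signed_end i False g) \<in> B"
        by (rule N[OF signed_end_in_rays[OF i g] signed_end_in_rays[OF i g]])
      then show False using sp by (simp add: splits_def line_def)
    qed
    then obtain k where "length (x k) \<le> N + length (root i)" ..
    moreover have "line i (x k) = line i g" unfolding x_def by (rule line_shift[OF i g])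
    ultimately show ?thesis using x[of k] by (intro bexI[of _ "x k"]) simp_all
  qed
  then have "{e \<in> lines. splits B e} \<subseteq>
      (\<Union>i\<in>{..<length ws}. line i ` {w \<in> carrier F. length w \<le> N + length (root i)})"
    unfolding lines_def by blast
  then show ?thesis
    by (rule finite_subset) (intro finite_UN_I finite_imageI finite_ball finite_lessThan)
qed

sublocale pair_identification "free_boundary n" lines
proof
  show "compact_space (free_boundary n)" by (rule compact_space_free_boundary)
  show "lines \<subseteq> topspace (free_boundary n) \<times> topspace (free_boundary n)"
    using signed_end_in_rays by (auto simp: lines_def line_def topspace_free_boundary)
  show "\<exists>B. clopenin (free_boundary n) B \<and> p \<in> B \<and> B \<subseteq> U" if "openin (free_boundary n) U" "p \<in> U" for U p
    using that by (rule zero_dimensional_free_boundary)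
  show "\<exists>B. clopenin (free_boundary n) B \<and> p \<in> B \<and> q \<notin> B"
    if "p \<in> topspace (free_boundary n)" "q \<in> topspace (free_boundary n)" "p \<noteq> q" for p q
    using that by (rule clopen_separation_free_boundary)
  show "fst e \<noteq> snd e" if e: "e \<in> lines" for e
  proof
    assume eq: "fst e = snd e"
    obtain i g where ig: "i < length ws" "g \<in> carrier F" "e = line i g" using e unfolding lines_def by blast
    then have "signed_end i True g = signed_end i False g"
      using eq ray_end_eq_iff[OF signed_end_in_rays[OF ig(1,2)]] by (simp add: line_def)
    then show False using signed_end_eqD[OF ig(1,2) ig(1,2)] by blast
  qed
  show "e = e'" if e: "e \<in> lines" "e' \<in> lines" "{fst e, snd e} \<inter> {fst e', snd e'} \<noteq> {}" for e e'
  proof -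
    obtain i g where ig: "i < length ws" "g \<in> carrier F" "e = line i g" using e(1) unfolding lines_def by blast
    obtain j h where jh: "j < length ws" "h \<in> carrier F" "e' = line j h" using e(2) unfolding lines_def by blast
    have "i = j \<and> (\<exists>c::int. h = g \<otimes>\<^bsub>F\<^esub> root i [^]\<^bsub>F\<^esub> c)"
      by (rule line_common_end[OF ig(1,2) jh(1,2) e(3)[unfolded ig(3) jh(3)]])
    then show ?thesis using line_shift[OF ig(1,2)] ig(3) jh(3) by auto
  qed
  show "finite {e \<in> lines. splits B e}" if "clopenin (free_boundary n) B" for B
    using that by (rule finite_splitting_lines)
qed

lemma decomposition_space_eq: "decomposition_space n (map reduce ws) = D"
  unfolding decomposition_space_def endpoint_relation_def r_def line_endpoints_pattern Let_def ..

theorem trivial_cech_cohomology_iff: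
  "trivial_group (cech_cohomology 1 (decomposition_space n (map reduce ws))) \<longleftrightarrow>
    (\<forall>i g. i < length ws \<longrightarrow> g \<in> carrier F \<longrightarrow>
      (\<exists>A. clopenin (free_boundary n) A \<and>
        (\<forall>j h. j < length ws \<longrightarrow> h \<in> carrier F \<longrightarrow> (splits A (line j h) \<longleftrightarrow> line j h = line i g))))"
  (is "?l \<longleftrightarrow> ?r")
proof
  assume l: ?l
  show ?r
  proof (intro allI impI)
    fix i g assume "i < length ws" "g \<in> carrier F"
    then have le: "line i g \<in> lines" unfolding lines_def by blast
    obtain A where A: "clopenin (free_boundary n) A" "\<forall>e'\<in>lines. splits A e' \<longleftrightarrow> e' = line i g"
      using splitting_of_trivial_cohomology[OF l[unfolded decomposition_space_eq] le] by (elim exE conjE)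
    have "\<forall>j h. j < length ws \<longrightarrow> h \<in> carrier F \<longrightarrow> (splits A (line j h) \<longleftrightarrow> line j h = line i g)"
      by (intro allI impI A(2)[rule_format]) (auto simp: lines_def)
    then show "\<exists>A. clopenin (free_boundary n) A \<and>
        (\<forall>j h. j < length ws \<longrightarrow> h \<in> carrier F \<longrightarrow> (splits A (line j h) \<longleftrightarrow> line j h = line i g))"
      using A(1) by (intro exI[of _ A] conjI)
  qed
next
  assume r: ?r
  show ?l
    unfolding decomposition_space_eq
  proof (rule trivial_cohomology_of_splitting)
    fix e assume "e \<in> lines"
    then obtain i g where ig: "i < length ws" "g \<in> carrier F" "e = line i g" unfolding lines_def by blast
    obtain A where A: "clopenin (free_boundary n) A"
      "\<forall>j h. j < length ws \<longrightarrow> h \<in> carrier F \<longrightarrow> (splits A (line j h) \<longleftrightarrow> line j h = line i g)"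
      using r[rule_format, OF ig(1,2)] by (elim exE conjE)
    have "\<forall>e'\<in>lines. splits A e' \<longleftrightarrow> e' = e"
      unfolding lines_def ig(3) using A(2) by auto
    then show "\<exists>A. clopenin (free_boundary n) A \<and> (\<forall>e'\<in>lines. splits A e' \<longleftrightarrow> e' = e)"
      using A(1) by (intro exI[of _ A] conjI)
  qed
qed

end

section \<open>Counting crossings mod 2\<close>

text \<open>Sums and products in \<open>bit\<close> are kept in ring form; turning them into XOR and
  AND would obstruct telescoping and distributivity.\<close>

declare add_bit_eq_xor [simp del] mult_bit_eq_and [simp del]

lemma bit_add_self [simp]: "(x::bit) + x = 0" "(x::bit) + (x + y) = y"
  by (cases x; cases y; simp)+

lemma bit_add_eq_0_iff: "(x::bit) + y = 0 \<longleftrightarrow> x = y"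
  by (cases x; cases y; simp)

text \<open>If \<open>x\<close> lay outside the span of \<open>S\<close>, a basis of that span could
  be extended by \<open>x\<close> and would carry a functional with value 1 at \<open>x\<close> and
  0 on \<open>S\<close>. Over two elements additivity is all of linearity, and for the same reason
  \<open>V\<close> is a subspace. The dimension may be infinite, so choice enters through the
  basis.\<close>

lemma bit_functional_separation:
  fixes S V :: "('a \<Rightarrow> bit) set"
  assumes functionals: "\<And>f :: ('a \<Rightarrow> bit) \<Rightarrow> bit. (\<And>u v. f (\<lambda>a. u a + v a) = f u + f v) \<Longrightarrow>
      (\<And>s. s \<in> S \<Longrightarrow> f s = 0) \<Longrightarrow> f x = 0"
    and V: "S \<subseteq> V" "(\<lambda>_. 0) \<in> V" "\<And>u v. u \<in> V \<Longrightarrow> v \<in> V \<Longrightarrow> (\<lambda>a. u a + v a) \<in> V"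
  shows "x \<in> V"
proof (rule ccontr)
  assume "x \<notin> V"
  interpret vs: vector_space_pair "\<lambda>(c::bit) (u :: 'a \<Rightarrow> bit). (\<lambda>a. c * u a)" "(*) :: bit \<Rightarrow> bit \<Rightarrow> bit"
    by unfold_locales (simp_all add: fun_eq_iff algebra_simps)
  have "vs.vs1.subspace V"
  proof (rule vs.vs1.subspaceI)
    show "0 \<in> V" using V(2) by (simp add: zero_fun_def)
    show "u + v \<in> V" if "u \<in> V" "v \<in> V" for u v using V(3)[OF that] by (simp add: plus_fun_def)
    show "(\<lambda>a. c * u a) \<in> V" if "u \<in> V" for c u using that V(2) by (cases c) simp_all
  qed
  then have "vs.vs1.span S \<subseteq> V" by (rule vs.vs1.span_minimal[OF V(1)])
  then have "x \<notin> vs.vs1.span S" using \<open>x \<notin> V\<close> by blast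
  obtain B where B: "B \<subseteq> S" "vs.vs1.independent B" "S \<subseteq> vs.vs1.span B"
    by (rule vs.vs1.maximal_independent_subset)
  have "x \<notin> vs.vs1.span B"
    using \<open>x \<notin> vs.vs1.span S\<close> vs.vs1.span_mono[OF B(1)] by blast
  then have ind: "vs.vs1.independent (insert x B)" using B(2) by (rule vs.vs1.independent_insertI)
  obtain f where f: "Vector_Spaces.linear (\<lambda>(c::bit) (u :: 'a \<Rightarrow> bit). (\<lambda>a. c * u a)) (*) f"
    "\<forall>u\<in>insert x B. f u = (if u = x then 1 else 0)"
    using vs.linear_independent_extend[OF ind, of "\<lambda>u. if u = x then 1 else 0"] by blast
  interpret f: Vector_Spaces.linear "\<lambda>(c::bit) (u :: 'a \<Rightarrow> bit). (\<lambda>a. c * u a)" "(*)" f by (rule f(1))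
  have "x \<notin> B" using \<open>x \<notin> vs.vs1.span B\<close> vs.vs1.span_base by blast
  then have "f u = 0" if "u \<in> B" for u using f(2) that by auto
  then have "f u = 0" if "u \<in> vs.vs1.span B" for u using that by (rule f.eq_0_on_span)
  then have fS: "f s = 0" if "s \<in> S" for s using that B(3) by blast
  have "f (\<lambda>a. u a + v a) = f u + f v" for u v
    using f.add[of u v] by (simp add: plus_fun_def)
  then have "f x = 0" using fS by (rule functionals)
  then show False using f(2) by simp
qed

lemma reduce_snoc:
  assumes "reduced h"
  shows "reduce (h @ [a]) = (if h \<noteq> [] \<and> last h = inv_letter a then butlast h else h @ [a])"
proof (cases "h \<noteq> [] \<and> last h = inv_letter a")
  case True
  then have h: "h = butlast h @ [inv_letter a]" by (metis append_butlast_last_id)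
  then have "reduced (butlast h)" using assms by (metis reduced_append)
  moreover have "reduce (h @ [a]) = reduce (butlast h @ [])"
    using reduce_cancel_middle[OF reduce_inv_left[of "[a]"], of "butlast h" "[]"] h
    by (metis append.assoc append_Nil2 inv_word_simps(1,2) append_Nil)
  ultimately show ?thesis using True by (simp add: reduce_reduced)
next
  case False
  have "inv_letter (last h) \<noteq> a \<or> h = []" using False by auto
  then have "reduced (h @ [a])" using assms by (auto simp: reduced_append reduced_Cons)
  then show ?thesis using False by (auto simp: reduce_reduced)
qed

text \<open>The end point farther from the origin of the edge joining \<open>h\<close> and \<open>h * x_j\<close>.\<close>

definition edge_top :: "letter list \<times> nat \<Rightarrow> letter list" where
  "edge_top e = (if fst e \<noteq> [] \<and> last (fst e) = (snd e, False) then fst e else fst e @ [(snd e, True)])"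

text \<open>The vertices with prefix \<open>edge_top e\<close> form the half-tree beyond
  \<open>e\<close>, and its indicator changes across \<open>e\<close> only. Crossing counts of an
  edge thereby become jumps of a function on vertices.\<close>

lemma prefix_flip_iff:
  assumes "reduced h"
  shows "prefix (edge_top e) h \<noteq> prefix (edge_top e) (reduce (h @ [(j, True)])) \<longleftrightarrow> e = (h, j)"
proof -
  obtain f k where e: "e = (f, k)" by (cases e)
  show ?thesis
  proof (cases "h \<noteq> [] \<and> last h = (j, False)")
    case True
    then have h: "h = butlast h @ [(j, False)]" by (metis append_butlast_last_id)
    have red: "reduce (h @ [(j, True)]) = butlast h"
      using True by (simp add: reduce_snoc[OF assms] inv_letter_def)
    have "prefix v h \<longleftrightarrow> v = h \<or> prefix v (butlast h)" for v
      by (subst h, subst prefix_snoc) (use h in auto)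
    moreover have "\<not> prefix h (butlast h)"
      using True by (metis append_butlast_last_id prefix_length_le length_append_singleton not_less_eq_eq order_refl)
    ultimately have "prefix (edge_top e) h \<noteq> prefix (edge_top e) (reduce (h @ [(j, True)])) \<longleftrightarrow> edge_top e = h"
      unfolding red by blast
    also have "\<dots> \<longleftrightarrow> e = (h, j)"
      using True by (auto simp: edge_top_def e)
    finally show ?thesis .
  next
    case False
    have red: "reduce (h @ [(j, True)]) = h @ [(j, True)]"
      using False by (auto simp: reduce_snoc[OF assms] inv_letter_def)
    have "\<not> prefix (h @ [(j, True)]) h" using prefix_length_le by fastforce
    then have "prefix (edge_top e) h \<noteq> prefix (edge_top e) (reduce (h @ [(j, True)])) \<longleftrightarrow> edge_top e = h @ [(j, True)]"
      unfolding red prefix_snoc by (cases "edge_top e = h @ [(j, True)]") simp_all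
    also have "\<dots> \<longleftrightarrow> e = (h, j)"
      using False by (auto simp: edge_top_def e)
    finally show ?thesis .
  qed
qed

lemma sum_telescope_bit: "(\<Sum>p<m. (f p :: bit) + f (Suc p)) = f 0 + f m"
  by (induction m) (simp_all add: algebra_simps)

lemma sum_telescope_int_bit:
  "(\<Sum>k\<in>{- int K..<int K}. (f k :: bit) + f (k + 1)) = f (- int K) + f (int K)"
proof (induction K)
  case (Suc K)
  have "{- int (Suc K)..<int (Suc K)} = insert (- int (Suc K)) (insert (int K) {- int K..<int K})"
    by auto
  then show ?case using Suc by (simp add: algebra_simps)
qed simp

context malnormal_words
begin

text \<open>The unreduced words \<open>ws ! i\<close> label paths joining consecutive vertices of a line; crossings of an
  edge are counted mod 2, so back-tracking does no harm. \<open>crossed_edge i g p\<close> is the edge passed by the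
  letter at position \<open>p\<close> of the path from \<open>g\<close>; the pair \<open>(h, j)\<close> stands for the edge from \<open>h\<close> to
  \<open>h * x_j\<close>.\<close>

definition tail_pos :: "nat \<Rightarrow> nat \<Rightarrow> nat" where
  "tail_pos i p = (if snd (ws ! i ! p) then p else Suc p)"

definition crossed_edge :: "nat \<Rightarrow> letter list \<Rightarrow> nat \<Rightarrow> letter list \<times> nat" where
  "crossed_edge i g p = (reduce (g @ take (tail_pos i p) (ws ! i)), fst (ws ! i ! p))"

definition edges :: "(letter list \<times> nat) set" where
  "edges = carrier F \<times> {..<n}"

definition jump :: "(letter list \<Rightarrow> bit) \<Rightarrow> letter list \<times> nat \<Rightarrow> bit" where
  "jump G e = G (fst e) + G (reduce (fst e @ [(snd e, True)]))"

definition steps :: "(nat \<times> nat) set" where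
  "steps = (SIGMA i:{..<length ws}. {..<length (ws ! i)})"

text \<open>\<open>\<phi> i g\<close> is the value of the line through \<open>g\<close> with label
  \<open>ws ! i\<close>; the invariance clause makes it depend on the line only. In the parity
  clause \<open>h\<close> is the tail of an edge, and the arguments of \<open>\<phi>\<close> are the
  starting vertices whose paths run across that edge. Infinitely many lines may have value 1, as
  befits a functional on finite sums of lines.\<close>

definition even_flow :: "(nat \<Rightarrow> letter list \<Rightarrow> bit) \<Rightarrow> bool" where
  "even_flow \<phi> \<longleftrightarrow>
     (\<forall>i<length ws. \<forall>g\<in>carrier F. \<phi> i (reduce (g @ ws ! i)) = \<phi> i g) \<and>
     (\<forall>h\<in>carrier F. \<forall>j<n. (\<Sum>q\<in>{q \<in> steps. fst (ws ! fst q ! snd q) = j}.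
        \<phi> (fst q) (reduce (h @ inv_word (take (tail_pos (fst q) (snd q)) (ws ! fst q))))) = 0)"

lemma finite_steps: "finite steps"
  by (simp add: steps_def)

lemma letters_nth: "i < length ws \<Longrightarrow> set (ws ! i) \<subseteq> letters n"
  by (rule letters) simp

lemma mult_in_carrier: "g \<in> carrier F \<Longrightarrow> set s \<subseteq> letters n \<Longrightarrow> reduce (g @ s) \<in> carrier F"
  by (rule reduce_in_carrier) (simp add: carrier_free_group)

lemma take_letters: "i < length ws \<Longrightarrow> set (take k (ws ! i)) \<subseteq> letters n"
  using letters_nth[of i] by (meson order_trans set_take_subset)

lemma crossed_edge_in_edges:
  assumes "(i, p) \<in> steps" "g \<in> carrier F"
  shows "crossed_edge i g p \<in> edges"
proof -
  have i: "i < length ws" "p < length (ws ! i)" using assms(1) by (simp_all add: steps_def)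
  then have "ws ! i ! p \<in> letters n" using letters_nth[of i] nth_mem by blast
  then have "fst (ws ! i ! p) < n" by (auto simp: letters_def)
  then show ?thesis
    using mult_in_carrier[OF assms(2) take_letters[OF i(1)]] by (simp add: edges_def crossed_edge_def)
qed

text \<open>Passing an edge backwards exchanges the two summands of \<open>jump\<close>, which is
  invisible in a sum, so the sign of the letter drops out.\<close>

lemma jump_crossed_edge:
  assumes "(i, p) \<in> steps"
  shows "jump G (crossed_edge i g p) = G (reduce (g @ take p (ws ! i))) + G (reduce (g @ take (Suc p) (ws ! i)))"
proof -
  have p: "p < length (ws ! i)" using assms by (simp add: steps_def)
  then have t: "take (Suc p) (ws ! i) = take p (ws ! i) @ [ws ! i ! p]" by (simp add: take_Suc_conv_app_nth)
  obtain j b where a: "ws ! i ! p = (j, b)" by (cases "ws ! i ! p")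
  show ?thesis
  proof (cases b)
    case True
    then show ?thesis using t a
      by (simp add: jump_def crossed_edge_def tail_pos_def reduce_append_left)
  next
    case False
    have "reduce (reduce (g @ take (Suc p) (ws ! i)) @ [(j, True)]) = reduce ((g @ take p (ws ! i)) @ ([(j, False)] @ [(j, True)]) @ [])"
      using t a False by (simp add: reduce_append_left)
    also have "\<dots> = reduce ((g @ take p (ws ! i)) @ [])"
      using reduce_inv_left[of "[(j, True)]"] by (intro reduce_cancel_middle) (simp add: inv_letter_def)
    finally show ?thesis using a False
      by (simp add: jump_def crossed_edge_def tail_pos_def add.commute)
  qed
qed

lemma sum_jumps:
  assumes "i < length ws" "g \<in> carrier F"
  shows "(\<Sum>p<length (ws ! i). jump G (crossed_edge i g p)) = G g + G (reduce (g @ ws ! i))"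
proof -
  have "(\<Sum>p<length (ws ! i). jump G (crossed_edge i g p)) =
      (\<Sum>p<length (ws ! i). G (reduce (g @ take p (ws ! i))) + G (reduce (g @ take (Suc p) (ws ! i))))"
    using assms by (intro sum.cong refl jump_crossed_edge) (simp add: steps_def)
  also have "\<dots> = G (reduce (g @ take 0 (ws ! i))) + G (reduce (g @ take (length (ws ! i)) (ws ! i)))"
    by (rule sum_telescope_bit)
  also have "reduce (g @ take 0 (ws ! i)) = g"
    using assms by (simp add: carrier_free_group reduce_reduced)
  finally show ?thesis by simp
qed

definition line_vertex :: "nat \<Rightarrow> letter list \<Rightarrow> int \<Rightarrow> letter list" where
  "line_vertex i g k = g \<otimes>\<^bsub>F\<^esub> root i [^]\<^bsub>F\<^esub> k"

lemma line_vertex_closed: "i < length ws \<Longrightarrow> g \<in> carrier F \<Longrightarrow> line_vertex i g k \<in> carrier F"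
  by (simp add: line_vertex_def root_closed)

lemma line_vertex_Suc:
  "i < length ws \<Longrightarrow> g \<in> carrier F \<Longrightarrow> line_vertex i g (k + 1) = reduce (line_vertex i g k @ ws ! i)"
proof -
  assume "i < length ws" "g \<in> carrier F"
  then have "line_vertex i g (k + 1) = line_vertex i g k \<otimes>\<^bsub>F\<^esub> root i"
    by (simp add: line_vertex_def G.int_pow_mult G.m_assoc root_closed)
  then show ?thesis by (simp add: mult_free_group root_def reduce_append_right)
qed

lemma inj_line_vertex: "i < length ws \<Longrightarrow> g \<in> carrier F \<Longrightarrow> inj (line_vertex i g)"
  unfolding line_vertex_def by (rule injI) (rule inj_int_pow_free_group[OF _ root_closed root_nonempty])

lemma line_vertex_0: "i < length ws \<Longrightarrow> g \<in> carrier F \<Longrightarrow> line_vertex i g 0 = g"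
  by (simp add: line_vertex_def)

lemma line_eq_iff_vertex:
  assumes "i < length ws" "g \<in> carrier F" "j < length ws" "h \<in> carrier F"
  shows "line j h = line i g \<longleftrightarrow> i = j \<and> h \<in> range (line_vertex i g)"
  using line_eq_iff[OF assms] by (auto simp: line_vertex_def)

lemma sum_jumps_line:
  assumes "i < length ws" "g \<in> carrier F"
  shows "(\<Sum>k\<in>{- int K..<int K}. \<Sum>p<length (ws ! i). jump G (crossed_edge i (line_vertex i g k) p)) =
    G (line_vertex i g (- int K)) + G (line_vertex i g (int K))"
proof -
  have "(\<Sum>k\<in>{- int K..<int K}. \<Sum>p<length (ws ! i). jump G (crossed_edge i (line_vertex i g k) p)) =
     (\<Sum>k\<in>{- int K..<int K}. G (line_vertex i g k) + G (line_vertex i g (k + 1)))"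
    using assms by (intro sum.cong refl) (simp add: sum_jumps line_vertex_closed line_vertex_Suc)
  then show ?thesis by (simp only: sum_telescope_int_bit[of "\<lambda>k. G (line_vertex i g k)"])
qed

text \<open>Locally constant functions on the boundary are handled as functions on vertices that depend,
  far out, on an initial segment of bounded length only.\<close>

definition determined_at :: "nat \<Rightarrow> (letter list \<Rightarrow> bit) \<Rightarrow> bool" where
  "determined_at N G \<longleftrightarrow> (\<forall>z\<in>carrier F. \<forall>z'\<in>carrier F. N \<le> length z \<longrightarrow> N \<le> length z' \<longrightarrow>
     take N z = take N z' \<longrightarrow> G z = G z')"

lemma determined_atD:
  "determined_at N G \<Longrightarrow> z \<in> carrier F \<Longrightarrow> z' \<in> carrier F \<Longrightarrow> N \<le> length z \<Longrightarrow> N \<le> length z' \<Longrightarrow>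
    take N z = take N z' \<Longrightarrow> G z = G z'"
  unfolding determined_at_def by blast

lemma determined_at_mono:
  assumes "determined_at N G" "N \<le> M" shows "determined_at M G"
  unfolding determined_at_def
proof (intro ballI impI)
  fix z z' assume *: "z \<in> carrier F" "z' \<in> carrier F" "M \<le> length z" "M \<le> length z'" "take M z = take M z'"
  have "take N z = take N (take M z)" using assms(2) by (simp add: min_absorb1)
  also have "\<dots> = take N (take M z')" using *(5) by (rule arg_cong)
  also have "\<dots> = take N z'" using assms(2) by (simp add: min_absorb1)
  finally show "G z = G z'" using *(3,4) assms(2) by (intro determined_atD[OF assms(1) *(1,2)]) simp_all
qed

lemma eventually_determined_nat:
  assumes G: "determined_at N G" and \<omega>: "\<omega> \<in> rays n" and x: "range x \<subseteq> carrier F" "tends_to_ray x \<omega>"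
  shows "\<exists>M. \<forall>k\<ge>M. G (x k) = G (ray_prefix \<omega> N)"
proof -
  obtain M where M: "\<forall>i\<ge>M. N \<le> length (x i) \<and> take N (x i) = ray_prefix \<omega> N"
    using x(2) unfolding tends_to_ray_def by blast
  have "G (x k) = G (ray_prefix \<omega> N)" if "k \<ge> M" for k
    using M[rule_format, OF that] x(1) \<omega>
    by (intro determined_atD[OF G]) (auto simp: rays_def take_ray_prefix)
  then show ?thesis by blast
qed

lemma eventually_line_vertex:
  assumes G: "determined_at N G" and i: "i < length ws" and g: "g \<in> carrier F"
  shows "\<exists>M. \<forall>K\<ge>M. G (line_vertex i g (- int K)) = G (ray_prefix (signed_end i False g) N) \<and>
      G (line_vertex i g (int K)) = G (ray_prefix (signed_end i True g) N)"
proof -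
  have *: "\<exists>M. \<forall>k\<ge>M. G (axis_path g (signed_root i s) k) = G (ray_prefix (signed_end i s g) N)" for s
    by (rule eventually_determined_nat[OF G signed_end_in_rays[OF i g] axis_path_closed[OF g signed_root_closed[OF i]]
          tends_to_signed_end[OF i g]])
  obtain M M' where "\<forall>k\<ge>M. G (axis_path g (signed_root i True) k) = G (ray_prefix (signed_end i True g) N)"
    "\<forall>k\<ge>M'. G (axis_path g (signed_root i False) k) = G (ray_prefix (signed_end i False g) N)"
    using *[of True] *[of False] by (elim exE)
  moreover have "axis_path g (signed_root i True) k = line_vertex i g (int k)"
    "axis_path g (signed_root i False) k = line_vertex i g (- int k)" for k
    by (simp_all add: axis_path_def signed_root_pow[OF i] line_vertex_def)
  ultimately show ?thesis by (intro exI[of _ "max M M'"]) simp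
qed

text \<open>The ends of an edge far from the origin share their first \<open>N\<close> letters; the
  margin of 1 allows the step to shorten the word.\<close>

lemma finite_jumps:
  assumes "determined_at N G"
  shows "finite {e \<in> edges. jump G e \<noteq> 0}"
proof (rule finite_subset)
  show "{e \<in> edges. jump G e \<noteq> 0} \<subseteq> {w \<in> carrier F. length w \<le> N + 1} \<times> {..<n}"
  proof
    fix e assume e: "e \<in> {e \<in> edges. jump G e \<noteq> 0}"
    obtain h j where hj: "e = (h, j)" by (cases e)
    have h: "h \<in> carrier F" "j < n" using e by (auto simp: edges_def hj)
    let ?h = "reduce (h @ [(j, True)])"
    have h': "?h \<in> carrier F" using h by (intro mult_in_carrier) (auto simp: letters_def)
    have "length h \<le> N + 1"
    proof (rule ccontr)
      assume "\<not> ?thesis"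
      then have len: "N + 1 \<le> length h" by simp
      have "length (reduce (inv_word h @ ?h)) \<le> 1" using length_reduce[of "[(j, True)]"] by simp
      then have "N \<le> length ?h \<and> take N h = take N ?h"
        using take_eq_of_close[of h ?h 1 N] h h' len by (simp add: carrier_free_group)
      then have "G h = G ?h" using determined_atD[OF assms h(1) h'] len by simp
      then show False using e by (simp add: jump_def hj)
    qed
    then show "e \<in> {w \<in> carrier F. length w \<le> N + 1} \<times> {..<n}" using h hj by simp
  qed
  show "finite ({w \<in> carrier F. length w \<le> N + 1} \<times> {..<n})" by (intro finite_cartesian_product finite_ball) simp
qed

lemma even_flow_line_vertex:
  assumes \<phi>: "even_flow \<phi>" and i: "i < length ws" and g: "g \<in> carrier F"
  shows "\<phi> i (line_vertex i g k) = \<phi> i g"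
proof (induction k rule: int_induct[where k = 0])
  case base
  then show ?case by (simp add: line_vertex_0 i g)
next
  case (step1 k)
  have "\<phi> i (line_vertex i g (k + 1)) = \<phi> i (line_vertex i g k)"
    using \<phi> line_vertex_closed[OF i g] i unfolding line_vertex_Suc[OF i g] even_flow_def by blast
  then show ?case using step1 by simp
next
  case (step2 k)
  have "\<phi> i (line_vertex i g (k - 1 + 1)) = \<phi> i (line_vertex i g (k - 1))"
    using \<phi> line_vertex_closed[OF i g] i unfolding line_vertex_Suc[OF i g] even_flow_def by blast
  then show ?case using step2 by simp
qed

section \<open>A splitting set forces even flows to vanish on its line\<close>

text \<open>The total jump of \<open>G\<close> along a line is its change from one end to the other.
  \<open>Y\<close> contains the starting vertices of all periods with nonzero jump, so this infinite
  total becomes a sum over a finite set.\<close>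

lemma sum_jumps_over_line:
  assumes G: "determined_at N G" and i: "i < length ws" and g: "g \<in> carrier F"
    and Y: "finite Y" "Y \<subseteq> carrier F"
    and zero: "\<And>g. g \<in> carrier F - Y \<Longrightarrow> (\<Sum>p<length (ws ! i). jump G (crossed_edge i g p)) = 0"
  shows "(\<Sum>f\<in>{f \<in> Y. line i f = line i g}. \<Sum>p<length (ws ! i). jump G (crossed_edge i f p)) =
    G (ray_prefix (signed_end i True g) N) + G (ray_prefix (signed_end i False g) N)"
proof -
  let ?x = "line_vertex i g" and ?\<Delta> = "\<lambda>f. \<Sum>p<length (ws ! i). jump G (crossed_edge i f p)"
  obtain M where M: "\<forall>K\<ge>M. G (?x (- int K)) = G (ray_prefix (signed_end i False g) N) \<and>
      G (?x (int K)) = G (ray_prefix (signed_end i True g) N)"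
    using eventually_line_vertex[OF G i g] by (rule exE)
  have "finite (?x -` Y)" by (rule finite_vimageI[OF Y(1) inj_line_vertex[OF i g]])
  then have fin: "finite (insert 0 ((\<lambda>k. nat \<bar>k\<bar>) ` (?x -` Y)))" by simp
  \<comment> \<open>The window contains every period that starts in \<open>Y\<close> and is wide
    enough for \<open>G\<close> to have its limit values at both ends.\<close>
  define K where "K = max M (Suc (Max (insert 0 ((\<lambda>k. nat \<bar>k\<bar>) ` (?x -` Y)))))"
  have K: "k \<in> {- int K..<int K}" if "?x k \<in> Y" for k
  proof -
    have "nat \<bar>k\<bar> \<le> Max (insert 0 ((\<lambda>k. nat \<bar>k\<bar>) ` (?x -` Y)))"
      using that by (intro Max_ge[OF fin]) auto
    then have "nat \<bar>k\<bar> < K" by (simp add: K_def)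
    then show ?thesis by auto
  qed
  have cls: "{f \<in> Y. line i f = line i g} = Y \<inter> range ?x"
    using line_eq_iff_vertex[OF i g i] Y(2) by blast
  have "(\<Sum>f\<in>Y \<inter> range ?x. ?\<Delta> f) = (\<Sum>f\<in>?x ` {- int K..<int K}. ?\<Delta> f)"
  proof (rule sum.mono_neutral_left)
    show "Y \<inter> range ?x \<subseteq> ?x ` {- int K..<int K}" using K by blast
    show "\<forall>f\<in>?x ` {- int K..<int K} - Y \<inter> range ?x. ?\<Delta> f = 0"
      using line_vertex_closed[OF i g] by (intro ballI zero) blast
  qed simp
  also have "\<dots> = (\<Sum>k\<in>{- int K..<int K}. ?\<Delta> (?x k))"
    using inj_line_vertex[OF i g] by (subst sum.reindex) (auto intro: inj_on_subset)
  also have "\<dots> = G (?x (- int K)) + G (?x (int K))" by (rule sum_jumps_line[OF i g])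
  also have "\<dots> = G (ray_prefix (signed_end i True g) N) + G (ray_prefix (signed_end i False g) N)"
    using M by (simp add: K_def add.commute)
  finally show ?thesis unfolding cls .
qed

text \<open>Double counting of the crossings, by lines of value 1, at which the indicator of
  \<open>A\<close> jumps. Summed by edges the count is even because \<open>\<phi>\<close> is an even
  flow; summed by lines only the one split line contributes.\<close>

theorem even_flow_eq_0_of_splitting:
  assumes A: "clopenin (free_boundary n) A"
    and split: "\<And>j h. j < length ws \<Longrightarrow> h \<in> carrier F \<Longrightarrow> splits A (line j h) \<longleftrightarrow> line j h = line i0 g0"
    and i0: "i0 < length ws" and g0: "g0 \<in> carrier F" and \<phi>: "even_flow \<phi>"
  shows "\<phi> i0 g0 = 0"
proof -
  obtain N where N: "\<forall>\<omega>\<in>rays n. \<forall>\<omega>'\<in>rays n. ray_prefix \<omega> N = ray_prefix \<omega>' N \<longrightarrow>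
     (ray_end n \<omega> \<in> A \<longleftrightarrow> ray_end n \<omega>' \<in> A)"
    using clopenin_free_boundaryD[OF A] by (rule exE)
  \<comment> \<open>A vertex inherits membership in \<open>A\<close> from the rays with the same
    first \<open>N\<close> letters, so only finitely many edges see a change.\<close>
  define G :: "letter list \<Rightarrow> bit" where
    "G z = of_bool (\<exists>\<omega>\<in>rays n. ray_end n \<omega> \<in> A \<and> ray_prefix \<omega> N = take N z)" for z
  have G: "determined_at N G" by (simp add: determined_at_def G_def)
  have G_ray: "G (ray_prefix \<omega> N) = of_bool (ray_end n \<omega> \<in> A)" if "\<omega> \<in> rays n" for \<omega>
  proof -
    have "(\<exists>\<omega>'\<in>rays n. ray_end n \<omega>' \<in> A \<and> ray_prefix \<omega>' N = ray_prefix \<omega> N) \<longleftrightarrow> ray_end n \<omega> \<in> A"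
      using N that by blast
    then show ?thesis by (simp add: G_def take_ray_prefix)
  qed
  have G_line: "G (ray_prefix (signed_end i True g) N) + G (ray_prefix (signed_end i False g) N) =
      of_bool (line i g = line i0 g0)" if "i < length ws" "g \<in> carrier F" for i g
    using split[OF that] G_ray[OF signed_end_in_rays[OF that, of True]] G_ray[OF signed_end_in_rays[OF that, of False]]
    by (auto simp: splits_def line_def)
  define \<Delta> where "\<Delta> i g = (\<Sum>p<length (ws ! i). jump G (crossed_edge i g p))" for i g
  define Ed where "Ed = {e \<in> edges. jump G e \<noteq> 0}"
  have Ed: "finite Ed" unfolding Ed_def by (rule finite_jumps[OF G])
  \<comment> \<open>For a position \<open>q\<close> in a word, \<open>start q h\<close> is the
    starting vertex whose path crosses at that position an edge with tail \<open>h\<close>; this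
    inverts \<open>crossed_edge\<close>.\<close>
  define start where "start q h = reduce (h @ inv_word (take (tail_pos (fst q) (snd q)) (ws ! fst q)))" for q h
  define S where "S q = {g \<in> carrier F. crossed_edge (fst q) g (snd q) \<in> Ed}" for q
  have start: "start q (fst (crossed_edge (fst q) g (snd q))) = g" if "g \<in> carrier F" for q g
    using that by (simp add: start_def crossed_edge_def carrier_free_group reduce_reduced)
  have start_closed: "start q h \<in> carrier F" if "q \<in> steps" "h \<in> carrier F" for q h
  proof -
    have "set (take (tail_pos (fst q) (snd q)) (ws ! fst q)) \<subseteq> letters n"
      using that(1) by (intro take_letters) (auto simp: steps_def)
    then show ?thesis unfolding start_def by (intro mult_in_carrier that(2)) (simp add: set_inv_word)
  qed
  have crossed_start: "crossed_edge (fst q) (start q (fst e)) (snd q) = e"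
    if "e \<in> Ed" "snd e = fst (ws ! fst q ! snd q)" for q e
  proof -
    have "reduced (fst e)" using that(1) by (auto simp: Ed_def edges_def carrier_free_group)
    then show ?thesis using that(2) by (simp add: start_def crossed_edge_def reduce_reduced prod_eq_iff)
  qed
  define Y where "Y = (\<Union>q\<in>steps. S q)"
  have "finite (S q)" for q
  proof (rule finite_subset)
    show "S q \<subseteq> (\<lambda>e. start q (fst e)) ` Ed"
    proof
      fix g assume "g \<in> S q"
      then have "g \<in> carrier F" "crossed_edge (fst q) g (snd q) \<in> Ed" by (simp_all add: S_def)
      then show "g \<in> (\<lambda>e. start q (fst e)) ` Ed" using start by (intro image_eqI) simp_all
    qed
    show "finite ((\<lambda>e. start q (fst e)) ` Ed)" using Ed by (rule finite_imageI)
  qed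
  then have Y: "finite Y" "Y \<subseteq> carrier F" using finite_steps by (auto simp: Y_def S_def)
  have jump0: "jump G (crossed_edge (fst q) g (snd q)) = 0" if "q \<in> steps" "g \<in> carrier F" "g \<notin> S q" for q g
    using that crossed_edge_in_edges[of "fst q" "snd q" g] by (auto simp: S_def Ed_def)
  have \<Delta>0: "\<Delta> i g = 0" if "i < length ws" "g \<in> carrier F - Y" for i g
    unfolding \<Delta>_def
  proof (rule sum.neutral, rule ballI)
    fix p assume "p \<in> {..<length (ws ! i)}"
    then have "(i, p) \<in> steps" using that(1) by (simp add: steps_def)
    then show "jump G (crossed_edge i g p) = 0" using jump0[of "(i, p)" g] that(2) by (auto simp: Y_def)
  qed
  \<comment> \<open>Count by edges: each inner sum is the parity condition of one edge.\<close>
  have "0 = (\<Sum>e\<in>Ed. \<Sum>q\<in>{q \<in> steps. fst (ws ! fst q ! snd q) = snd e}. \<phi> (fst q) (start q (fst e)))"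
  proof (rule sum.neutral[symmetric], rule ballI)
    fix e assume "e \<in> Ed"
    then have "fst e \<in> carrier F" "snd e < n" by (auto simp: Ed_def edges_def)
    then show "(\<Sum>q\<in>{q \<in> steps. fst (ws ! fst q ! snd q) = snd e}. \<phi> (fst q) (start q (fst e))) = 0"
      using \<phi> unfolding even_flow_def start_def by blast
  qed
  also have "\<dots> = (\<Sum>q\<in>steps. \<Sum>e\<in>{e \<in> Ed. fst (ws ! fst q ! snd q) = snd e}. \<phi> (fst q) (start q (fst e)))"
    by (rule sum.swap_restrict[OF Ed finite_steps])
  also have "\<dots> = (\<Sum>q\<in>steps. \<Sum>g\<in>S q. \<phi> (fst q) g)"
  proof (rule sum.cong[OF refl])
    fix q assume q: "q \<in> steps"
    show "(\<Sum>e\<in>{e \<in> Ed. fst (ws ! fst q ! snd q) = snd e}. \<phi> (fst q) (start q (fst e))) = (\<Sum>g\<in>S q. \<phi> (fst q) g)"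
    proof (rule sum.reindex_bij_witness[where i = "\<lambda>g. crossed_edge (fst q) g (snd q)" and j = "\<lambda>e. start q (fst e)"])
      fix e assume e: "e \<in> {e \<in> Ed. fst (ws ! fst q ! snd q) = snd e}"
      then show c: "crossed_edge (fst q) (start q (fst e)) (snd q) = e" using crossed_start by simp
      have "fst e \<in> carrier F" using e by (auto simp: Ed_def edges_def)
      then show "start q (fst e) \<in> S q" using start_closed[OF q] c e by (simp add: S_def)
    next
      fix g assume "g \<in> S q"
      then show "start q (fst (crossed_edge (fst q) g (snd q))) = g"
        "crossed_edge (fst q) g (snd q) \<in> {e \<in> Ed. fst (ws ! fst q ! snd q) = snd e}"
        using start by (simp_all add: S_def) (simp add: crossed_edge_def)
    qed simp
  qed
  \<comment> \<open>On \<open>Y\<close> the weight \<open>jump\<close> is 1 exactly for members of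
    \<open>S q\<close>, so all positions can be summed over the same finite set.\<close>
  also have "\<dots> = (\<Sum>q\<in>steps. \<Sum>g\<in>Y. \<phi> (fst q) g * jump G (crossed_edge (fst q) g (snd q)))"
  proof (rule sum.cong[OF refl])
    fix q assume q: "q \<in> steps"
    show "(\<Sum>g\<in>S q. \<phi> (fst q) g) = (\<Sum>g\<in>Y. \<phi> (fst q) g * jump G (crossed_edge (fst q) g (snd q)))"
    proof (rule sum.mono_neutral_cong_left[OF Y(1)])
      show "S q \<subseteq> Y" using q by (auto simp: Y_def)
      show "\<forall>g\<in>Y - S q. \<phi> (fst q) g * jump G (crossed_edge (fst q) g (snd q)) = 0"
        using jump0[OF q] Y(2) by auto
      show "\<phi> (fst q) g = \<phi> (fst q) g * jump G (crossed_edge (fst q) g (snd q))" if "g \<in> S q" for g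
        using that by (simp add: S_def Ed_def)
    qed
  qed
  also have "\<dots> = (\<Sum>i<length ws. \<Sum>p<length (ws ! i). \<Sum>g\<in>Y. \<phi> i g * jump G (crossed_edge i g p))"
    unfolding steps_def by (subst sum.Sigma) (simp_all add: case_prod_unfold)
  also have "\<dots> = (\<Sum>i<length ws. \<Sum>g\<in>Y. \<phi> i g * \<Delta> i g)"
    unfolding \<Delta>_def sum_distrib_left by (intro sum.cong refl sum.swap)
  also have "\<dots> = (\<Sum>i<length ws. of_bool (i = i0) * \<phi> i0 g0)"
  proof (rule sum.cong[OF refl])
    fix i assume "i \<in> {..<length ws}"
    then have i: "i < length ws" by simp
    have inner: "(\<Sum>g\<in>{g \<in> Y. line i g = line i g1}. \<phi> i g * \<Delta> i g) = (if line i g1 = line i0 g0 then \<phi> i0 g0 else 0)"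
      if g1: "g1 \<in> carrier F" for g1
    proof -
      have "\<phi> i g = \<phi> i g1" if "g \<in> {g \<in> Y. line i g = line i g1}" for g
        using that line_eq_iff_vertex[OF i g1 i, of g] Y(2) even_flow_line_vertex[OF \<phi> i g1] by blast
      then have "(\<Sum>g\<in>{g \<in> Y. line i g = line i g1}. \<phi> i g * \<Delta> i g)
          = \<phi> i g1 * (\<Sum>g\<in>{g \<in> Y. line i g = line i g1}. \<Delta> i g)"
        by (simp add: sum_distrib_left)
      also have "(\<Sum>g\<in>{g \<in> Y. line i g = line i g1}. \<Delta> i g) = of_bool (line i g1 = line i0 g0)"
        using sum_jumps_over_line[OF G i g1 Y] \<Delta>0[OF i] G_line[OF i g1] unfolding \<Delta>_def by simp
      finally have eq: "(\<Sum>g\<in>{g \<in> Y. line i g = line i g1}. \<phi> i g * \<Delta> i g)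
          = \<phi> i g1 * of_bool (line i g1 = line i0 g0)" .
      show ?thesis
      proof (cases "line i g1 = line i0 g0")
        case True
        then have "i0 = i \<and> g1 \<in> range (line_vertex i0 g0)" by (rule iffD1[OF line_eq_iff_vertex[OF i0 g0 i g1]])
        then have "\<phi> i g1 = \<phi> i0 g0" using even_flow_line_vertex[OF \<phi> i0 g0] by blast
        then show ?thesis using eq True by simp
      qed (use eq in simp)
    qed
    \<comment> \<open>Starting vertices are grouped by line: \<open>\<phi>\<close> is constant on a
      group, and the jumps in it add up to 1 exactly for the split line.\<close>
    have "(\<Sum>g\<in>Y. \<phi> i g * \<Delta> i g) = (\<Sum>y\<in>line i ` Y. \<Sum>g\<in>{g \<in> Y. line i g = y}. \<phi> i g * \<Delta> i g)"
      by (rule sum.image_gen[OF Y(1)])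
    also have "\<dots> = (\<Sum>y\<in>line i ` Y. if y = line i0 g0 then \<phi> i0 g0 else 0)"
    proof (rule sum.cong[OF refl])
      fix y assume "y \<in> line i ` Y"
      then obtain g1 where "g1 \<in> Y" "y = line i g1" by blast
      then show "(\<Sum>g\<in>{g \<in> Y. line i g = y}. \<phi> i g * \<Delta> i g) = (if y = line i0 g0 then \<phi> i0 g0 else 0)"
        using inner[of g1] Y(2) by blast
    qed
    also have "\<dots> = (if line i0 g0 \<in> line i ` Y then \<phi> i0 g0 else 0)"
      using Y(1) by (simp add: sum.delta)
    \<comment> \<open>The split line must meet \<open>Y\<close>, since an empty sum cannot equal its
      total jump 1.\<close>
    also have "line i0 g0 \<in> line i ` Y \<longleftrightarrow> i = i0"
    proof
      assume "line i0 g0 \<in> line i ` Y"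
      then obtain g where g: "g \<in> Y" "line i g = line i0 g0" by force
      then have "g \<in> carrier F" using Y(2) by blast
      then show "i = i0" using line_eq_iff_vertex[OF i0 g0 i] g(2) by blast
    next
      assume "i = i0"
      show "line i0 g0 \<in> line i ` Y"
      proof (rule ccontr)
        assume "line i0 g0 \<notin> line i ` Y"
        then have empty: "{g \<in> Y. line i0 g = line i0 g0} = {}" using \<open>i = i0\<close> by (auto simp: image_iff)
        have "(\<Sum>f\<in>{f \<in> Y. line i0 f = line i0 g0}. \<Sum>p<length (ws ! i0). jump G (crossed_edge i0 f p)) =
            of_bool (line i0 g0 = line i0 g0)"
          using sum_jumps_over_line[OF G i0 g0 Y] \<Delta>0[OF i0] G_line[OF i0 g0] unfolding \<Delta>_def by simp
        then have "(0::bit) = of_bool (line i0 g0 = line i0 g0)" unfolding empty sum.empty .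
        then show False by simp
      qed
    qed
    finally show "(\<Sum>g\<in>Y. \<phi> i g * \<Delta> i g) = of_bool (i = i0) * \<phi> i0 g0" by simp
  qed
  also have "\<dots> = (\<Sum>i<length ws. if i = i0 then \<phi> i0 g0 else 0)"
    by (intro sum.cong) simp_all
  also have "\<dots> = \<phi> i0 g0" using i0 by (simp add: sum.delta)
  finally show ?thesis by simp
qed

section \<open>Duality: absence of even flows yields splitting sets\<close>

text \<open>Coordinates are indexed by starting vertices and not by lines, which avoids a quotient
  space; the vectors of \<open>realizable_shift\<close> account for the different starting vertices
  on one line.\<close>

definition unit :: "nat \<Rightarrow> letter list \<Rightarrow> nat \<times> letter list \<Rightarrow> bit" where
  "unit i g = (\<lambda>a. of_bool (a = (i, g)))"

text \<open>Crossing numbers mod 2 of one edge by single periods. For an edge this vector has finite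
  support, as \<open>flux_eq_sum_unit\<close> makes explicit.\<close>

definition flux :: "letter list \<times> nat \<Rightarrow> nat \<times> letter list \<Rightarrow> bit" where
  "flux e = (\<lambda>a. if fst a < length ws \<and> snd a \<in> carrier F
     then \<Sum>p<length (ws ! fst a). of_bool (crossed_edge (fst a) (snd a) p = e) else 0)"

text \<open>\<open>u\<close> is the coboundary of a locally constant function on the boundary: its
  total along each line is the difference of that function at the two ends. The infinite total is
  expressed through symmetric windows whose sums eventually stop changing.\<close>

definition realizable :: "(nat \<times> letter list \<Rightarrow> bit) \<Rightarrow> bool" where
  "realizable u \<longleftrightarrow> (\<exists>N G. determined_at N G \<and> (\<forall>i<length ws. \<forall>g\<in>carrier F. \<exists>M. \<forall>K\<ge>M.
     (\<Sum>k\<in>{- int K..<int K}. u (i, line_vertex i g k)) =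
       G (ray_prefix (signed_end i True g) N) + G (ray_prefix (signed_end i False g) N)))"

lemma realizableI:
  assumes "determined_at N G" and "\<And>i g. i < length ws \<Longrightarrow> g \<in> carrier F \<Longrightarrow> \<exists>M. \<forall>K\<ge>M.
     (\<Sum>k\<in>{- int K..<int K}. u (i, line_vertex i g k)) =
       G (ray_prefix (signed_end i True g) N) + G (ray_prefix (signed_end i False g) N)"
  shows "realizable u"
  using assms unfolding realizable_def by (rule_tac exI[of _ N], rule_tac exI[of _ G]) simp

lemma realizable_zero: "realizable (\<lambda>_. 0)"
  by (rule realizableI[of 0 "\<lambda>_. 0"]) (simp_all add: determined_at_def)

lemma realizable_add:
  assumes "realizable u" "realizable v" shows "realizable (\<lambda>a. u a + v a)"
proof -
  obtain N G where G: "determined_at N G"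
    and u: "\<And>i g. i < length ws \<Longrightarrow> g \<in> carrier F \<Longrightarrow> \<exists>M. \<forall>K\<ge>M. (\<Sum>k\<in>{- int K..<int K}. u (i, line_vertex i g k)) =
       G (ray_prefix (signed_end i True g) N) + G (ray_prefix (signed_end i False g) N)"
    using assms(1) unfolding realizable_def by blast
  obtain N' G' where G': "determined_at N' G'"
    and v: "\<And>i g. i < length ws \<Longrightarrow> g \<in> carrier F \<Longrightarrow> \<exists>M. \<forall>K\<ge>M. (\<Sum>k\<in>{- int K..<int K}. v (i, line_vertex i g k)) =
       G' (ray_prefix (signed_end i True g) N') + G' (ray_prefix (signed_end i False g) N')"
    using assms(2) unfolding realizable_def by blast
  define L where "L = max N N'"
  have L: "determined_at L G" "determined_at L G'"
    using determined_at_mono[OF G] determined_at_mono[OF G'] by (simp_all add: L_def)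
  then have "determined_at L (\<lambda>z. G z + G' z)"
    unfolding determined_at_def by metis
  moreover have ray: "G (ray_prefix \<omega> L) = G (ray_prefix \<omega> N)" "G' (ray_prefix \<omega> L) = G' (ray_prefix \<omega> N')"
    if "\<omega> \<in> rays n" for \<omega>
    using that by (auto intro!: determined_atD[OF G] determined_atD[OF G'] simp: rays_def take_ray_prefix L_def)
  have "\<exists>M. \<forall>K\<ge>M. (\<Sum>k\<in>{- int K..<int K}. u (i, line_vertex i g k) + v (i, line_vertex i g k)) =
       (G (ray_prefix (signed_end i True g) L) + G' (ray_prefix (signed_end i True g) L)) +
       (G (ray_prefix (signed_end i False g) L) + G' (ray_prefix (signed_end i False g) L))"
    if ig: "i < length ws" "g \<in> carrier F" for i g
  proof -
    obtain M where M: "\<forall>K\<ge>M. (\<Sum>k\<in>{- int K..<int K}. u (i, line_vertex i g k)) =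
       G (ray_prefix (signed_end i True g) N) + G (ray_prefix (signed_end i False g) N)"
      using u[OF ig] by (rule exE)
    obtain M' where M': "\<forall>K\<ge>M'. (\<Sum>k\<in>{- int K..<int K}. v (i, line_vertex i g k)) =
       G' (ray_prefix (signed_end i True g) N') + G' (ray_prefix (signed_end i False g) N')"
      using v[OF ig] by (rule exE)
    show ?thesis
      using M M' by (intro exI[of _ "max M M'"])
        (simp add: sum.distrib ray signed_end_in_rays[OF ig] ac_simps)
  qed
  ultimately show ?thesis
    by (intro realizableI[of L "\<lambda>z. G z + G' z"])
qed

text \<open>The witness is the indicator of the half-tree beyond \<open>e\<close>, which jumps only
  at \<open>e\<close>; its trace on the boundary is a cylinder.\<close>

lemma realizable_flux:
  assumes e: "e \<in> edges" shows "realizable (flux e)"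
proof -
  define G :: "letter list \<Rightarrow> bit" where "G z = of_bool (prefix (edge_top e) z)" for z
  let ?N = "length (edge_top e)"
  have pre: "prefix v z \<longleftrightarrow> take (length v) z = v" for v z :: "letter list"
    by (metis append_eq_conv_conj prefix_def take_is_prefix)
  have G: "determined_at ?N G"
    unfolding determined_at_def G_def pre by simp
  have jump: "jump G f = of_bool (f = e)" if "f \<in> edges" for f
  proof -
    have "reduced (fst f)" using that by (auto simp: edges_def carrier_free_group)
    then show ?thesis
      using prefix_flip_iff[of "fst f" e "snd f"] by (cases f) (auto simp: jump_def G_def)
  qed
  have flux: "flux e (i, g) = (\<Sum>p<length (ws ! i). jump G (crossed_edge i g p))"
    if "i < length ws" "g \<in> carrier F" for i g
    using that by (auto simp: flux_def jump crossed_edge_in_edges steps_def intro!: sum.cong)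
  have "\<exists>M. \<forall>K\<ge>M. (\<Sum>k\<in>{- int K..<int K}. flux e (i, line_vertex i g k)) =
       G (ray_prefix (signed_end i True g) ?N) + G (ray_prefix (signed_end i False g) ?N)"
    if ig: "i < length ws" "g \<in> carrier F" for i g
  proof -
    have s: "(\<Sum>k\<in>{- int K..<int K}. flux e (i, line_vertex i g k)) =
        G (line_vertex i g (- int K)) + G (line_vertex i g (int K))" for K
      using sum_jumps_line[OF ig, of G K] by (simp add: flux ig(1) line_vertex_closed[OF ig])
    obtain M where "\<forall>K\<ge>M. G (line_vertex i g (- int K)) = G (ray_prefix (signed_end i False g) ?N) \<and>
      G (line_vertex i g (int K)) = G (ray_prefix (signed_end i True g) ?N)"
      using eventually_line_vertex[OF G ig] by (rule exE)
    then show ?thesis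
      unfolding s by (intro exI[of _ M]) (simp add: add.commute)
  qed
  then show ?thesis
    using G by (intro realizableI[of ?N G])
qed

lemma sum_unit_line:
  assumes i: "i < length ws" and g: "g \<in> carrier F" and j: "j < length ws" and h: "h \<in> carrier F"
  shows "\<exists>M. \<forall>K\<ge>M. (\<Sum>k\<in>{- int K..<int K}. unit j h (i, line_vertex i g k)) = of_bool (line j h = line i g)"
proof (cases "line j h = line i g")
  case True
  then have ij: "i = j" "h \<in> range (line_vertex i g)" using line_eq_iff_vertex[OF i g j h] by blast+
  then obtain k0 where k0: "h = line_vertex i g k0" by blast
  have "unit j h (i, line_vertex i g k) = (if k0 = k then 1 else 0)" for k
    using inj_line_vertex[OF i g] by (auto simp: unit_def k0 ij inj_eq)
  then have "(\<Sum>k\<in>{- int K..<int K}. unit j h (i, line_vertex i g k)) = 1" if "K \<ge> Suc (nat \<bar>k0\<bar>)" for K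
  proof -
    have "- int K \<le> k0 \<and> k0 < int K" using that by linarith
    then show ?thesis using \<open>\<And>k. unit j h (i, line_vertex i g k) = (if k0 = k then 1 else 0)\<close> by simp
  qed
  then show ?thesis using True by (intro exI[of _ "Suc (nat \<bar>k0\<bar>)"]) simp
next
  case False
  then have "unit j h (i, line_vertex i g k) = 0" for k
    using line_eq_iff_vertex[OF i g j h] by (auto simp: unit_def)
  then show ?thesis using False by simp
qed

text \<open>Both starting vertices lie on one line, so every total is even and the zero function
  serves as \<open>G\<close>.\<close>

lemma realizable_shift:
  assumes j: "j < length ws" and h: "h \<in> carrier F"
  shows "realizable (\<lambda>a. unit j h a + unit j (reduce (h @ ws ! j)) a)"
proof -
  let ?h = "reduce (h @ ws ! j)"
  have h': "?h \<in> carrier F" using h letters_nth[OF j] by (rule mult_in_carrier)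
  have "?h = line_vertex j h 1" using line_vertex_Suc[OF j h, of 0] by (simp add: line_vertex_0[OF j h])
  then have same: "line j ?h = line j h" using line_eq_iff_vertex[OF j h j h'] by blast
  have "\<exists>M. \<forall>K\<ge>M. (\<Sum>k\<in>{- int K..<int K}. unit j h (i, line_vertex i g k) + unit j ?h (i, line_vertex i g k)) = 0"
    if ig: "i < length ws" "g \<in> carrier F" for i g
  proof -
    obtain M where M: "\<forall>K\<ge>M. (\<Sum>k\<in>{- int K..<int K}. unit j h (i, line_vertex i g k)) = of_bool (line j h = line i g)"
      using sum_unit_line[OF ig j h] by (rule exE)
    obtain M' where M': "\<forall>K\<ge>M'. (\<Sum>k\<in>{- int K..<int K}. unit j ?h (i, line_vertex i g k)) = of_bool (line j ?h = line i g)"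
      using sum_unit_line[OF ig j h'] by (rule exE)
    show ?thesis using M M' by (intro exI[of _ "max M M'"]) (simp add: sum.distrib same)
  qed
  then show ?thesis
    by (intro realizableI[of 0 "\<lambda>_. 0"]) (simp_all add: determined_at_def)
qed

text \<open>For a fixed position in a fixed word, exactly one starting vertex leads across the given
  edge, provided that the letter there uses the generator \<open>j\<close>.\<close>

lemma flux_eq_sum_unit:
  assumes h: "h \<in> carrier F" and j: "j < n"
  shows "flux (h, j) a = (\<Sum>q\<in>{q \<in> steps. fst (ws ! fst q ! snd q) = j}.
    unit (fst q) (reduce (h @ inv_word (take (tail_pos (fst q) (snd q)) (ws ! fst q)))) a)"
proof -
  obtain i g where a: "a = (i, g)" by (cases a)
  let ?P = "\<lambda>q. fst (ws ! fst q ! snd q) = j"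
  let ?s = "\<lambda>q. reduce (h @ inv_word (take (tail_pos (fst q) (snd q)) (ws ! fst q)))"
  have closed: "?s q \<in> carrier F" if "q \<in> steps" for q
    using that by (intro mult_in_carrier h) (auto simp: set_inv_word steps_def intro!: take_letters)
  have "(\<Sum>q\<in>{q \<in> steps. ?P q}. unit (fst q) (?s q) a) = (\<Sum>q\<in>steps. if ?P q then unit (fst q) (?s q) a else 0)"
    by (rule sum.inter_filter[OF finite_steps])
  also have "\<dots> = (\<Sum>i'<length ws. \<Sum>p<length (ws ! i'). if ?P (i', p) then unit i' (?s (i', p)) a else 0)"
    unfolding steps_def by (subst sum.Sigma) (auto simp: case_prod_unfold intro!: sum.cong)
  also have "\<dots> = (\<Sum>i'<length ws. if i' = i then flux (h, j) a else 0)"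
  proof (rule sum.cong[OF refl])
    fix i' assume "i' \<in> {..<length ws}"
    then have i': "i' < length ws" by simp
    show "(\<Sum>p<length (ws ! i'). if ?P (i', p) then unit i' (?s (i', p)) a else 0) = (if i' = i then flux (h, j) a else 0)"
    proof (cases "i' = i \<and> g \<in> carrier F")
      case True
      have "(if ?P (i', p) then unit i' (?s (i', p)) a else 0) = of_bool (crossed_edge i g p = (h, j))" for p
      proof -
        have "g = ?s (i, p) \<longleftrightarrow> reduce (g @ take (tail_pos i p) (ws ! i)) = h"
        proof
          assume "g = ?s (i, p)"
          then show "reduce (g @ take (tail_pos i p) (ws ! i)) = h"
            using h by (simp add: carrier_free_group reduce_reduced)
        next
          assume "reduce (g @ take (tail_pos i p) (ws ! i)) = h"
          then have "h = reduce (g @ take (tail_pos i p) (ws ! i))" ..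
          then show "g = ?s (i, p)"
            using True by (simp add: carrier_free_group reduce_reduced)
        qed
        then show ?thesis using True by (auto simp: unit_def a crossed_edge_def)
      qed
      then show ?thesis using True i' by (simp add: flux_def a)
    next
      case False
      have z: "unit i' (?s (i', p)) a = 0" if "p < length (ws ! i')" for p
        using False closed[of "(i', p)"] that i' by (auto simp: unit_def a steps_def)
      have "(\<Sum>p<length (ws ! i'). if ?P (i', p) then unit i' (?s (i', p)) a else 0) = 0"
        by (rule sum.neutral, rule ballI) (simp only: lessThan_iff z if_cancel)
      moreover have "flux (h, j) a = 0" if "i' = i" using False that by (simp add: flux_def a)
      ultimately show ?thesis by simp
    qed
  qed
  also have "\<dots> = flux (h, j) a" by (simp add: flux_def a)
  finally show ?thesis by simp
qed

text \<open>An additive functional that vanishes on all fluxes and shift differences restricts on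
  unit vectors to an even flow, so by assumption it vanishes at \<open>unit i0 g0\<close>. By
  separation this vector is realizable, and a realizing \<open>G\<close> cuts out the clopen
  set.\<close>

theorem splitting_of_no_even_flow:
  assumes none: "\<And>\<phi>. even_flow \<phi> \<Longrightarrow> \<phi> i0 g0 = 0" and i0: "i0 < length ws" and g0: "g0 \<in> carrier F"
  shows "\<exists>A. clopenin (free_boundary n) A \<and>
    (\<forall>j h. j < length ws \<longrightarrow> h \<in> carrier F \<longrightarrow> (splits A (line j h) \<longleftrightarrow> line j h = line i0 g0))"
proof -
  let ?S = "flux ` edges \<union> {\<lambda>a. unit i g a + unit i (reduce (g @ ws ! i)) a | i g. i < length ws \<and> g \<in> carrier F}"
  have "unit i0 g0 \<in> {u. realizable u}"
  proof (rule bit_functional_separation[where S = ?S])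
    fix f :: "(nat \<times> letter list \<Rightarrow> bit) \<Rightarrow> bit"
    assume add: "\<And>u v. f (\<lambda>a. u a + v a) = f u + f v" and S: "\<And>s. s \<in> ?S \<Longrightarrow> f s = 0"
    have f0: "f (\<lambda>_. 0) = 0" using add[of "\<lambda>_. 0" "\<lambda>_. 0"] by simp
    have f_sum: "f (\<lambda>a. \<Sum>q\<in>Q. t q a) = (\<Sum>q\<in>Q. f (t q))" if "finite Q" for Q :: "(nat \<times> nat) set" and t
      using that by (induction Q rule: finite_induct) (simp_all add: f0 add)
    \<comment> \<open>The values of \<open>f\<close> on unit vectors are all that matters, as every
      flux is a finite sum of them.\<close>
    define \<phi> where "\<phi> i g = f (unit i g)" for i g
    have "even_flow \<phi>"
      unfolding even_flow_def
    proof (intro conjI allI impI ballI)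
      fix i g assume "i < length ws" "g \<in> carrier F"
      then have "f (\<lambda>a. unit i g a + unit i (reduce (g @ ws ! i)) a) = 0" by (intro S) blast
      then show "\<phi> i (reduce (g @ ws ! i)) = \<phi> i g" by (simp add: add \<phi>_def bit_add_eq_0_iff)
    next
      fix h j assume hj: "h \<in> carrier F" "j < n"
      then have "f (flux (h, j)) = 0" by (intro S) (simp add: edges_def)
      moreover have "flux (h, j) = (\<lambda>a. \<Sum>q\<in>{q \<in> steps. fst (ws ! fst q ! snd q) = j}.
          unit (fst q) (reduce (h @ inv_word (take (tail_pos (fst q) (snd q)) (ws ! fst q)))) a)"
        using flux_eq_sum_unit[OF hj] by (rule ext)
      ultimately show "(\<Sum>q\<in>{q \<in> steps. fst (ws ! fst q ! snd q) = j}.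
          \<phi> (fst q) (reduce (h @ inv_word (take (tail_pos (fst q) (snd q)) (ws ! fst q))))) = 0"
        using finite_steps by (simp add: f_sum \<phi>_def)
    qed
    then show "f (unit i0 g0) = 0" using none[of \<phi>] by (simp add: \<phi>_def)
  next
    show "?S \<subseteq> {u. realizable u}" using realizable_flux realizable_shift by blast
    show "(\<lambda>_. 0) \<in> {u. realizable u}" using realizable_zero by simp
    show "(\<lambda>a. u a + v a) \<in> {u. realizable u}" if "u \<in> {u. realizable u}" "v \<in> {u. realizable u}" for u v
      using realizable_add that by simp
  qed
  then obtain N G where G: "determined_at N G" and real: "\<forall>i<length ws. \<forall>g\<in>carrier F. \<exists>M. \<forall>K\<ge>M.
     (\<Sum>k\<in>{- int K..<int K}. unit i0 g0 (i, line_vertex i g k)) =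
       G (ray_prefix (signed_end i True g) N) + G (ray_prefix (signed_end i False g) N)"
    unfolding realizable_def mem_Collect_eq by (elim exE conjE)
  \<comment> \<open>\<open>R\<close> depends on the first \<open>N\<close> letters only, hence is
    clopen; two elements of \<open>bit\<close> add up to 1 exactly when they differ, so the ends of
    a line are separated exactly when the total of \<open>unit i0 g0\<close> along it is 1.\<close>
  define R where "R = {\<omega> \<in> rays n. G (ray_prefix \<omega> N) = 1}"
  have "clopenin (free_boundary n) (ray_end n ` R)"
    by (rule clopenin_free_boundaryI[where N = N]) (auto simp: R_def)
  moreover have "splits (ray_end n ` R) (line i g) \<longleftrightarrow> line i g = line i0 g0"
    if ig: "i < length ws" "g \<in> carrier F" for i g
  proof -
    obtain M where M: "\<forall>K\<ge>M. (\<Sum>k\<in>{- int K..<int K}. unit i0 g0 (i, line_vertex i g k)) =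
       G (ray_prefix (signed_end i True g) N) + G (ray_prefix (signed_end i False g) N)"
      using real[rule_format, OF ig] by (rule exE)
    obtain M' where M': "\<forall>K\<ge>M'. (\<Sum>k\<in>{- int K..<int K}. unit i0 g0 (i, line_vertex i g k)) = of_bool (line i0 g0 = line i g)"
      using sum_unit_line[OF ig i0 g0] by (rule exE)
    have eq: "G (ray_prefix (signed_end i True g) N) + G (ray_prefix (signed_end i False g) N) = of_bool (line i0 g0 = line i g)"
      using M[rule_format, of "max M M'"] M'[rule_format, of "max M M'"] by simp
    have "ray_end n (signed_end i s g) \<in> ray_end n ` R \<longleftrightarrow> G (ray_prefix (signed_end i s g) N) = 1" for s
      using ray_end_in_image_iff[OF signed_end_in_rays[OF ig], of R] signed_end_in_rays[OF ig] by (auto simp: R_def)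
    then have "splits (ray_end n ` R) (line i g) \<longleftrightarrow>
        G (ray_prefix (signed_end i True g) N) + G (ray_prefix (signed_end i False g) N) = 1"
      by (cases "G (ray_prefix (signed_end i True g) N)"; cases "G (ray_prefix (signed_end i False g) N)")
        (simp_all add: splits_def line_def)
    then show ?thesis unfolding eq by auto
  qed
  ultimately show ?thesis by (intro exI[of _ "ray_end n ` R"] conjI allI impI)
qed

theorem trivial_cech_cohomology_iff_no_even_flow:
  "trivial_group (cech_cohomology 1 (decomposition_space n (map reduce ws))) \<longleftrightarrow>
    (\<forall>\<phi>. even_flow \<phi> \<longrightarrow> (\<forall>i<length ws. \<forall>g\<in>carrier F. \<phi> i g = 0))"
  unfolding trivial_cech_cohomology_iff
proof (intro iffI allI impI ballI)
  fix \<phi> i g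
  assume *: "\<forall>i g. i < length ws \<longrightarrow> g \<in> carrier F \<longrightarrow> (\<exists>A. clopenin (free_boundary n) A \<and>
      (\<forall>j h. j < length ws \<longrightarrow> h \<in> carrier F \<longrightarrow> (splits A (line j h) \<longleftrightarrow> line j h = line i g)))"
    and "even_flow \<phi>" "i < length ws" "g \<in> carrier F"
  obtain A where "clopenin (free_boundary n) A"
      "\<forall>j h. j < length ws \<longrightarrow> h \<in> carrier F \<longrightarrow> (splits A (line j h) \<longleftrightarrow> line j h = line i g)"
    using *[rule_format, OF \<open>i < length ws\<close> \<open>g \<in> carrier F\<close>] by (elim exE conjE)
  then show "\<phi> i g = 0"
    using \<open>even_flow \<phi>\<close> \<open>i < length ws\<close> \<open>g \<in> carrier F\<close> by (intro even_flow_eq_0_of_splitting[of A]) simp_all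
next
  fix i g
  assume *: "\<forall>\<phi>. even_flow \<phi> \<longrightarrow> (\<forall>i<length ws. \<forall>g\<in>carrier F. \<phi> i g = 0)" "i < length ws" "g \<in> carrier F"
  show "\<exists>A. clopenin (free_boundary n) A \<and>
      (\<forall>j h. j < length ws \<longrightarrow> h \<in> carrier F \<longrightarrow> (splits A (line j h) \<longleftrightarrow> line j h = line i g))"
    by (rule splitting_of_no_even_flow[OF _ *(2,3)]) (use * in blast)
qed

end

section \<open>Computable functions\<close>

definition computable :: "nat \<Rightarrow> (nat list \<Rightarrow> nat) \<Rightarrow> bool" where
  "computable k f \<longleftrightarrow> (\<exists>r. \<forall>xs. length xs = k \<longrightarrow> rec_eval r xs (f xs))"

lemma computable_cong: "computable k f \<Longrightarrow> (\<And>xs. length xs = k \<Longrightarrow> f xs = g xs) \<Longrightarrow> computable k g"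
  unfolding computable_def by metis

lemma computable_nth: "i < k \<Longrightarrow> computable k (\<lambda>xs. xs ! i)"
  unfolding computable_def by (auto intro: rec_eval_Proj)

lemma computable_hd_funpow_tl: "i < k \<Longrightarrow> computable k (\<lambda>xs. hd ((tl ^^ i) xs))"
proof (rule computable_cong[OF computable_nth])
  fix xs :: "nat list" assume "i < k" "length xs = k"
  moreover have "(tl ^^ i) ys = drop i ys" for ys :: "nat list"
    by (induction i) (simp_all add: drop_Suc tl_drop)
  ultimately show "xs ! i = hd ((tl ^^ i) xs)" by (simp add: hd_drop_conv_nth)
qed

text \<open>Arguments are addressed through \<open>hd\<close> and \<open>tl\<close> because a bound
  variable is put in front of the argument list: passing under a binder replaces the list by its
  tail and preserves this form.\<close>

lemma computable_var:
  "0 < k \<Longrightarrow> computable k (\<lambda>xs. hd xs)"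
  "1 < k \<Longrightarrow> computable k (\<lambda>xs. hd (tl xs))"
  "2 < k \<Longrightarrow> computable k (\<lambda>xs. hd (tl (tl xs)))"
  "3 < k \<Longrightarrow> computable k (\<lambda>xs. hd (tl (tl (tl xs))))"
  "4 < k \<Longrightarrow> computable k (\<lambda>xs. hd (tl (tl (tl (tl xs)))))"
  "5 < k \<Longrightarrow> computable k (\<lambda>xs. hd (tl (tl (tl (tl (tl xs))))))"
  "6 < k \<Longrightarrow> computable k (\<lambda>xs. hd (tl (tl (tl (tl (tl (tl xs)))))))"
  "7 < k \<Longrightarrow> computable k (\<lambda>xs. hd (tl (tl (tl (tl (tl (tl (tl xs))))))))"
  by (drule computable_hd_funpow_tl, simp add: numeral_eq_Suc)+

lemma computable_comp:
  assumes g: "computable m g" and fs: "length fs = m" "\<And>f. f \<in> set fs \<Longrightarrow> computable k f"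
  shows "computable k (\<lambda>xs. g (map (\<lambda>f. f xs) fs))"
proof -
  obtain r where r: "\<And>xs. length xs = m \<Longrightarrow> rec_eval r xs (g xs)" using g unfolding computable_def by blast
  have "\<forall>f\<in>set fs. \<exists>s. \<forall>xs. length xs = k \<longrightarrow> rec_eval s xs (f xs)" using fs(2) unfolding computable_def by blast
  then obtain s where s: "\<And>f xs. f \<in> set fs \<Longrightarrow> length xs = k \<Longrightarrow> rec_eval (s f) xs (f xs)" by metis
  have "rec_eval (Comp r (map s fs)) xs (g (map (\<lambda>f. f xs) fs))" if "length xs = k" for xs
  proof (rule rec_eval_Comp)
    show "list_all2 (\<lambda>g y. rec_eval g xs y) (map s fs) (map (\<lambda>f. f xs) fs)"
      using s that by (simp add: list_all2_conv_all_nth)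
    show "rec_eval r (map (\<lambda>f. f xs) fs) (g (map (\<lambda>f. f xs) fs))" using fs(1) by (intro r) simp
  qed
  then show ?thesis unfolding computable_def by blast
qed

lemma computable_comp1: "computable 1 (\<lambda>xs. h (hd xs)) \<Longrightarrow> computable k f \<Longrightarrow> computable k (\<lambda>xs. h (f xs))"
  using computable_comp[of 1 "\<lambda>xs. h (hd xs)" "[f]" k] by simp

lemma computable_comp2:
  "computable 2 (\<lambda>xs. h (hd xs) (hd (tl xs))) \<Longrightarrow> computable k f \<Longrightarrow> computable k g \<Longrightarrow>
    computable k (\<lambda>xs. h (f xs) (g xs))"
  using computable_comp[of 2 "\<lambda>xs. h (hd xs) (hd (tl xs))" "[f, g]" k] by auto

lemma computable_Suc: "computable k f \<Longrightarrow> computable k (\<lambda>xs. Suc (f xs))"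
proof (rule computable_comp1[where h = Suc])
  have "rec_eval Succ xs (Suc (hd xs))" if "length xs = 1" for xs
    using that rec_eval_Succ by (cases xs) auto
  then show "computable 1 (\<lambda>xs. Suc (hd xs))" unfolding computable_def by blast
qed

lemma computable_const: "computable k (\<lambda>xs. c)"
proof (induction c)
  case 0
  then show ?case unfolding computable_def using rec_eval_Zero by blast
next
  case (Suc c)
  then show ?case by (rule computable_Suc)
qed

text \<open>The step function receives the counter, the accumulated value and the parameters in the
  order of \<open>PrimRec\<close>. The closing composition supplies the bound \<open>b\<close>
  followed by a copy of all parameters.\<close>

lemma computable_rec:
  assumes b: "computable k b" and f: "computable k f"
    and g: "computable (Suc (Suc k)) (\<lambda>ys. g (hd ys) (hd (tl ys)) (tl (tl ys)))"
  shows "computable k (\<lambda>xs. rec_nat (f xs) (\<lambda>m y. g m y xs) (b xs))"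
proof -
  obtain r where r: "\<And>xs. length xs = k \<Longrightarrow> rec_eval r xs (f xs)" using f unfolding computable_def by blast
  obtain s where s: "\<And>xs. length xs = Suc (Suc k) \<Longrightarrow> rec_eval s xs (g (hd xs) (hd (tl xs)) (tl (tl xs)))"
    using g unfolding computable_def by blast
  have pr: "rec_eval (PrimRec r s) (m # xs) (rec_nat (f xs) (\<lambda>m y. g m y xs) m)" if xs: "length xs = k" for m xs
  proof (induction m)
    case 0
    then show ?case using r[OF xs] by (simp add: rec_eval_PrimRec_0)
  next
    case (Suc m)
    have "rec_eval s (m # rec_nat (f xs) (\<lambda>m y. g m y xs) m # xs) (g m (rec_nat (f xs) (\<lambda>m y. g m y xs) m) xs)"
      using s[of "m # rec_nat (f xs) (\<lambda>m y. g m y xs) m # xs"] xs by simp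
    then show ?case using rec_eval_PrimRec_Suc[OF Suc] by simp
  qed
  have "computable (Suc k) (\<lambda>ys. rec_nat (f (tl ys)) (\<lambda>m y. g m y (tl ys)) (hd ys))"
    unfolding computable_def
  proof (intro exI[of _ "PrimRec r s"] allI impI)
    fix ys :: "nat list" assume "length ys = Suc k"
    then show "rec_eval (PrimRec r s) ys (rec_nat (f (tl ys)) (\<lambda>m y. g m y (tl ys)) (hd ys))"
      using pr[of "tl ys" "hd ys"] by (cases ys) auto
  qed
  then have "computable k (\<lambda>xs. (\<lambda>ys. rec_nat (f (tl ys)) (\<lambda>m y. g m y (tl ys)) (hd ys))
      (map (\<lambda>f. f xs) (b # map (\<lambda>i xs. xs ! i) [0..<k])))"
    using b by (intro computable_comp[of "Suc k"]) (auto intro: computable_nth)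
  then show ?thesis
  proof (rule computable_cong)
    fix xs :: "nat list" assume "length xs = k"
    then have "map (\<lambda>i. xs ! i) [0..<k] = xs" using map_nth[of xs] by simp
    then show "(\<lambda>ys. rec_nat (f (tl ys)) (\<lambda>m y. g m y (tl ys)) (hd ys)) (map (\<lambda>f. f xs) (b # map (\<lambda>i xs. xs ! i) [0..<k]))
        = rec_nat (f xs) (\<lambda>m y. g m y xs) (b xs)"
      by (simp add: comp_def)
  qed
qed

lemma computable_add:
  assumes "computable k f" "computable k g" shows "computable k (\<lambda>xs. f xs + g xs)"
proof -
  have eq: "rec_nat a (\<lambda>m y. Suc y) b = a + b" for a b :: nat by (induction b) simp_all
  have "computable k (\<lambda>xs. rec_nat (f xs) (\<lambda>m y. Suc y) (g xs))"
    by (rule computable_rec[OF assms(2,1)]) (intro computable_Suc computable_var, simp)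
  then show ?thesis by (simp only: eq)
qed

lemma computable_mult:
  assumes "computable k f" "computable k g" shows "computable k (\<lambda>xs. f xs * g xs)"
proof (rule computable_comp2[OF _ assms])
  have eq: "rec_nat 0 (\<lambda>m y. y + a) b = a * b" for a b :: nat by (induction b) simp_all
  have "computable 2 (\<lambda>xs. rec_nat 0 (\<lambda>m y. y + hd xs) (hd (tl xs)))"
    by (rule computable_rec[OF computable_var(2) computable_const])
      (intro computable_add computable_var | simp)+
  then show "computable 2 (\<lambda>xs. hd xs * hd (tl xs))" by (simp only: eq)
qed

lemma computable_pred:
  assumes "computable k f" shows "computable k (\<lambda>xs. f xs - 1)"
proof -
  have eq: "rec_nat 0 (\<lambda>m y. m) b = b - 1" for b :: nat by (induction b) simp_all
  have "computable k (\<lambda>xs. rec_nat 0 (\<lambda>m y. m) (f xs))"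
    by (rule computable_rec[OF assms computable_const]) (intro computable_var, simp)
  then show ?thesis by (simp only: eq)
qed

lemma computable_diff:
  assumes "computable k f" "computable k g" shows "computable k (\<lambda>xs. f xs - g xs)"
proof -
  have eq: "rec_nat a (\<lambda>m y. y - 1) b = a - b" for a b :: nat by (induction b) simp_all
  have "computable k (\<lambda>xs. rec_nat (f xs) (\<lambda>m y. y - 1) (g xs))"
    by (rule computable_rec[OF assms(2,1)]) (intro computable_pred computable_var, simp)
  then show ?thesis by (simp only: eq)
qed

lemma computable_power2:
  assumes "computable k f" shows "computable k (\<lambda>xs. 2 ^ f xs)"
proof -
  have eq: "rec_nat 1 (\<lambda>m y. y + y) b = (2 :: nat) ^ b" for b :: nat by (induction b) simp_all
  have "computable k (\<lambda>xs. rec_nat 1 (\<lambda>m y. y + y) (f xs))"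
    by (rule computable_rec[OF assms computable_const]) (intro computable_add computable_var; simp)
  then show ?thesis by (simp only: eq)
qed

lemma computable_sum:
  assumes "computable k b" "computable (Suc k) (\<lambda>ys. g (hd ys) (tl ys))"
  shows "computable k (\<lambda>xs. \<Sum>m<b xs. g m xs)"
proof -
  have eq: "rec_nat 0 (\<lambda>m y. y + g m xs) c = (\<Sum>m<c. g m xs)" for c xs
    by (induction c) simp_all
  \<comment> \<open>Index 1 holds the accumulated value and is skipped, because the summand depends
    on the counter and the parameters only.\<close>
  have "computable (Suc (Suc k)) (\<lambda>ys. (\<lambda>zs. g (hd zs) (tl zs)) (map (\<lambda>f. f ys) (hd # map (\<lambda>i xs. xs ! Suc (Suc i)) [0..<k])))"
    by (rule computable_comp[OF assms(2)]) (auto intro: computable_nth computable_var)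
  then have "computable (Suc (Suc k)) (\<lambda>ys. g (hd ys) (tl (tl ys)))"
  proof (rule computable_cong)
    fix ys :: "nat list" assume "length ys = Suc (Suc k)"
    then have "map (\<lambda>i. ys ! Suc (Suc i)) [0..<k] = tl (tl ys)"
      by (intro nth_equalityI) (auto simp: nth_tl)
    then show "(\<lambda>zs. g (hd zs) (tl zs)) (map (\<lambda>f. f ys) (hd # map (\<lambda>i xs. xs ! Suc (Suc i)) [0..<k])) = g (hd ys) (tl (tl ys))"
      by (simp add: comp_def)
  qed
  then have "computable (Suc (Suc k)) (\<lambda>ys. hd (tl ys) + g (hd ys) (tl (tl ys)))"
    by (intro computable_add computable_var) simp_all
  then show ?thesis
    using computable_rec[OF assms(1) computable_const[of k 0], of "\<lambda>m y xs. y + g m xs"] by (simp add: eq)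
qed

section \<open>Decidable predicates and bounded quantifiers\<close>

definition decidable :: "nat \<Rightarrow> (nat list \<Rightarrow> bool) \<Rightarrow> bool" where
  "decidable k P \<longleftrightarrow> computable k (\<lambda>xs. of_bool (P xs))"

lemma decidable_le:
  assumes "computable k f" "computable k g" shows "decidable k (\<lambda>xs. f xs \<le> g xs)"
proof -
  have "of_bool (a \<le> b) = 1 - (a - b)" for a b :: nat by auto
  then show ?thesis unfolding decidable_def using assms by (simp add: computable_diff computable_const)
qed

lemma decidable_not: "decidable k P \<Longrightarrow> decidable k (\<lambda>xs. \<not> P xs)"
proof -
  assume P: "decidable k P"
  have "of_bool (\<not> p) = 1 - (of_bool p :: nat)" for p by auto
  then show ?thesis using computable_diff[OF computable_const P[unfolded decidable_def], of 1]
    unfolding decidable_def by simp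
qed

lemma decidable_conj: "decidable k P \<Longrightarrow> decidable k Q \<Longrightarrow> decidable k (\<lambda>xs. P xs \<and> Q xs)"
  unfolding decidable_def of_bool_conj by (rule computable_mult)

lemma decidable_imp: "decidable k P \<Longrightarrow> decidable k Q \<Longrightarrow> decidable k (\<lambda>xs. P xs \<longrightarrow> Q xs)"
  using decidable_not[OF decidable_conj[OF _ decidable_not], of k P Q] by simp

lemma decidable_disj: "decidable k P \<Longrightarrow> decidable k Q \<Longrightarrow> decidable k (\<lambda>xs. P xs \<or> Q xs)"
  using decidable_imp[OF decidable_not, of k P Q] by (simp add: imp_conv_disj)

lemma decidable_iff: "decidable k P \<Longrightarrow> decidable k Q \<Longrightarrow> decidable k (\<lambda>xs. P xs \<longleftrightarrow> Q xs)"
  unfolding iff_conv_conj_imp by (intro decidable_conj decidable_imp)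

lemma decidable_eq: "computable k f \<Longrightarrow> computable k g \<Longrightarrow> decidable k (\<lambda>xs. f xs = g xs)"
  unfolding order_eq_iff[of "_ :: nat"] by (intro decidable_conj decidable_le)

lemma decidable_less: "computable k f \<Longrightarrow> computable k g \<Longrightarrow> decidable k (\<lambda>xs. f xs < g xs)"
  unfolding less_eq_Suc_le by (intro decidable_le computable_Suc)

lemma computable_of_bool: "decidable k P \<Longrightarrow> computable k (\<lambda>xs. of_bool (P xs))"
  by (simp add: decidable_def)

text \<open>Counting the witnesses turns a bounded search into a bounded sum.\<close>

lemma decidable_ex:
  assumes "computable k b" "decidable (Suc k) (\<lambda>ys. P (hd ys) (tl ys))"
  shows "decidable k (\<lambda>xs. \<exists>m<b xs. P m xs)"
proof -
  have "(\<exists>m<c. Q m) \<longleftrightarrow> 0 < (\<Sum>m<c. of_bool (Q m) :: nat)" for c :: nat and Q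
    by (subst zero_less_iff_neq_zero) auto
  then show ?thesis
    using assms by (simp only:) (intro decidable_less computable_const computable_sum computable_of_bool)
qed

lemma decidable_all:
  assumes "computable k b" "decidable (Suc k) (\<lambda>ys. P (hd ys) (tl ys))"
  shows "decidable k (\<lambda>xs. \<forall>m<b xs. P m xs)"
  using decidable_not[OF decidable_ex[OF assms(1) decidable_not[OF assms(2)]]] by simp

lemmas computable_intros =
  computable_var computable_const computable_Suc computable_add computable_mult computable_diff
  computable_power2 computable_sum computable_of_bool decidable_le decidable_less decidable_eq
  decidable_not decidable_conj decidable_imp decidable_disj decidable_iff decidable_ex decidable_all

text \<open>The triangular number in the pairing is obtained as a sum, which avoids a division by
  2.\<close>

lemma computable_prod_encode:
  assumes "computable k f" "computable k g" shows "computable k (\<lambda>xs. prod_encode (f xs, g xs))"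
proof -
  have "(\<Sum>m<Suc b. m) = triangle b" for b :: nat by (induction b) simp_all
  then have eq: "prod_encode (a, b) = (\<Sum>m<Suc (a + b). m) + a" for a b
    by (simp only: prod_encode_def case_prod_conv)
  show ?thesis unfolding eq by (intro computable_intros assms) simp
qed

text \<open>Bit \<open>x\<close> of \<open>S\<close> is set when the quotient of \<open>S\<close> by
  \<open>2 ^ x\<close> is odd. Division with remainder is expressed as an equation with bounded
  quotient and remainder, so a search replaces the computation of quotients.\<close>

lemma decidable_mem:
  assumes "computable k f" "computable k g" shows "decidable k (\<lambda>xs. f xs \<in> set_decode (g xs))"
proof -
  have "x \<in> set_decode S \<longleftrightarrow> (\<exists>q<Suc S. \<exists>t<2 ^ x. S = (q + q + 1) * 2 ^ x + t)" for x S :: nat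
  proof
    assume "x \<in> set_decode S"
    then have "odd (S div 2 ^ x)" by (simp add: set_decode_def)
    then obtain q where q: "S div 2 ^ x = q + q + 1" by (metis mult_2 oddE)
    then have "S = (q + q + 1) * 2 ^ x + S mod 2 ^ x" by (metis div_mult_mod_eq)
    moreover have "S div 2 ^ x \<le> S" by (rule div_le_dividend)
    then have "q < Suc S" using q by linarith
    moreover have "S mod 2 ^ x < 2 ^ x" by simp
    ultimately show "\<exists>q<Suc S. \<exists>t<2 ^ x. S = (q + q + 1) * 2 ^ x + t" by blast
  next
    assume "\<exists>q<Suc S. \<exists>t<2 ^ x. S = (q + q + 1) * 2 ^ x + t"
    then obtain q t where "t < 2 ^ x" "S = t + (q + q + 1) * 2 ^ x" by (auto simp: add.commute)
    then have "S div 2 ^ x = q + q + 1" by (simp only: div_mult_self1) simp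
    then show "x \<in> set_decode S" by (simp add: set_decode_def)
  qed
  then show ?thesis
    by (simp only:) (rule computable_comp2[where h = "\<lambda>x S. of_bool (\<exists>q<Suc S. \<exists>t<2 ^ x. S = (q + q + 1) * 2 ^ x + t)",
        OF _ assms, folded decidable_def], intro computable_intros; simp)
qed

section \<open>Taking codes of lists apart\<close>

text \<open>The pairing is inverted by exhaustive search: in the double sum only the decoded pair
  contributes. Components never exceed the code of their pair, so \<open>z\<close> bounds both; the
  \<open>Suc\<close> is the one that \<open>list_encode\<close> applies to nonempty lists.\<close>

definition code_hd :: "nat \<Rightarrow> nat" where
  "code_hd z = (\<Sum>x<z. \<Sum>y<z. of_bool (Suc (prod_encode (x, y)) = z) * x)"

definition code_tl :: "nat \<Rightarrow> nat" where
  "code_tl z = (\<Sum>x<z. \<Sum>y<z. of_bool (Suc (prod_encode (x, y)) = z) * y)"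

lemma code_hd_tl: "code_hd (list_encode (x # xs)) = x" "code_tl (list_encode (x # xs)) = list_encode xs"
proof -
  let ?z = "list_encode (x # xs)" and ?y = "list_encode xs"
  have lt: "x < ?z" "?y < ?z" by (simp_all add: le_imp_less_Suc le_prod_encode_1 le_prod_encode_2)
  have eq: "Suc (prod_encode (x', y')) = ?z \<longleftrightarrow> x' = x \<and> y' = ?y" for x' y'
    by (simp add: prod_encode_eq)
  have s: "(\<Sum>x'<?z. \<Sum>y'<?z. of_bool (x' = x \<and> y' = ?y) * h x' y') = h x ?y" for h :: "nat \<Rightarrow> nat \<Rightarrow> nat"
  proof -
    have "(\<Sum>x'<?z. \<Sum>y'<?z. of_bool (x' = x \<and> y' = ?y) * h x' y') =
        (\<Sum>x'<?z. if x' = x then (\<Sum>y'<?z. if y' = ?y then h x y' else 0) else 0)"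
      by (intro sum.cong refl) (auto intro!: sum.cong)
    then show ?thesis using lt by (simp add: sum.delta del: list_encode.simps)
  qed
  show "code_hd ?z = x" unfolding code_hd_def eq by (rule s)
  show "code_tl ?z = ?y" unfolding code_tl_def eq by (rule s)
qed

lemma computable_code_hd: "computable k f \<Longrightarrow> computable k (\<lambda>xs. code_hd (f xs))"
  unfolding code_hd_def
  by (rule computable_comp1[where h = "\<lambda>z. \<Sum>x<z. \<Sum>y<z. of_bool (Suc (prod_encode (x, y)) = z) * x"])
    (intro computable_intros computable_prod_encode; simp)

lemma computable_code_tl: "computable k f \<Longrightarrow> computable k (\<lambda>xs. code_tl (f xs))"
  unfolding code_tl_def
  by (rule computable_comp1[where h = "\<lambda>z. \<Sum>x<z. \<Sum>y<z. of_bool (Suc (prod_encode (x, y)) = z) * y"])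
    (intro computable_intros computable_prod_encode; simp)

definition code_drop :: "nat \<Rightarrow> nat \<Rightarrow> nat" where
  "code_drop z i = rec_nat z (\<lambda>m y. code_tl y) i"

definition code_nth :: "nat \<Rightarrow> nat \<Rightarrow> nat" where
  "code_nth z i = code_hd (code_drop z i)"

text \<open>Positions at which a nonempty list remains are counted; a list is no longer than its
  code, so \<open>z\<close> is a sufficient range.\<close>

definition code_length :: "nat \<Rightarrow> nat" where
  "code_length z = (\<Sum>i<z. of_bool (0 < code_drop z i))"

lemma code_drop: "code_drop (list_encode xs) i = list_encode (drop i xs)"
proof (induction i)
  case (Suc i)
  have "code_tl (list_encode (drop i xs)) = list_encode (drop (Suc i) xs)"
  proof (cases "drop i xs")
    case Nil
    then show ?thesis by (simp add: code_tl_def drop_Suc drop_tl)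
  next
    case (Cons y ys)
    then have "drop (Suc i) xs = ys" by (simp add: drop_Suc drop_tl)
    then show ?thesis using Cons code_hd_tl(2) by simp
  qed
  then show ?case using Suc by (simp add: code_drop_def)
qed (simp add: code_drop_def)

lemma code_nth: "i < length xs \<Longrightarrow> code_nth (list_encode xs) i = xs ! i"
  unfolding code_nth_def code_drop by (metis Cons_nth_drop_Suc code_hd_tl(1))

lemma length_le_list_encode: "length xs \<le> list_encode xs"
proof (induction xs)
  case (Cons x xs)
  then show ?case using le_prod_encode_2[of "list_encode xs" x] by simp
qed simp

lemma nth_le_list_encode: "i < length xs \<Longrightarrow> xs ! i \<le> list_encode xs"
proof (induction xs arbitrary: i)
  case (Cons x xs)
  show ?case
  proof (cases i)
    case 0
    then show ?thesis using le_prod_encode_1[of x "list_encode xs"] by simp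
  next
    case (Suc j)
    then have "xs ! j \<le> list_encode xs" using Cons by simp
    then show ?thesis using le_prod_encode_2[of "list_encode xs" x] Suc by simp
  qed
qed simp

lemma code_length: "code_length (list_encode xs) = length xs"
proof -
  have pos: "0 < list_encode ys \<longleftrightarrow> ys \<noteq> []" for ys by (cases ys) simp_all
  have "code_length (list_encode xs) = (\<Sum>i<list_encode xs. of_bool (i < length xs))"
    unfolding code_length_def code_drop pos by (intro sum.cong refl) auto
  also have "\<dots> = card ({..<list_encode xs} \<inter> {i. i < length xs})" by simp
  also have "{..<list_encode xs} \<inter> {i. i < length xs} = {..<length xs}"
    using length_le_list_encode[of xs] by auto
  finally show ?thesis by simp
qed

lemma computable_code_drop: "computable k f \<Longrightarrow> computable k g \<Longrightarrow> computable k (\<lambda>xs. code_drop (f xs) (g xs))"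
  unfolding code_drop_def by (intro computable_rec computable_code_tl computable_var) simp_all

lemma computable_code_nth: "computable k f \<Longrightarrow> computable k g \<Longrightarrow> computable k (\<lambda>xs. code_nth (f xs) (g xs))"
  unfolding code_nth_def by (intro computable_code_hd computable_code_drop)

lemma computable_code_length: "computable k f \<Longrightarrow> computable k (\<lambda>xs. code_length (f xs))"
  unfolding code_length_def
  by (rule computable_comp1[where h = "\<lambda>z. \<Sum>i<z. of_bool (0 < code_drop z i)"])
    (intro computable_intros computable_code_drop; simp)

section \<open>Patterns of lines at a vertex\<close>

text \<open>A pattern is the set of those passages \<open>(i, p)\<close> of lines through a vertex (the \<open>i\<close>-th word, read up
  to position \<open>p\<close>) to which a flow assigns \<open>1\<close>. Since the Cayley graph is a tree, patterns that fit
  along each edge can be put together to a flow.\<close>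

definition passages :: "letter list list \<Rightarrow> (nat \<times> nat) set" where
  "passages ws = {(i, p). i < length ws \<and> p \<le> length (ws ! i)}"

text \<open>Positions 0 and \<open>length (ws ! i)\<close> denote the same line seen in two
  consecutive periods, so they must agree. In the second clause every edge is inspected at its tail
  only, which is the case distinction of \<open>tail_pos\<close>; the sum is a natural number so
  that its parity can be decided arithmetically.\<close>

definition balanced_pattern :: "nat \<Rightarrow> letter list list \<Rightarrow> (nat \<times> nat) set \<Rightarrow> bool" where
  "balanced_pattern n ws P \<longleftrightarrow>
     (\<forall>i<length ws. (i, 0) \<in> P \<longleftrightarrow> (i, length (ws ! i)) \<in> P) \<and>
     (\<forall>j<n. even (\<Sum>i<length ws. \<Sum>p<length (ws ! i).
        of_bool (fst (ws ! i ! p) = j \<and> (i, if snd (ws ! i ! p) then p else Suc p) \<in> P) :: nat))"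

text \<open>\<open>P\<close> sits at a vertex \<open>h\<close> and \<open>P'\<close> at
  \<open>h * a\<close>. A letter \<open>a\<close> leads from \<open>h\<close> to
  \<open>h * a\<close> and the inverse letter leads back; in either case the two passages belong to
  one path and must agree.\<close>

definition fits :: "letter list list \<Rightarrow> letter \<Rightarrow> (nat \<times> nat) set \<Rightarrow> (nat \<times> nat) set \<Rightarrow> bool" where
  "fits ws a P P' \<longleftrightarrow> (\<forall>i<length ws. \<forall>p<length (ws ! i).
     (ws ! i ! p = a \<longrightarrow> ((i, p) \<in> P \<longleftrightarrow> (i, Suc p) \<in> P')) \<and>
     (ws ! i ! p = inv_letter a \<longrightarrow> ((i, p) \<in> P' \<longleftrightarrow> (i, Suc p) \<in> P)))"

text \<open>One successor in each direction is enough, since the same choice can be repeated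
  throughout the tree. A nonempty pattern in the set excludes the zero flow.\<close>

definition tiling :: "nat \<Rightarrow> letter list list \<Rightarrow> (nat \<times> nat) set set \<Rightarrow> bool" where
  "tiling n ws \<P> \<longleftrightarrow> \<P> \<subseteq> Pow (passages ws) \<and> (\<exists>P\<in>\<P>. P \<noteq> {}) \<and>
     (\<forall>P\<in>\<P>. balanced_pattern n ws P \<and> (\<forall>a\<in>letters n. \<exists>P'\<in>\<P>. fits ws a P P'))"

lemma fits_inv: "fits ws (inv_letter a) P' P \<longleftrightarrow> fits ws a P P'"
  by (auto simp: fits_def)

lemma of_nat_bit_eq_0_iff: "of_nat m = (0::bit) \<longleftrightarrow> even m"
  by (induction m) (auto simp: bit_add_eq_0_iff)

context malnormal_words
begin

text \<open>The parity condition at an edge with tail \<open>h\<close> involves only starting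
  vertices whose paths pass through \<open>h\<close>, so it can be read off from the pattern at
  \<open>h\<close> alone.\<close>

lemma sum_flow_iff:
  assumes "\<And>i q. i < length ws \<Longrightarrow> q \<le> length (ws ! i) \<Longrightarrow>
      (\<phi> i (reduce (h @ inv_word (take q (ws ! i)))) = (1::bit)) \<longleftrightarrow> (i, q) \<in> P"
  shows "(\<Sum>q\<in>{q \<in> steps. fst (ws ! fst q ! snd q) = j}.
        \<phi> (fst q) (reduce (h @ inv_word (take (tail_pos (fst q) (snd q)) (ws ! fst q))))) = 0 \<longleftrightarrow>
     even (\<Sum>i<length ws. \<Sum>p<length (ws ! i).
        of_bool (fst (ws ! i ! p) = j \<and> (i, if snd (ws ! i ! p) then p else Suc p) \<in> P) :: nat)"
proof -
  let ?t = "\<lambda>i p. of_bool (fst (ws ! i ! p) = j \<and> (i, if snd (ws ! i ! p) then p else Suc p) \<in> P)"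
  have \<phi>: "\<phi> i (reduce (h @ inv_word (take (tail_pos i p) (ws ! i)))) =
      of_bool ((i, if snd (ws ! i ! p) then p else Suc p) \<in> P)"
    if "i < length ws" "p < length (ws ! i)" for i p
    using assms[OF that(1), of "tail_pos i p"] that(2)
    by (cases "\<phi> i (reduce (h @ inv_word (take (tail_pos i p) (ws ! i))))") (simp_all add: tail_pos_def)
  have "(\<Sum>q\<in>{q \<in> steps. fst (ws ! fst q ! snd q) = j}.
        \<phi> (fst q) (reduce (h @ inv_word (take (tail_pos (fst q) (snd q)) (ws ! fst q))))) =
     (\<Sum>q\<in>steps. if fst (ws ! fst q ! snd q) = j then
        \<phi> (fst q) (reduce (h @ inv_word (take (tail_pos (fst q) (snd q)) (ws ! fst q)))) else 0)"
    by (rule sum.inter_filter[OF finite_steps])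
  also have "\<dots> = (\<Sum>q\<in>steps. ?t (fst q) (snd q))"
    by (intro sum.cong refl) (auto simp: steps_def \<phi>)
  also have "\<dots> = (\<Sum>i<length ws. \<Sum>p<length (ws ! i). ?t i p)"
    unfolding steps_def by (subst sum.Sigma) (simp_all add: case_prod_unfold)
  also have "\<dots> = of_nat (\<Sum>i<length ws. \<Sum>p<length (ws ! i). ?t i p)"
    by (simp only: of_nat_sum of_nat_of_bool)
  finally show ?thesis by (simp only: of_nat_bit_eq_0_iff)
qed

text \<open>The patterns left by the flow at all vertices form the required set. Moving to a
  neighbour lengthens or shortens the part of a word read so far by one letter, while the starting
  vertex of the path stays the same.\<close>

lemma tiling_of_even_flow:
  assumes \<phi>: "even_flow \<phi>" and nz: "i0 < length ws" "g0 \<in> carrier F" "\<phi> i0 g0 \<noteq> 0"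
  shows "\<exists>\<P>. tiling n ws \<P>"
proof -
  define \<psi> where "\<psi> h = {(i, p) \<in> passages ws. \<phi> i (reduce (h @ inv_word (take p (ws ! i)))) = 1}" for h
  have mem: "(i, p) \<in> \<psi> h \<longleftrightarrow> \<phi> i (reduce (h @ inv_word (take p (ws ! i)))) = 1"
    if "i < length ws" "p \<le> length (ws ! i)" for i p h
    using that by (simp add: \<psi>_def passages_def)
  have bal: "balanced_pattern n ws (\<psi> h)" if h: "h \<in> carrier F" for h
    unfolding balanced_pattern_def
  proof (intro conjI allI impI)
    fix i assume i: "i < length ws"
    have h': "reduce (h @ inv_word (ws ! i)) \<in> carrier F"
      using h letters_nth[OF i] by (intro mult_in_carrier) (simp_all add: set_inv_word)
    have "\<phi> i (reduce (reduce (h @ inv_word (ws ! i)) @ ws ! i)) = \<phi> i (reduce (h @ inv_word (ws ! i)))"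
      using \<phi> i h' unfolding even_flow_def by blast
    then show "(i, 0) \<in> \<psi> h \<longleftrightarrow> (i, length (ws ! i)) \<in> \<psi> h" using mem[OF i] by simp
  next
    fix j assume "j < n"
    then have "(\<Sum>q\<in>{q \<in> steps. fst (ws ! fst q ! snd q) = j}.
        \<phi> (fst q) (reduce (h @ inv_word (take (tail_pos (fst q) (snd q)) (ws ! fst q))))) = 0"
      using \<phi> h unfolding even_flow_def by blast
    then show "even (\<Sum>i<length ws. \<Sum>p<length (ws ! i).
        of_bool (fst (ws ! i ! p) = j \<and> (i, if snd (ws ! i ! p) then p else Suc p) \<in> \<psi> h) :: nat)"
      using sum_flow_iff[of \<phi> h "\<psi> h" j] mem by simp
  qed
  have fit: "fits ws a (\<psi> h) (\<psi> (reduce (h @ [a])))" for a h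
    unfolding fits_def
  proof (intro allI impI conjI)
    fix i p assume ip: "i < length ws" "p < length (ws ! i)"
    have t: "take (Suc p) (ws ! i) = take p (ws ! i) @ [ws ! i ! p]" using ip by (simp add: take_Suc_conv_app_nth)
    show "(i, p) \<in> \<psi> h \<longleftrightarrow> (i, Suc p) \<in> \<psi> (reduce (h @ [a]))" if a: "ws ! i ! p = a"
    proof -
      have "reduce (reduce (h @ [a]) @ inv_word (take (Suc p) (ws ! i)))
          = reduce (h @ ([a] @ inv_word [a]) @ inv_word (take p (ws ! i)))"
        using t a by (simp add: reduce_append_left)
      also have "\<dots> = reduce (h @ inv_word (take p (ws ! i)))" by (rule reduce_cancel_middle[OF reduce_inv_right])
      finally show ?thesis using mem[OF ip(1)] ip(2) by simp
    qed
    show "(i, p) \<in> \<psi> (reduce (h @ [a])) \<longleftrightarrow> (i, Suc p) \<in> \<psi> h" if a: "ws ! i ! p = inv_letter a"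
    proof -
      have "reduce (h @ inv_word (take (Suc p) (ws ! i))) = reduce (reduce (h @ [a]) @ inv_word (take p (ws ! i)))"
        using t a by (simp add: reduce_append_left)
      then show ?thesis using mem[OF ip(1)] ip(2) by simp
    qed
  qed
  have "tiling n ws (\<psi> ` carrier F)"
    unfolding tiling_def
  proof (intro conjI ballI)
    show "\<psi> ` carrier F \<subseteq> Pow (passages ws)" by (auto simp: \<psi>_def)
    have "\<phi> i0 g0 = 1" using nz(3) by (cases "\<phi> i0 g0") simp_all
    then have "(i0, 0) \<in> \<psi> g0" using mem[OF nz(1), of 0 g0] nz(2) by (simp add: carrier_free_group reduce_reduced)
    then show "\<exists>P\<in>\<psi> ` carrier F. P \<noteq> {}" using nz(2) by blast
  next
    fix P assume "P \<in> \<psi> ` carrier F"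
    then obtain h where h: "h \<in> carrier F" "P = \<psi> h" by blast
    then show "balanced_pattern n ws P" using bal by simp
    fix a assume "a \<in> letters n"
    then have "reduce (h @ [a]) \<in> carrier F" using h(1) by (intro mult_in_carrier) simp_all
    then show "\<exists>P'\<in>\<psi> ` carrier F. fits ws a P P'" using fit h(2) by blast
  qed
  then show ?thesis by (rule exI)
qed

text \<open>Successors are chosen along reduced words from the identity. Every edge joins a reduced
  word to an extension of it by one letter, so it fits by choice in one direction and by symmetry in
  the other.\<close>

lemma even_flow_of_tiling:
  assumes til: "tiling n ws \<P>"
  shows "\<exists>\<phi>. even_flow \<phi> \<and> (\<exists>i<length ws. \<exists>g\<in>carrier F. \<phi> i g \<noteq> 0)"
proof -
  obtain P0 where P0: "P0 \<in> \<P>" "P0 \<noteq> {}" using til unfolding tiling_def by blast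
  define nxt where "nxt P a = (SOME P'. P' \<in> \<P> \<and> fits ws a P P')" for P a
  have nxt: "nxt P a \<in> \<P>" "fits ws a P (nxt P a)" if "P \<in> \<P>" "a \<in> letters n" for P a
  proof -
    have "\<exists>P'. P' \<in> \<P> \<and> fits ws a P P'" using til that unfolding tiling_def by blast
    then have "nxt P a \<in> \<P> \<and> fits ws a P (nxt P a)" unfolding nxt_def by (rule someI_ex)
    then show "nxt P a \<in> \<P>" "fits ws a P (nxt P a)" by simp_all
  qed
  define \<psi> where "\<psi> v = foldl nxt P0 v" for v
  have \<psi>_in: "\<psi> v \<in> \<P>" if "set v \<subseteq> letters n" for v
    using that by (induction v rule: rev_induct) (simp_all add: \<psi>_def P0 nxt)
  have fit: "fits ws a (\<psi> h) (\<psi> (reduce (h @ [a])))" if h: "h \<in> carrier F" and a: "a \<in> letters n" for h a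
  proof (cases "h \<noteq> [] \<and> last h = inv_letter a")
    \<comment> \<open>The edge was laid from the shorter word with the inverse letter; symmetry of
      \<open>fits\<close> turns it round.\<close>
    case True
    then have hh: "h = butlast h @ [inv_letter a]" by (metis append_butlast_last_id)
    have red: "reduce (h @ [a]) = butlast h" using h True by (simp add: reduce_snoc carrier_free_group)
    have "set (butlast h) \<subseteq> letters n" using h by (auto simp: carrier_free_group dest: in_set_butlastD)
    then have "fits ws (inv_letter a) (\<psi> (butlast h)) (nxt (\<psi> (butlast h)) (inv_letter a))"
      using a by (intro nxt(2) \<psi>_in) simp_all
    also have "nxt (\<psi> (butlast h)) (inv_letter a) = \<psi> h" by (subst (2) hh) (simp add: \<psi>_def)
    finally show ?thesis unfolding red fits_inv .
  next
    case False
    then have "reduce (h @ [a]) = h @ [a]" using h by (auto simp: reduce_snoc carrier_free_group)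
    moreover have "set h \<subseteq> letters n" using h by (simp add: carrier_free_group)
    ultimately show ?thesis using nxt(2)[OF \<psi>_in a] by (simp add: \<psi>_def)
  qed
  have bal: "balanced_pattern n ws (\<psi> h)" if "h \<in> carrier F" for h
    using til \<psi>_in[of h] that unfolding tiling_def by (simp add: carrier_free_group)
  \<comment> \<open>The membership recorded at the start of a period is carried from vertex to
    vertex. Backtracking of an unreduced word does no harm, since every edge fits in both
    directions.\<close>
  have along: "(i, p) \<in> \<psi> (reduce (g @ take p (ws ! i))) \<longleftrightarrow> (i, 0) \<in> \<psi> g"
    if i: "i < length ws" and g: "g \<in> carrier F" and "p \<le> length (ws ! i)" for i p g
    using that(3)
  proof (induction p)
    case 0
    then show ?case using g by (simp add: carrier_free_group reduce_reduced)
  next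
    case (Suc p)
    let ?a = "ws ! i ! p" and ?h = "reduce (g @ take p (ws ! i))"
    have "?a \<in> set (ws ! i)" using Suc.prems by simp
    then have a: "?a \<in> letters n" using letters_nth[OF i] by (rule subsetD[rotated])
    have "fits ws ?a (\<psi> ?h) (\<psi> (reduce (?h @ [?a])))"
      by (rule fit[OF mult_in_carrier[OF g take_letters[OF i]] a])
    then have "(i, p) \<in> \<psi> ?h \<longleftrightarrow> (i, Suc p) \<in> \<psi> (reduce (?h @ [?a]))"
      using i Suc.prems unfolding fits_def by simp
    moreover have "reduce (?h @ [?a]) = reduce (g @ take (Suc p) (ws ! i))"
      using Suc.prems by (simp add: take_Suc_conv_app_nth reduce_append_left)
    ultimately show ?case using Suc by simp
  qed
  define \<phi> :: "nat \<Rightarrow> letter list \<Rightarrow> bit" where "\<phi> i g = of_bool ((i, 0) \<in> \<psi> g)" for i g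
  have \<phi>_mem: "\<phi> i (reduce (h @ inv_word (take q (ws ! i)))) = 1 \<longleftrightarrow> (i, q) \<in> \<psi> h"
    if i: "i < length ws" and q: "q \<le> length (ws ! i)" and h: "h \<in> carrier F" for i q h
  proof -
    let ?g = "reduce (h @ inv_word (take q (ws ! i)))"
    have "?g \<in> carrier F" using h take_letters[OF i] by (intro mult_in_carrier) (simp_all add: set_inv_word)
    moreover have "reduce (?g @ take q (ws ! i)) = h" using h by (simp add: carrier_free_group reduce_reduced)
    ultimately show ?thesis using along[OF i _ q, of ?g] by (simp add: \<phi>_def)
  qed
  have "even_flow \<phi>"
    unfolding even_flow_def
  proof (intro conjI allI impI ballI)
    fix i g assume i: "i < length ws" and g: "g \<in> carrier F"
    have g': "reduce (g @ ws ! i) \<in> carrier F" using g letters_nth[OF i] by (rule mult_in_carrier)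
    have "(i, 0) \<in> \<psi> (reduce (g @ ws ! i)) \<longleftrightarrow> (i, length (ws ! i)) \<in> \<psi> (reduce (g @ ws ! i))"
      using bal[OF g'] i unfolding balanced_pattern_def by blast
    also have "\<dots> \<longleftrightarrow> (i, 0) \<in> \<psi> g" using along[OF i g, of "length (ws ! i)"] by simp
    finally show "\<phi> i (reduce (g @ ws ! i)) = \<phi> i g" by (simp add: \<phi>_def)
  next
    fix h j assume h: "h \<in> carrier F" and j: "j < n"
    show "(\<Sum>q\<in>{q \<in> steps. fst (ws ! fst q ! snd q) = j}.
        \<phi> (fst q) (reduce (h @ inv_word (take (tail_pos (fst q) (snd q)) (ws ! fst q))))) = 0"
    proof (subst sum_flow_iff[of \<phi> h "\<psi> h"])
      show "even (\<Sum>i<length ws. \<Sum>p<length (ws ! i).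
        of_bool (fst (ws ! i ! p) = j \<and> (i, if snd (ws ! i ! p) then p else Suc p) \<in> \<psi> h) :: nat)"
        using bal[OF h] j unfolding balanced_pattern_def by blast
    qed (use \<phi>_mem h in blast)
  qed
  moreover have "\<exists>i<length ws. \<exists>g\<in>carrier F. \<phi> i g \<noteq> 0"
  proof -
    \<comment> \<open>The nonempty pattern sits at the identity. A passage \<open>(i, p)\<close> in
      it belongs to the path that reaches the identity after \<open>p\<close> letters, and the flow
      is 1 at the start of that path.\<close>
    have "P0 \<subseteq> passages ws" using til P0(1) unfolding tiling_def by blast
    then obtain i p where ip: "(i, p) \<in> P0" "i < length ws" "p \<le> length (ws ! i)"
      using P0(2) by (auto simp: passages_def)
    have nil: "[] \<in> carrier F" by (simp add: carrier_free_group)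
    have "\<phi> i (reduce ([] @ inv_word (take p (ws ! i)))) = 1"
      using \<phi>_mem[OF ip(2,3) nil] ip(1) by (simp add: \<psi>_def)
    moreover have "reduce ([] @ inv_word (take p (ws ! i))) \<in> carrier F"
      using take_letters[OF ip(2)] by (intro mult_in_carrier nil) (simp add: set_inv_word)
    ultimately show ?thesis using ip(2) by (intro exI[of _ i] conjI bexI) simp_all
  qed
  ultimately show ?thesis by blast
qed

theorem trivial_cech_cohomology_iff_no_tiling:
  "trivial_group (cech_cohomology 1 (decomposition_space n (map reduce ws))) \<longleftrightarrow> \<not> (\<exists>\<P>. tiling n ws \<P>)"
  unfolding trivial_cech_cohomology_iff_no_even_flow
  using tiling_of_even_flow even_flow_of_tiling by metis

end

text \<open>Here \<open>c\<close> is the Goedel number of the list of words. The generator \<open>x_j\<close> has code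
  \<open>j + j + 1\<close> and its inverse has code \<open>j + j\<close>; the bound \<open>Suc c * Suc c\<close> suffices because a list is
  never longer than its code.\<close>

definition code_letter_at :: "nat \<Rightarrow> nat \<Rightarrow> nat \<Rightarrow> nat" where
  "code_letter_at c i p = code_nth (code_nth c i) p"

definition code_balanced :: "nat \<Rightarrow> nat \<Rightarrow> nat \<Rightarrow> bool" where
  "code_balanced n c P \<longleftrightarrow>
     (\<forall>i<code_length c. prod_encode (i, 0) \<in> set_decode P \<longleftrightarrow> prod_encode (i, code_length (code_nth c i)) \<in> set_decode P) \<and>
     (\<forall>j<n. \<exists>m<Suc c * Suc c. (\<Sum>i<code_length c. \<Sum>p<code_length (code_nth c i).
        of_bool ((code_letter_at c i p = j + j + 1 \<and> prod_encode (i, p) \<in> set_decode P) \<or>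
          (code_letter_at c i p = j + j \<and> prod_encode (i, Suc p) \<in> set_decode P))) = m + m)"

text \<open>\<open>a\<close> and \<open>a'\<close> stand for the codes of a letter and of its
  inverse; both are passed so that no inversion has to be computed.\<close>

definition code_fits :: "nat \<Rightarrow> nat \<Rightarrow> nat \<Rightarrow> nat \<Rightarrow> nat \<Rightarrow> bool" where
  "code_fits c a a' P P' \<longleftrightarrow> (\<forall>i<code_length c. \<forall>p<code_length (code_nth c i).
     (code_letter_at c i p = a \<longrightarrow> (prod_encode (i, p) \<in> set_decode P \<longleftrightarrow> prod_encode (i, Suc p) \<in> set_decode P')) \<and>
     (code_letter_at c i p = a' \<longrightarrow> (prod_encode (i, p) \<in> set_decode P' \<longleftrightarrow> prod_encode (i, Suc p) \<in> set_decode P)))"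

definition code_tiling :: "nat \<Rightarrow> nat \<Rightarrow> nat \<Rightarrow> nat \<Rightarrow> bool" where
  "code_tiling n c b Q \<longleftrightarrow>
     (\<exists>P<b. P \<in> set_decode Q \<and> 0 < P) \<and>
     (\<forall>P<b. P \<in> set_decode Q \<longrightarrow>
        (\<forall>x<b. x \<in> set_decode P \<longrightarrow> (\<exists>i<code_length c. \<exists>p<Suc (code_length (code_nth c i)). x = prod_encode (i, p))) \<and>
        code_balanced n c P \<and>
        (\<forall>j<n. (\<exists>P'<b. P' \<in> set_decode Q \<and> code_fits c (j + j + 1) (j + j) P P') \<and>
               (\<exists>P'<b. P' \<in> set_decode Q \<and> code_fits c (j + j) (j + j + 1) P P')))"

text \<open>Both components of a passage are at most \<open>c\<close>, so passages have codes at
  most \<open>prod_encode (c, c)\<close> and patterns have codes below this number. Sets of patterns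
  are coded one exponential higher, below \<open>2 ^ code_bound c\<close>.\<close>

definition code_bound :: "nat \<Rightarrow> nat" where
  "code_bound c = 2 ^ Suc (prod_encode (c, c))"

lemma computable_code_letter_at:
  "computable k f \<Longrightarrow> computable k g \<Longrightarrow> computable k h \<Longrightarrow> computable k (\<lambda>xs. code_letter_at (f xs) (g xs) (h xs))"
  unfolding code_letter_at_def by (intro computable_code_nth)

lemmas code_intros = computable_intros computable_prod_encode decidable_mem computable_code_nth
  computable_code_length computable_code_letter_at

lemma decidable_code_tiling:
  "decidable 2 (\<lambda>xs. \<exists>Q<2 ^ code_bound (hd (tl xs)). code_tiling (hd xs) (hd (tl xs)) (code_bound (hd (tl xs))) Q)"
  unfolding code_tiling_def code_balanced_def code_fits_def code_bound_def
  by (intro code_intros; simp)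

section \<open>Correctness of the coded search\<close>

lemma set_encode_less:
  assumes "finite A" "\<And>x. x \<in> A \<Longrightarrow> x < m" shows "set_encode A < 2 ^ m"
proof -
  have "set_encode A \<le> (\<Sum>x<m. 2 ^ x)"
    unfolding set_encode_def using assms by (intro sum_mono2) auto
  also have "\<dots> = 2 ^ m - 1" by (metis atLeast0LessThan sum_power2)
  also have "\<dots> < 2 ^ m" by simp
  finally show ?thesis .
qed

lemma set_decode_less: "x \<in> set_decode P \<Longrightarrow> x < P"
proof -
  assume "x \<in> set_decode P"
  then have "P div 2 ^ x \<noteq> 0" by (auto simp: set_decode_def intro!: Nat.gr0I)
  then have "2 ^ x \<le> P" by (simp add: div_eq_0_iff)
  then show "x < P" using less_exp[of x] by (meson le_less_trans less_le_trans)
qed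

lemma triangle_mono: "m \<le> k \<Longrightarrow> triangle m \<le> triangle k"
  unfolding triangle_def by (intro div_le_mono mult_le_mono) simp_all

lemma prod_encode_mono: "i \<le> k \<Longrightarrow> p \<le> k \<Longrightarrow> prod_encode (i, p) \<le> prod_encode (k, k)"
  unfolding prod_encode_def using triangle_mono[of "i + p" "k + k"] by simp

definition pattern_of_code :: "nat \<Rightarrow> (nat \<times> nat) set" where
  "pattern_of_code P = {(i, p). prod_encode (i, p) \<in> set_decode P}"

context
  fixes ws :: "letter list list" and c :: nat
  assumes c: "c = encode_words ws"
begin

lemma code_length_words: "code_length c = length ws"
  by (simp add: c encode_words_def code_length)

lemma code_nth_words: "i < length ws \<Longrightarrow> code_nth c i = list_encode (map encode_letter (ws ! i))"
  by (simp add: c encode_words_def code_nth)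

lemma code_length_word: "i < length ws \<Longrightarrow> code_length (code_nth c i) = length (ws ! i)"
  by (simp add: code_nth_words code_length)

lemma code_letter_at_words:
  "i < length ws \<Longrightarrow> p < length (ws ! i) \<Longrightarrow> code_letter_at c i p = encode_letter (ws ! i ! p)"
  by (simp add: code_letter_at_def code_nth_words code_nth)

lemma length_words_le: "length ws \<le> c" "i < length ws \<Longrightarrow> length (ws ! i) \<le> c"
proof -
  show "length ws \<le> c"
    using length_le_list_encode[of "map (\<lambda>w. list_encode (map encode_letter w)) ws"] by (simp add: c encode_words_def)
  assume i: "i < length ws"
  have "length (ws ! i) \<le> list_encode (map encode_letter (ws ! i))"
    using length_le_list_encode[of "map encode_letter (ws ! i)"] by simp
  also have "\<dots> \<le> c"
    using nth_le_list_encode[of i "map (\<lambda>w. list_encode (map encode_letter w)) ws"] i by (simp add: c encode_words_def)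
  finally show "length (ws ! i) \<le> c" .
qed

lemma encode_letter_eq_iff:
  "encode_letter a = j + j + 1 \<longleftrightarrow> a = (j, True)" "encode_letter a = j + j \<longleftrightarrow> a = (j, False)"
proof -
  obtain i s where a: "a = (i, s)" by (cases a)
  show "encode_letter a = j + j + 1 \<longleftrightarrow> a = (j, True)" "encode_letter a = j + j \<longleftrightarrow> a = (j, False)"
    unfolding a encode_letter_def by (cases s; simp; presburger)+
qed

lemma code_balanced_iff: "code_balanced n c P \<longleftrightarrow> balanced_pattern n ws (pattern_of_code P)"
proof -
  have "(\<exists>m<Suc c * Suc c. (\<Sum>i<code_length c. \<Sum>p<code_length (code_nth c i).
        of_bool ((code_letter_at c i p = j + j + 1 \<and> prod_encode (i, p) \<in> set_decode P) \<or>
          (code_letter_at c i p = j + j \<and> prod_encode (i, Suc p) \<in> set_decode P))) = m + m) \<longleftrightarrow>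
     even (\<Sum>i<length ws. \<Sum>p<length (ws ! i).
        of_bool (fst (ws ! i ! p) = j \<and> (i, if snd (ws ! i ! p) then p else Suc p) \<in> pattern_of_code P) :: nat)" for j
  proof -
    define S :: nat where "S = (\<Sum>i<length ws. \<Sum>p<length (ws ! i).
        of_bool (fst (ws ! i ! p) = j \<and> (i, if snd (ws ! i ! p) then p else Suc p) \<in> pattern_of_code P))"
    have eq: "(\<Sum>i<code_length c. \<Sum>p<code_length (code_nth c i).
        of_bool ((code_letter_at c i p = j + j + 1 \<and> prod_encode (i, p) \<in> set_decode P) \<or>
          (code_letter_at c i p = j + j \<and> prod_encode (i, Suc p) \<in> set_decode P))) = S"
      unfolding S_def code_length_words
    proof (intro sum.cong refl)
      fix i assume "i \<in> {..<length ws}"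
      then have i: "i < length ws" by simp
      show "{..<code_length (code_nth c i)} = {..<length (ws ! i)}" by (simp add: code_length_word[OF i])
      fix p assume "p \<in> {..<length (ws ! i)}"
      then have p: "p < length (ws ! i)" by simp
      obtain k s where ks: "ws ! i ! p = (k, s)" by (cases "ws ! i ! p")
      show "of_bool ((code_letter_at c i p = j + j + 1 \<and> prod_encode (i, p) \<in> set_decode P) \<or>
          (code_letter_at c i p = j + j \<and> prod_encode (i, Suc p) \<in> set_decode P)) =
        of_bool (fst (ws ! i ! p) = j \<and> (i, if snd (ws ! i ! p) then p else Suc p) \<in> pattern_of_code P)"
        unfolding code_letter_at_words[OF i p] encode_letter_eq_iff ks
        by (cases s) (auto simp: pattern_of_code_def)
    qed
    \<comment> \<open>At most \<open>c\<close> words of length at most \<open>c\<close> contribute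
      at most \<open>c * c\<close>, so half of the sum lies within the search range.\<close>
    have "S \<le> (\<Sum>i<length ws. c)"
      unfolding S_def
    proof (rule sum_mono)
      fix i assume "i \<in> {..<length ws}"
      then have "length (ws ! i) \<le> c" using length_words_le(2) by simp
      moreover have "(\<Sum>p<length (ws ! i). of_bool (fst (ws ! i ! p) = j \<and>
          (i, if snd (ws ! i ! p) then p else Suc p) \<in> pattern_of_code P) :: nat) \<le> (\<Sum>p<length (ws ! i). 1)"
        by (rule sum_mono) simp
      ultimately show "(\<Sum>p<length (ws ! i). of_bool (fst (ws ! i ! p) = j \<and>
          (i, if snd (ws ! i ! p) then p else Suc p) \<in> pattern_of_code P)) \<le> c" by simp
    qed
    also have "\<dots> \<le> c * c" using length_words_le(1) by simp
    finally have le: "S \<le> c * c" .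
    have "(\<exists>m<Suc c * Suc c. S = m + m) \<longleftrightarrow> even S"
    proof
      assume "even S"
      then obtain m where m: "S = m + m" by (metis evenE mult_2)
      then have "m < Suc c * Suc c" using le by simp
      then show "\<exists>m<Suc c * Suc c. S = m + m" using m by blast
    qed auto
    then show ?thesis unfolding eq S_def[symmetric] .
  qed
  moreover have "(\<forall>i<code_length c. prod_encode (i, 0) \<in> set_decode P \<longleftrightarrow>
      prod_encode (i, code_length (code_nth c i)) \<in> set_decode P) \<longleftrightarrow>
     (\<forall>i<length ws. (i, 0) \<in> pattern_of_code P \<longleftrightarrow> (i, length (ws ! i)) \<in> pattern_of_code P)"
    unfolding code_length_words pattern_of_code_def by (auto simp: code_length_word)
  ultimately show ?thesis unfolding code_balanced_def balanced_pattern_def by simp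
qed

lemma code_fits_iff:
  "code_fits c (j + j + 1) (j + j) P P' \<longleftrightarrow> fits ws (j, True) (pattern_of_code P) (pattern_of_code P')"
  "code_fits c (j + j) (j + j + 1) P P' \<longleftrightarrow> fits ws (j, False) (pattern_of_code P) (pattern_of_code P')"
  unfolding code_fits_def fits_def code_length_words
  by (auto simp: code_length_word code_letter_at_words encode_letter_eq_iff[unfolded One_nat_def add_Suc_right add_0_right]
      encode_letter_eq_iff inv_letter_def pattern_of_code_def)

lemma ball_letters: "(\<forall>a\<in>letters n. Q a) \<longleftrightarrow> (\<forall>j<n. Q (j, True) \<and> Q (j, False))"
proof
  assume *: "\<forall>j<n. Q (j, True) \<and> Q (j, False)"
  show "\<forall>a\<in>letters n. Q a"
  proof
    fix a assume "a \<in> letters n"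
    then show "Q a" using * by (cases a; cases "snd a") (auto simp: letters_def)
  qed
qed (simp add: letters_def)

lemma finite_passages: "finite (passages ws)"
proof -
  have "passages ws = (SIGMA i:{..<length ws}. {..length (ws ! i)})" by (auto simp: passages_def)
  then show ?thesis by simp
qed

text \<open>Binary expansion is applied in two layers: sets of passages become numbers, and sets of
  these numbers become the candidates \<open>Q\<close>.\<close>

lemma code_tiling_iff: "(\<exists>Q<2 ^ code_bound c. code_tiling n c (code_bound c) Q) \<longleftrightarrow> (\<exists>\<P>. tiling n ws \<P>)"
proof
  assume "\<exists>Q<2 ^ code_bound c. code_tiling n c (code_bound c) Q"
  then obtain Q where Q: "code_tiling n c (code_bound c) Q" by blast
  let ?b = "code_bound c"
  define \<P> where "\<P> = pattern_of_code ` {P. P < ?b \<and> P \<in> set_decode Q}"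
  have pas: "x \<in> set_decode P \<Longrightarrow> x \<in> prod_encode ` passages ws" if P: "P < ?b" "P \<in> set_decode Q" for P x
  proof -
    assume x: "x \<in> set_decode P"
    \<comment> \<open>An element of a coded set is smaller than the code, so the bounded quantifier
      over \<open>x\<close> in \<open>code_tiling\<close> reaches all elements of
      \<open>P\<close>.\<close>
    then have "x < ?b" using set_decode_less[of x P] P(1) by simp
    then obtain i p where "i < code_length c" "p < Suc (code_length (code_nth c i))" "x = prod_encode (i, p)"
      using Q P x unfolding code_tiling_def by blast
    then show ?thesis by (simp add: code_length_words code_length_word passages_def less_Suc_eq_le)
  qed
  have "tiling n ws \<P>"
    unfolding tiling_def
  proof (intro conjI ballI)
    show "\<P> \<subseteq> Pow (passages ws)"
    proof -
      have "(i, p) \<in> passages ws" if "P < ?b" "P \<in> set_decode Q" "prod_encode (i, p) \<in> set_decode P" for P i p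
        using pas[OF that] by (simp add: inj_image_mem_iff[OF inj_prod_encode])
      then show ?thesis by (auto simp: \<P>_def pattern_of_code_def)
    qed
    obtain P where P: "P < ?b" "P \<in> set_decode Q" "0 < P" using Q unfolding code_tiling_def by blast
    then have "set_decode P \<noteq> {}" by (metis set_decode_inverse set_encode_empty less_irrefl)
    then obtain x where "x \<in> set_decode P" by blast
    moreover obtain i p where "x = prod_encode (i, p)" by (metis surj_prod_encode surj_def surj_pair)
    ultimately have "(i, p) \<in> pattern_of_code P" by (simp add: pattern_of_code_def)
    then show "\<exists>P\<in>\<P>. P \<noteq> {}" using P unfolding \<P>_def by blast
  next
    fix P' assume "P' \<in> \<P>"
    then obtain P where P: "P < ?b" "P \<in> set_decode Q" "P' = pattern_of_code P" unfolding \<P>_def by blast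
    then have ok: "code_balanced n c P \<and>
        (\<forall>j<n. (\<exists>P'<?b. P' \<in> set_decode Q \<and> code_fits c (j + j + 1) (j + j) P P') \<and>
               (\<exists>P'<?b. P' \<in> set_decode Q \<and> code_fits c (j + j) (j + j + 1) P P'))"
      using Q unfolding code_tiling_def by blast
    then show "balanced_pattern n ws P'" using P(3) code_balanced_iff by simp
    have "\<forall>a\<in>letters n. \<exists>R\<in>\<P>. fits ws a P' R"
      unfolding ball_letters P(3) \<P>_def using ok unfolding code_fits_iff by blast
    then show "\<exists>R\<in>\<P>. fits ws a P' R" if "a \<in> letters n" for a using that by blast
  qed
  then show "\<exists>\<P>. tiling n ws \<P>" by (rule exI)
next
  assume "\<exists>\<P>. tiling n ws \<P>"
  then obtain \<P> where \<P>: "tiling n ws \<P>" by (rule exE)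
  let ?b = "code_bound c"
  define enc where "enc P = set_encode (prod_encode ` P)" for P
  have sub: "P \<subseteq> passages ws" if "P \<in> \<P>" for P using \<P> that unfolding tiling_def by blast
  have fin: "finite P" if "P \<in> \<P>" for P using sub[OF that] finite_passages by (rule finite_subset)
  have dec: "set_decode (enc P) = prod_encode ` P" if "P \<in> \<P>" for P
    using fin[OF that] by (simp add: enc_def)
  have pat: "pattern_of_code (enc P) = P" if "P \<in> \<P>" for P
    unfolding pattern_of_code_def dec[OF that] by (simp add: inj_image_mem_iff[OF inj_prod_encode])
  have enc_less: "enc P < ?b" if P: "P \<in> \<P>" for P
    unfolding code_bound_def enc_def
  proof (rule set_encode_less)
    show "finite (prod_encode ` P)" using fin[OF P] by simp
    fix x assume "x \<in> prod_encode ` P"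
    then obtain i p where "x = prod_encode (i, p)" "(i, p) \<in> passages ws" using sub[OF P] by auto
    moreover from this have "i \<le> c" "p \<le> c"
      using length_words_le(1) length_words_le(2)[of i] by (auto simp: passages_def)
    ultimately show "x < Suc (prod_encode (c, c))" using prod_encode_mono[of i c p] by simp
  qed
  have "finite \<P>"
    using \<P> finite_passages unfolding tiling_def by (meson finite_Pow_iff finite_subset)
  then have finQ: "finite (enc ` \<P>)" by simp
  define Q where "Q = set_encode (enc ` \<P>)"
  have decQ: "set_decode Q = enc ` \<P>" using finQ by (simp add: Q_def)
  have "Q < 2 ^ ?b" unfolding Q_def using enc_less by (intro set_encode_less finQ) auto
  moreover have "code_tiling n c ?b Q"
    unfolding code_tiling_def
  proof (intro conjI)
    obtain P where P: "P \<in> \<P>" "P \<noteq> {}" using \<P> unfolding tiling_def by blast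
    have "set_decode (enc P) \<noteq> {}" using P dec[OF P(1)] by simp
    then have "0 < enc P" by (metis gr0I set_decode_zero)
    then show "\<exists>P<?b. P \<in> set_decode Q \<and> 0 < P" using P(1) enc_less[OF P(1)] decQ by blast
    show "\<forall>P<?b. P \<in> set_decode Q \<longrightarrow>
        (\<forall>x<?b. x \<in> set_decode P \<longrightarrow> (\<exists>i<code_length c. \<exists>p<Suc (code_length (code_nth c i)). x = prod_encode (i, p))) \<and>
        code_balanced n c P \<and>
        (\<forall>j<n. (\<exists>P'<?b. P' \<in> set_decode Q \<and> code_fits c (j + j + 1) (j + j) P P') \<and>
               (\<exists>P'<?b. P' \<in> set_decode Q \<and> code_fits c (j + j) (j + j + 1) P P'))"
    proof (intro allI impI)
      fix P' assume "P' < ?b" "P' \<in> set_decode Q"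
      then obtain P where P: "P \<in> \<P>" "P' = enc P" unfolding decQ by blast
      have 1: "\<exists>i<code_length c. \<exists>p<Suc (code_length (code_nth c i)). x = prod_encode (i, p)" if x: "x \<in> set_decode P'" for x
      proof -
        obtain i p where "x = prod_encode (i, p)" "(i, p) \<in> passages ws"
          using x sub[OF P(1)] unfolding P(2) dec[OF P(1)] by auto
        then show ?thesis
          by (intro exI[of _ i] exI[of _ p] conjI)
            (auto simp: passages_def code_length_words code_length_word)
      qed
      have bal: "code_balanced n c P'"
        using \<P> P unfolding tiling_def code_balanced_iff by (simp add: pat)
      have ft: "\<forall>j<n. (\<exists>R\<in>\<P>. fits ws (j, True) P R) \<and> (\<exists>R\<in>\<P>. fits ws (j, False) P R)"
        using \<P> P(1) unfolding tiling_def ball_letters by blast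
      have ex: "\<exists>P''<?b. P'' \<in> set_decode Q \<and> fits ws a P (pattern_of_code P'')" if a: "\<exists>R\<in>\<P>. fits ws a P R" for a
      proof -
        obtain R where R: "R \<in> \<P>" "fits ws a P R" using a by blast
        then show ?thesis using enc_less[OF R(1)] pat[OF R(1)] unfolding decQ by (intro exI[of _ "enc R"]) simp
      qed
      have 2: "\<forall>j<n. (\<exists>P''<?b. P'' \<in> set_decode Q \<and> code_fits c (j + j + 1) (j + j) P' P'') \<and>
               (\<exists>P''<?b. P'' \<in> set_decode Q \<and> code_fits c (j + j) (j + j + 1) P' P'')"
        unfolding code_fits_iff P(2) pat[OF P(1)] using ft ex by simp
      show "(\<forall>x<?b. x \<in> set_decode P' \<longrightarrow> (\<exists>i<code_length c. \<exists>p<Suc (code_length (code_nth c i)). x = prod_encode (i, p))) \<and>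
        code_balanced n c P' \<and>
        (\<forall>j<n. (\<exists>P''<?b. P'' \<in> set_decode Q \<and> code_fits c (j + j + 1) (j + j) P' P'') \<and>
               (\<exists>P''<?b. P'' \<in> set_decode Q \<and> code_fits c (j + j) (j + j + 1) P' P''))"
        using 1 bal 2 by (intro conjI allI impI) simp_all
    qed
  qed
  ultimately show "\<exists>Q<2 ^ ?b. code_tiling n c ?b Q" by blast
qed

end

theorem corollary6:
  shows "\<exists>algorithm. \<forall>n ws.
    (\<forall>w\<in>set ws. set w \<subseteq> letters n) \<longrightarrow>
    malnormal_family (free_group n) (map reduce ws) \<longrightarrow>
    rec_eval algorithm [n, encode_words ws]
      (if trivial_group (cech_cohomology 1 (decomposition_space n (map reduce ws))) then 1 else 0)"
proof -
  \<comment> \<open>One recursive function serves all inputs: it searches the finitely many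
    candidates and always halts. Malnormality enters when its answer is read as a statement on
    cohomology.\<close>
  obtain r where r: "\<forall>xs. length xs = 2 \<longrightarrow> rec_eval r xs (of_bool
      (\<not> (\<exists>Q<2 ^ code_bound (hd (tl xs)). code_tiling (hd xs) (hd (tl xs)) (code_bound (hd (tl xs))) Q)))"
    using decidable_not[OF decidable_code_tiling] unfolding decidable_def computable_def by (rule exE)
  show ?thesis
  proof (intro exI[of _ r] allI impI)
    fix n ws
    assume "\<forall>w\<in>set ws. set w \<subseteq> letters n" "malnormal_family (free_group n) (map reduce ws)"
    then interpret malnormal_words n ws by unfold_locales auto
    have "(if trivial_group (cech_cohomology 1 (decomposition_space n (map reduce ws))) then 1 else 0) =
        (of_bool (\<not> (\<exists>Q<2 ^ code_bound (encode_words ws).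
          code_tiling n (encode_words ws) (code_bound (encode_words ws)) Q)) :: nat)"
      unfolding trivial_cech_cohomology_iff_no_tiling code_tiling_iff[OF refl] by simp
    then show "rec_eval r [n, encode_words ws]
      (if trivial_group (cech_cohomology 1 (decomposition_space n (map reduce ws))) then 1 else 0)"
      using spec[OF r, of "[n, encode_words ws]"] by simp
  qed
qed

end
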